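(* The group, under tensor product, of equivalence classes of topological complex line bundles over the adelic projective line $\mathbb CP^1_{\mathbb Q}$ is isomorphic to $(\mathbb Q,+)$. The rational number $q$ associated to a complex line bundle $L_q$ is the first Chern number of the line bundle, and the first Chern number of the tensor product $L_{q_1}\otimes L_{q_2}$ is $q_1+q_2$.
   Context: For positive integers $n\mid m$ let $p_{n,m}$ be the map $z\mapsto z^{m/n}$. The adelic projective line is $\mathbb CP^1_{\mathbb Q}=\varprojlim\mathbb CP^1$, the inverse limit of copies of $\mathbb CP^1$ indexed by positive integers ordered by divisibility with bonding maps $p_{n,m}$ (branched at $0,\infty$); $\pi_n:\mathbb CP^1_{\mathbb Q}\to\mathbb CP^1$ is the projection to level $n$. The adelic solenoid is $S^1_{\mathbb Q}=\varprojlim S^1$ for the same maps restricted to $S^1$; its characters are $\chi_q$, $q\in\mathbb Q$, where $\chi_{m/n}(u)=\pi_n(u)^m$. $\mathbb CP^1_{\mathbb Q}$ is homeomorphic to the suspension of $S^1_{\mathbb Q}$. Every topological complex line bundle on $\mathbb CP^1_{\mathbb Q}$ is a pullback of the Hopf bundle $\mathcal O_{\mathbb CP^1}(1)$ by a map $\mathbb CP^1_{\mathbb Q}\to\mathbb CP^1\simeq S^2$ which is the suspension of a map $g:S^1_{\mathbb Q}\to S^1$; by Scheffer's theorem $g$ is homotopic to exactly one character $\chi_q$. This $q$ is the rational number associated to the line bundle, and the bundle is then denoted $L_q$; it is, by terminology, its first Chern number. In particular $\pi_n^*\mathcal O_{\mathbb CP^1}(m)$ has associated number $m/n$. *)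

theory Defs
  imports "HOL-Analysis.Analysis" "HOL-Algebra.Group"
begin

section \<open>Quotient topologies and inverse limits\<close>

definition quotient_topology :: "'a topology \<Rightarrow> ('a \<Rightarrow> 'b) \<Rightarrow> 'b topology" where
  "quotient_topology X q =
     topology (\<lambda>U. U \<subseteq> q ` topspace X \<and> openin X {x \<in> topspace X. q x \<in> U})"

lemma openin_quotient_topology:
  "openin (quotient_topology X q) U \<longleftrightarrow>
     U \<subseteq> q ` topspace X \<and> openin X {x \<in> topspace X. q x \<in> U}"
proof -
  have "istopology (\<lambda>U. U \<subseteq> q ` topspace X \<and> openin X {x \<in> topspace X. q x \<in> U})"
    unfolding istopology_def
  proof (intro conjI allI impI)
    fix S T
    assume S: "S \<subseteq> q ` topspace X \<and> openin X {x \<in> topspace X. q x \<in> S}"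
      and T: "T \<subseteq> q ` topspace X \<and> openin X {x \<in> topspace X. q x \<in> T}"
    show "S \<inter> T \<subseteq> q ` topspace X"
      using S by blast
    have "{x \<in> topspace X. q x \<in> S \<inter> T} = {x \<in> topspace X. q x \<in> S} \<inter> {x \<in> topspace X. q x \<in> T}"
      by blast
    then show "openin X {x \<in> topspace X. q x \<in> S \<inter> T}"
      using S T by (simp only: openin_Int)
  next
    fix K
    assume K: "\<forall>S\<in>K. S \<subseteq> q ` topspace X \<and> openin X {x \<in> topspace X. q x \<in> S}"
    show "\<Union> K \<subseteq> q ` topspace X"
      using K by blast
    have eq: "{x \<in> topspace X. q x \<in> \<Union> K} = (\<Union>S\<in>K. {x \<in> topspace X. q x \<in> S})"
      by blast
    show "openin X {x \<in> topspace X. q x \<in> \<Union> K}"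
      unfolding eq using K by (intro openin_Union) auto
  qed
  then show ?thesis
    by (simp add: quotient_topology_def)
qed

lemma topspace_quotient_topology: "topspace (quotient_topology X q) = q ` topspace X"
proof -
  have "{x \<in> topspace X. q x \<in> q ` topspace X} = topspace X"
    by blast
  then have "openin (quotient_topology X q) (q ` topspace X)"
    by (simp add: openin_quotient_topology)
  then have "q ` topspace X \<subseteq> topspace (quotient_topology X q)"
    by (rule openin_subset)
  moreover have "topspace (quotient_topology X q) \<subseteq> q ` topspace X"
    using openin_topspace [of "quotient_topology X q"] unfolding openin_quotient_topology
    by (rule conjunct1)
  ultimately show ?thesis
    by (rule subset_antisym [rotated])
qed

lemma quotient_map_quotient_topology: "quotient_map X (quotient_topology X q) q"
  unfolding quotient_map_def topspace_quotient_topology openin_quotient_topology by blast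

text \<open>When \<open>r i j\<close>, the bonding map \<open>p i j\<close> goes from \<open>X j\<close> to \<open>X i\<close>.\<close>

definition inverse_limit ::
    "'i set \<Rightarrow> ('i \<Rightarrow> 'i \<Rightarrow> bool) \<Rightarrow> ('i \<Rightarrow> 'a topology) \<Rightarrow> ('i \<Rightarrow> 'i \<Rightarrow> 'a \<Rightarrow> 'a)
       \<Rightarrow> ('i \<Rightarrow> 'a) topology" where
  "inverse_limit I r X p =
     subtopology (product_topology X I) {x. \<forall>i\<in>I. \<forall>j\<in>I. r i j \<longrightarrow> p i j (x j) = x i}"


section \<open>The adelic solenoid and the adelic projective line\<close>

type_synonym cp1_point = "(complex \<times> complex) set"

definition proj_line :: "complex \<times> complex \<Rightarrow> cp1_point" where
  "proj_line v = {(c * fst v, c * snd v) | c. True}"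

text \<open>The complex projective line is the space of lines through the origin of
  \<open>\<complex>\<^sup>2\<close>. The affine coordinate is \<open>z = z\<^sub>0 / z\<^sub>1\<close>, so that \<open>0\<close> is the line through
  \<open>(0, 1)\<close> and \<open>\<infinity>\<close> the line through \<open>(1, 0)\<close>.\<close>

definition CP1 :: "cp1_point topology" where
  "CP1 = quotient_topology (top_of_set (- {0})) proj_line"

text \<open>The map \<open>z \<mapsto> z ^ k\<close> for \<open>k > 0\<close>, that is, \<open>[z\<^sub>0 : z\<^sub>1] \<mapsto> [z\<^sub>0 ^ k : z\<^sub>1 ^ k]\<close>; as
  \<open>k\<close>-th powers exhaust the complex numbers, the image of a line is a whole line.\<close>

definition cp1_power :: "nat \<Rightarrow> cp1_point \<Rightarrow> cp1_point" where
  "cp1_power k l = (\<lambda>(z, w). (z ^ k, w ^ k)) ` l"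

lemma cp1_power_proj_line:
  assumes "k > 0"
  shows "cp1_power k (proj_line (z, w)) = proj_line (z ^ k, w ^ k)"
proof -
  have root: "\<exists>c. d = c ^ k" for d :: complex
  proof (cases "d = 0")
    case True
    then have "d = 0 ^ k" using assms by simp
    then show ?thesis by blast
  next
    case False
    have "exp (Ln d / of_nat k) ^ k = exp (of_nat k * (Ln d / of_nat k))"
      by (rule exp_of_nat_mult [symmetric])
    also have "\<dots> = d" using assms False by simp
    finally show ?thesis by metis
  qed
  show ?thesis
  proof (intro equalityI subsetI)
    fix v assume "v \<in> cp1_power k (proj_line (z, w))"
    then obtain c where "v = ((c * z) ^ k, (c * w) ^ k)"
      by (auto simp: cp1_power_def proj_line_def)
    then have "v = (c ^ k * z ^ k, c ^ k * w ^ k)"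
      by (simp add: power_mult_distrib)
    then show "v \<in> proj_line (z ^ k, w ^ k)"
      by (auto simp: proj_line_def)
  next
    fix v assume "v \<in> proj_line (z ^ k, w ^ k)"
    then obtain d where v: "v = (d * z ^ k, d * w ^ k)"
      by (auto simp: proj_line_def)
    obtain c where "d = c ^ k" using root by blast
    then have "v = (\<lambda>(z, w). (z ^ k, w ^ k)) (c * z, c * w)"
      by (simp add: v power_mult_distrib)
    then show "v \<in> cp1_power k (proj_line (z, w))"
      unfolding cp1_power_def by (rule image_eqI) (auto simp: proj_line_def)
  qed
qed

definition CP1_Q :: "(nat \<Rightarrow> cp1_point) topology" where
  "CP1_Q = inverse_limit {0<..} (dvd) (\<lambda>_. CP1) (\<lambda>n m. cp1_power (m div n))"

definition S1 :: "complex topology" where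
  "S1 = top_of_set (sphere 0 1)"

definition S1_Q :: "(nat \<Rightarrow> complex) topology" where
  "S1_Q = inverse_limit {0<..} (dvd) (\<lambda>_. S1) (\<lambda>n m z. z ^ (m div n))"

definition solenoid_character :: "rat \<Rightarrow> (nat \<Rightarrow> complex) \<Rightarrow> complex" where
  "solenoid_character q u = (case quotient_of q of (m, n) \<Rightarrow> u (nat n) powi m)"

text \<open>The homeomorphisms from the suspensions of \<open>S1\<close> and of \<open>S1_Q\<close> to \<open>CP1\<close> and to
  \<open>CP1_Q\<close>, in the suspension coordinate \<open>s\<close> from \<open>0\<close> to \<open>1\<close>: a point \<open>(u, s)\<close> has affine
  coordinate \<open>(s / (1 - s)) * u\<close> in \<open>CP1\<close>, and \<open>(s / (1 - s)) powr (1 / n) * u n\<close> at level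
  \<open>n\<close> of \<open>CP1_Q\<close>. The ends \<open>s = 0\<close> and \<open>s = 1\<close> are collapsed to the points \<open>0\<close> and \<open>\<infinity>\<close>.\<close>

definition susp_S1 :: "complex \<Rightarrow> real \<Rightarrow> cp1_point" where
  "susp_S1 u s = proj_line (of_real s * u, of_real (1 - s))"

definition susp_S1_Q :: "(nat \<Rightarrow> complex) \<Rightarrow> real \<Rightarrow> (nat \<Rightarrow> cp1_point)" where
  "susp_S1_Q u s =
     (\<lambda>n\<in>{0<..}. proj_line (of_real (root n s) * u n, of_real (root n (1 - s))))"

text \<open>The suspension of \<open>g : S1_Q \<rightarrow> S1\<close>, as a map from \<open>CP1_Q\<close> to \<open>CP1\<close>.\<close>

definition suspension_map ::
    "((nat \<Rightarrow> complex) \<Rightarrow> complex) \<Rightarrow> (nat \<Rightarrow> cp1_point) \<Rightarrow> cp1_point" where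
  "suspension_map g x =
     (THE l. \<exists>u\<in>topspace S1_Q. \<exists>s\<in>{0..1}. x = susp_S1_Q u s \<and> l = susp_S1 (g u) s)"


section \<open>Topological complex line bundles\<close>

text \<open>The operations are meaningful only on the total space, and addition only on pairs of
  vectors in the same fibre.\<close>

record ('e, 'x) bundle_data =
  total_space :: "'e topology"
  proj :: "'e \<Rightarrow> 'x"
  fadd :: "'e \<Rightarrow> 'e \<Rightarrow> 'e"
  fscale :: "complex \<Rightarrow> 'e \<Rightarrow> 'e"

definition fibre :: "('e, 'x) bundle_data \<Rightarrow> 'x \<Rightarrow> 'e set" where
  "fibre E x = {v \<in> topspace (total_space E). proj E v = x}"

definition local_trivialisation ::
    "'x topology \<Rightarrow> ('e, 'x) bundle_data \<Rightarrow> 'x set \<Rightarrow> ('e \<Rightarrow> 'x \<times> complex) \<Rightarrow> bool" where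
  "local_trivialisation X E U h \<longleftrightarrow>
     homeomorphic_map (subtopology (total_space E) {v. proj E v \<in> U})
       (prod_topology (subtopology X U) euclidean) h \<and>
     (\<forall>x\<in>U \<inter> topspace X. \<forall>v\<in>fibre E x.
        fst (h v) = x \<and>
        (\<forall>w\<in>fibre E x. snd (h (fadd E v w)) = snd (h v) + snd (h w)) \<and>
        (\<forall>c. snd (h (fscale E c v)) = c * snd (h v)))"

text \<open>The vector space axioms for the fibres need not be required separately: a local
  trivialisation maps each fibre bijectively onto \<open>{x} \<times> \<complex>\<close> and carries the operations to
  those of \<open>\<complex>\<close>, so each fibre is a one-dimensional complex vector space.\<close>

definition line_bundle :: "'x topology \<Rightarrow> ('e, 'x) bundle_data \<Rightarrow> bool" where
  "line_bundle X E \<longleftrightarrow>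
     continuous_map (total_space E) X (proj E) \<and>
     (\<forall>x. \<forall>v\<in>fibre E x.
        (\<forall>w\<in>fibre E x. fadd E v w \<in> fibre E x) \<and> (\<forall>c. fscale E c v \<in> fibre E x)) \<and>
     (\<forall>x\<in>topspace X. \<exists>U h. openin X U \<and> x \<in> U \<and> local_trivialisation X E U h)"

text \<open>Isomorphism over the identity of the base.\<close>

definition bundle_iso :: "('e, 'x) bundle_data \<Rightarrow> ('f, 'x) bundle_data \<Rightarrow> bool" where
  "bundle_iso E F \<longleftrightarrow>
     (\<exists>h. homeomorphic_map (total_space E) (total_space F) h \<and>
        (\<forall>x. \<forall>v\<in>fibre E x.
           proj F (h v) = x \<and>
           (\<forall>w\<in>fibre E x. h (fadd E v w) = fadd F (h v) (h w)) \<and>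
           (\<forall>c. h (fscale E c v) = fscale F c (h v))))"

definition trivial_bundle :: "'x topology \<Rightarrow> ('x \<times> complex, 'x) bundle_data" where
  "trivial_bundle X =
     \<lparr> total_space = prod_topology X euclidean,
       proj = fst,
       fadd = (\<lambda>(x, a) (_, b). (x, a + b)),
       fscale = (\<lambda>c (x, a). (x, c * a)) \<rparr>"

definition pullback_bundle ::
    "'y topology \<Rightarrow> ('y \<Rightarrow> 'x) \<Rightarrow> ('e, 'x) bundle_data \<Rightarrow> ('y \<times> 'e, 'y) bundle_data" where
  "pullback_bundle Y f E =
     \<lparr> total_space = subtopology (prod_topology Y (total_space E)) {(y, v). proj E v = f y},
       proj = fst,
       fadd = (\<lambda>(y, v) (_, w). (y, fadd E v w)),
       fscale = (\<lambda>c (y, v). (y, fscale E c v)) \<rparr>"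

text \<open>For finite-dimensional spaces, the tensor product of \<open>V\<close> and \<open>W\<close> is the dual of the
  space of bilinear forms on \<open>V \<times> W\<close>, with \<open>v \<otimes> w\<close> the evaluation of a form at \<open>(v, w)\<close>.
  For lines every tensor is of the form \<open>v \<otimes> w\<close>, so the total space of the tensor product
  of two line bundles is the image of their fibre product under \<open>(v, w) \<mapsto> v \<otimes> w\<close>; it gets
  the quotient topology.\<close>

definition bilinear_forms ::
    "('e, 'x) bundle_data \<Rightarrow> ('f, 'x) bundle_data \<Rightarrow> 'x \<Rightarrow> ('e \<Rightarrow> 'f \<Rightarrow> complex) set" where
  "bilinear_forms E F x =
     {B. \<forall>v\<in>fibre E x. \<forall>w\<in>fibre F x.
           (\<forall>v'\<in>fibre E x. B (fadd E v v') w = B v w + B v' w) \<and>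
           (\<forall>w'\<in>fibre F x. B v (fadd F w w') = B v w + B v w') \<and>
           (\<forall>c. B (fscale E c v) w = c * B v w \<and> B v (fscale F c w) = c * B v w)}"

definition tensor_vec ::
    "('e, 'x) bundle_data \<Rightarrow> ('f, 'x) bundle_data \<Rightarrow> 'e \<times> 'f \<Rightarrow> 'x \<times> (('e \<Rightarrow> 'f \<Rightarrow> complex) \<Rightarrow> complex)"
  where
  "tensor_vec E F = (\<lambda>(v, w). (proj E v, \<lambda>B\<in>bilinear_forms E F (proj E v). B v w))"

definition tensor_bundle ::
    "('e, 'x) bundle_data \<Rightarrow> ('f, 'x) bundle_data
       \<Rightarrow> ('x \<times> (('e \<Rightarrow> 'f \<Rightarrow> complex) \<Rightarrow> complex), 'x) bundle_data" where
  "tensor_bundle E F =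
     \<lparr> total_space =
         quotient_topology
           (subtopology (prod_topology (total_space E) (total_space F)) {(v, w). proj E v = proj F w})
           (tensor_vec E F),
       proj = fst,
       fadd = (\<lambda>(x, s) (_, t). (x, \<lambda>B\<in>bilinear_forms E F x. s B + t B)),
       fscale = (\<lambda>c (x, s). (x, \<lambda>B\<in>bilinear_forms E F x. c * s B)) \<rparr>"

text \<open>The isomorphism classes are formed inside the type of bundles whose total space has
  points of type \<open>'x \<times> complex\<close>. Nothing is lost: choosing a nonzero vector in each fibre
  identifies the total space of any line bundle over \<open>X\<close>, as a set, with
  \<open>topspace X \<times> UNIV\<close>. In \<open>bundle_class\<close> the given bundle may have points of any type.\<close>

definition bundle_class ::
    "'x topology \<Rightarrow> ('e, 'x) bundle_data \<Rightarrow> ('x \<times> complex, 'x) bundle_data set" where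
  "bundle_class X E = {F. line_bundle X F \<and> bundle_iso F E}"

definition line_bundle_group :: "'x topology \<Rightarrow> ('x \<times> complex, 'x) bundle_data set monoid" where
  "line_bundle_group X =
     \<lparr> carrier = {bundle_class X E | E :: ('x \<times> complex, 'x) bundle_data. line_bundle X E},
       monoid.mult = (\<lambda>a b. \<Union>E\<in>a. \<Union>F\<in>b. bundle_class X (tensor_bundle E F)),
       one = bundle_class X (trivial_bundle X) \<rparr>"

definition rational_group :: "rat monoid" where
  "rational_group = \<lparr> carrier = UNIV, monoid.mult = (+), one = 0 \<rparr>"


section \<open>The first Chern number\<close>

text \<open>The Hopf bundle is the dual of the tautological bundle: a vector over the line \<open>l\<close> is a
  linear functional on \<open>l\<close>. Its total space is a quotient of the trivial bundle whose fibre
  is the space of linear functionals on \<open>\<complex>\<^sup>2\<close>, by restriction of functionals to \<open>l\<close>.\<close>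

definition hopf_bundle :: "(cp1_point \<times> (complex \<times> complex \<Rightarrow> complex), cp1_point) bundle_data" where
  "hopf_bundle =
     \<lparr> total_space =
         quotient_topology (prod_topology CP1 (euclidean :: (complex \<times> complex) topology))
           (\<lambda>(l, (a, b)). (l, \<lambda>v\<in>l. a * fst v + b * snd v)),
       proj = fst,
       fadd = (\<lambda>(l, \<phi>) (_, \<psi>). (l, \<lambda>v\<in>l. \<phi> v + \<psi> v)),
       fscale = (\<lambda>c (l, \<phi>). (l, \<lambda>v\<in>l. c * \<phi> v)) \<rparr>"

definition associated_rational :: "('e, nat \<Rightarrow> cp1_point) bundle_data \<Rightarrow> rat \<Rightarrow> bool" where
  "associated_rational E q \<longleftrightarrow>
     (\<exists>g. continuous_map S1_Q S1 g \<and>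
          bundle_iso E (pullback_bundle CP1_Q (suspension_map g) hopf_bundle) \<and>
          homotopic_with (\<lambda>_. True) S1_Q S1 g (solenoid_character q))"

definition first_chern_number :: "('e, nat \<Rightarrow> cp1_point) bundle_data \<Rightarrow> rat" where
  "first_chern_number E = (THE q. associated_rational E q)"

end

theory Submission
  imports Defs
begin

text \<open>
  The adelic projective line is the suspension of the solenoid. Cut along the equator \<open>s = 1/2\<close>, it
  becomes the union of two closed cones over the solenoid, each containing one pole.

  A line bundle over a cone has a nowhere vanishing section (\<open>frame_on_slice\<close>): a vector at the pole
  is transported along the rays. For this, the charts of the bundle are averaged to a continuous
  family of linear maps between all fibres, which are invertible between nearby fibres, and finitely
  many of these are composed (\<open>transport_along_homotopy\<close>). A bundle is therefore described by the ratio
  \<open>t\<close> of two such sections on the equator, a map from the solenoid to the punctured plane.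

  Other sections multiply \<open>t\<close> by functions without zeros that extend over a cone. On the equator they
  have logarithms, since the cone can be contracted. Conversely, \<open>t\<close> and \<open>t \<cdot> exp L\<close> describe isomorphic
  bundles, since \<open>L\<close> extends to the whole space after multiplication with a function of \<open>s\<close> that
  vanishes at the poles. So the isomorphism classes correspond to the maps from the solenoid to the
  punctured plane modulo exponentials (\<open>clutching_of_bundle_iso\<close>, \<open>bundle_iso_of_clutching\<close>).

  By Scheffer's theorem each such class contains exactly one character. Existence
  (\<open>solenoid_map_log\<close>): by the theorem of Stone and Weierstrass, \<open>t\<close> can be approximated by a function
  of one coordinate, and a map from the circle to the punctured plane is a power times an
  exponential. Uniqueness (\<open>solenoid_character_has_log\<close>): a logarithm of a character would be linear
  along the real line in the solenoid, but it is bounded.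

  The index \<open>q\<close> of this character is the associated rational, because the pullback of the Hopf bundle by
  the suspension of \<open>g\<close> is described by \<open>t = g\<close>; it takes all rational values for the same reason. It is
  additive because tensor products multiply the functions \<open>t\<close>, and the product of the characters with
  indices \<open>q\<close> and \<open>r\<close> is the one with index \<open>q + r\<close>.
\<close>

section \<open>Line bundles in coordinates\<close>

text \<open>A local trivialisation, reduced to the fibre coordinate \<open>k\<close> and its inverse \<open>g x\<close> on the fibre
  over \<open>x\<close>. As \<open>k\<close> is injective on each fibre and carries the operations to those of \<open>\<complex>\<close>, every
  identity between vectors of one fibre becomes an identity between complex numbers.\<close>

definition chart ::
    "'x topology \<Rightarrow> ('e, 'x) bundle_data \<Rightarrow> 'x set \<Rightarrow> ('e \<Rightarrow> complex) \<Rightarrow> ('x \<Rightarrow> complex \<Rightarrow> 'e) \<Rightarrow> bool"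
  where
  "chart X E U k g \<longleftrightarrow>
     openin X U \<and>
     continuous_map (subtopology (total_space E) {v. proj E v \<in> U}) euclidean k \<and>
     continuous_map (prod_topology (subtopology X U) euclidean) (total_space E) (\<lambda>(x, c). g x c) \<and>
     (\<forall>x\<in>U. \<forall>c. g x c \<in> fibre E x \<and> k (g x c) = c) \<and>
     (\<forall>x\<in>U. \<forall>v\<in>fibre E x. g x (k v) = v \<and>
        (\<forall>w\<in>fibre E x. k (fadd E v w) = k v + k w) \<and> (\<forall>c. k (fscale E c v) = c * k v))"

lemma continuous_map_locally:
  assumes "\<And>z. z \<in> topspace Z \<Longrightarrow> \<exists>W. openin Z W \<and> z \<in> W \<and> continuous_map (subtopology Z W) Y f"
  shows "continuous_map Z Y f"
proof -
  obtain W where W: "\<And>z. z \<in> topspace Z \<Longrightarrow>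
      openin Z (W z) \<and> z \<in> W z \<and> continuous_map (subtopology Z (W z)) Y f"
    using assms by metis
  show ?thesis
    by (rule pasting_lemma [of "topspace Z" Z W Y "\<lambda>_. f" f]) (use W in blast)+
qed

lemma continuous_map_in_topspace:
  "continuous_map X Y f \<Longrightarrow> x \<in> topspace X \<Longrightarrow> f x \<in> topspace Y"
  using continuous_map_image_subset_topspace by blast

lemma subtopology_cong:
  assumes "\<And>z. z \<in> topspace Z \<Longrightarrow> z \<in> S \<longleftrightarrow> z \<in> T"
  shows "subtopology Z S = subtopology Z T"
proof -
  have "topspace Z \<inter> S = topspace Z \<inter> T" using assms by blast
  then show ?thesis using subtopology_restrict by metis
qed

lemma fibreD:
  assumes "v \<in> fibre E x"
  shows "v \<in> topspace (total_space E)" "proj E v = x"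
  using assms by (auto simp: fibre_def)

lemma fibreI: "v \<in> topspace (total_space E) \<Longrightarrow> v \<in> fibre E (proj E v)"
  by (simp add: fibre_def)

lemma line_bundle_proj: "line_bundle X E \<Longrightarrow> continuous_map (total_space E) X (proj E)"
  by (simp add: line_bundle_def)

lemma fibre_base:
  assumes "line_bundle X E" "v \<in> fibre E x"
  shows "x \<in> topspace X"
  using continuous_map_image_subset_topspace [OF line_bundle_proj [OF assms(1)]] fibreD [OF assms(2)]
  by blast

lemma fadd_in_fibre: "line_bundle X E \<Longrightarrow> v \<in> fibre E x \<Longrightarrow> w \<in> fibre E x \<Longrightarrow> fadd E v w \<in> fibre E x"
  by (simp add: line_bundle_def)

lemma fscale_in_fibre: "line_bundle X E \<Longrightarrow> v \<in> fibre E x \<Longrightarrow> fscale E c v \<in> fibre E x"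
  by (simp add: line_bundle_def)

lemma chartD:
  assumes "chart X E U k g"
  shows "openin X U"
    and "continuous_map (subtopology (total_space E) {v. proj E v \<in> U}) euclidean k"
    and "continuous_map (prod_topology (subtopology X U) euclidean) (total_space E) (\<lambda>(x, c). g x c)"
    and "\<And>x c. x \<in> U \<Longrightarrow> g x c \<in> fibre E x"
    and "\<And>x c. x \<in> U \<Longrightarrow> k (g x c) = c"
    and "\<And>x v. x \<in> U \<Longrightarrow> v \<in> fibre E x \<Longrightarrow> g x (k v) = v"
    and "\<And>x v w. x \<in> U \<Longrightarrow> v \<in> fibre E x \<Longrightarrow> w \<in> fibre E x \<Longrightarrow> k (fadd E v w) = k v + k w"
    and "\<And>x v c. x \<in> U \<Longrightarrow> v \<in> fibre E x \<Longrightarrow> k (fscale E c v) = c * k v"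
  using assms unfolding chart_def by blast+

lemma chart_inj:
  assumes "chart X E U k g" "x \<in> U" "v \<in> fibre E x" "w \<in> fibre E x" "k v = k w"
  shows "v = w"
  using chartD(6) [OF assms(1,2)] assms(3-5) by metis

lemma chart_of_local_trivialisation:
  assumes lt: "local_trivialisation X E U h" and U: "openin X U"
  shows "\<exists>k g. chart X E U k g"
proof -
  let ?EU = "subtopology (total_space E) {v. proj E v \<in> U}"
  let ?P = "prod_topology (subtopology X U) euclidean :: ('a \<times> complex) topology"
  have UX: "U \<subseteq> topspace X" by (rule openin_subset [OF U])
  obtain g where g: "homeomorphic_maps ?EU ?P h g"
    using lt unfolding local_trivialisation_def homeomorphic_map_maps by blast
  have h: "continuous_map ?EU ?P h" and gc: "continuous_map ?P ?EU g"
    and gh: "\<And>v. v \<in> topspace ?EU \<Longrightarrow> g (h v) = v" and hg: "\<And>y. y \<in> topspace ?P \<Longrightarrow> h (g y) = y"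
    using g by (auto simp: homeomorphic_maps_def)
  have lin: "\<And>x v. x \<in> U \<Longrightarrow> v \<in> fibre E x \<Longrightarrow> fst (h v) = x"
    "\<And>x v w. x \<in> U \<Longrightarrow> v \<in> fibre E x \<Longrightarrow> w \<in> fibre E x \<Longrightarrow> snd (h (fadd E v w)) = snd (h v) + snd (h w)"
    "\<And>x v c. x \<in> U \<Longrightarrow> v \<in> fibre E x \<Longrightarrow> snd (h (fscale E c v)) = c * snd (h v)"
    using lt UX unfolding local_trivialisation_def by blast+
  have gin: "g (x, c) \<in> topspace (total_space E)" "proj E (g (x, c)) \<in> U" if "x \<in> U" for x c
  proof -
    have "(x, c) \<in> topspace ?P" using that UX by auto
    then have "g (x, c) \<in> topspace ?EU"
      using continuous_map_image_subset_topspace [OF gc] by blast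
    then show "g (x, c) \<in> topspace (total_space E)" "proj E (g (x, c)) \<in> U" by auto
  qed
  have gf: "g (x, c) \<in> fibre E x" if "x \<in> U" for x c
  proof -
    have "(x, c) \<in> topspace ?P" using that UX by auto
    then have "h (g (x, c)) = (x, c)" by (rule hg)
    moreover have "fst (h (g (x, c))) = proj E (g (x, c))"
      using gin [OF that] by (intro lin(1) fibreI)
    ultimately show ?thesis using gin [OF that] by (simp add: fibre_def)
  qed
  have "chart X E U (\<lambda>v. snd (h v)) (\<lambda>x c. g (x, c))"
    unfolding chart_def
  proof (intro conjI ballI allI)
    show "openin X U" by (rule U)
    show "continuous_map ?EU euclidean (\<lambda>v. snd (h v))"
      using continuous_map_snd_of [OF h] by (simp add: o_def)
    show "continuous_map ?P (total_space E) (\<lambda>(x, c). g (x, c))"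
      using gc by (simp add: continuous_map_in_subtopology)
  next
    fix x c assume x: "x \<in> U"
    show "g (x, c) \<in> fibre E x" by (rule gf [OF x])
    show "snd (h (g (x, c))) = c" using hg [of "(x, c)"] x UX by auto
  next
    fix x v assume x: "x \<in> U" and v: "v \<in> fibre E x"
    have "(x, snd (h v)) = h v" using lin(1) [OF x v] by (metis prod.collapse)
    moreover have "v \<in> topspace ?EU" using fibreD [OF v] x by auto
    ultimately show "g (x, snd (h v)) = v" using gh by simp
  qed (use lin in blast)+
  then show ?thesis by blast
qed

lemma local_trivialisation_of_chart:
  assumes c: "chart X E U k g" and p: "continuous_map (total_space E) X (proj E)"
  shows "local_trivialisation X E U (\<lambda>v. (proj E v, k v))"
proof -
  let ?EU = "subtopology (total_space E) {v. proj E v \<in> U}"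
  let ?P = "prod_topology (subtopology X U) euclidean :: ('a \<times> complex) topology"
  have UX: "U \<subseteq> topspace X" by (rule openin_subset [OF chartD(1) [OF c]])
  have "homeomorphic_maps ?EU ?P (\<lambda>v. (proj E v, k v)) (\<lambda>(x, c). g x c)"
    unfolding homeomorphic_maps_def
  proof (intro conjI ballI)
    show "continuous_map ?EU ?P (\<lambda>v. (proj E v, k v))"
      by (intro continuous_map_pairedI continuous_map_into_subtopology
          continuous_map_from_subtopology [OF p] chartD(2) [OF c]) auto
    show "continuous_map ?P ?EU (\<lambda>(x, c). g x c)"
      using chartD(3)[OF c] chartD(4) [OF c] UX
      by (auto simp: continuous_map_in_subtopology fibre_def)
    show "(case (proj E v, k v) of (x, c) \<Rightarrow> g x c) = v" if "v \<in> topspace ?EU" for v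
      using that chartD(6) [OF c, of "proj E v" v] by (auto simp: fibre_def)
    show "(proj E (case y of (x, c) \<Rightarrow> g x c), k (case y of (x, c) \<Rightarrow> g x c)) = y" if "y \<in> topspace ?P" for y
      using that chartD(4,5) [OF c] UX by (auto simp: fibre_def)
  qed
  then show ?thesis
    unfolding local_trivialisation_def homeomorphic_map_maps
    using chartD(7,8) [OF c] by (auto simp: fibre_def)
qed

lemma line_bundle_chart:
  assumes "line_bundle X E" "x \<in> topspace X"
  obtains U k g where "x \<in> U" "chart X E U k g"
  using assms chart_of_local_trivialisation unfolding line_bundle_def by metis

lemma line_bundleI:
  assumes "continuous_map (total_space E) X (proj E)"
    and "\<And>x v w. v \<in> fibre E x \<Longrightarrow> w \<in> fibre E x \<Longrightarrow> fadd E v w \<in> fibre E x"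
    and "\<And>x v c. v \<in> fibre E x \<Longrightarrow> fscale E c v \<in> fibre E x"
    and "\<And>x. x \<in> topspace X \<Longrightarrow> \<exists>U k g. x \<in> U \<and> chart X E U k g"
  shows "line_bundle X E"
  unfolding line_bundle_def
  using assms local_trivialisation_of_chart chartD(1) by metis

lemma fibre_chart:
  assumes "line_bundle X E" "v \<in> fibre E x"
  obtains U k g where "x \<in> U" "chart X E U k g"
  using line_bundle_chart [OF assms(1) fibre_base [OF assms]] by blast

lemma chart_subset:
  assumes c: "chart X E U k g" and V: "openin X V" "V \<subseteq> U"
  shows "chart X E V k g"
proof -
  have 1: "continuous_map (subtopology (total_space E) {v. proj E v \<in> V}) euclidean k"
    by (rule continuous_map_from_subtopology_mono [OF chartD(2) [OF c]]) (use V in auto)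
  have "prod_topology (subtopology X V) euclidean
      = subtopology (prod_topology (subtopology X U) euclidean) (V \<times> (UNIV :: complex set))"
    using V by (simp add: subtopology_Times subtopology_subtopology inf.absorb2)
  then have "continuous_map (prod_topology (subtopology X V) euclidean) (total_space E) (\<lambda>(x, c). g x c)"
    using continuous_map_from_subtopology [OF chartD(3) [OF c]] by simp
  then show ?thesis
    using 1 V c unfolding chart_def by blast
qed

text \<open>The zero vector of a fibre is not part of the data of a bundle; it is the only vector fixed by
  multiplication with \<open>0\<close>.\<close>

definition nonzero_vector :: "('e, 'x) bundle_data \<Rightarrow> 'e \<Rightarrow> bool" where
  "nonzero_vector E v \<longleftrightarrow> fscale E 0 v \<noteq> v"

text \<open>The coordinate of \<open>v\<close> in the basis \<open>w\<close> of its fibre, for a nonzero \<open>w\<close>. Transition functions and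
  isomorphisms of line bundles are all expressed through it.\<close>

definition ratio :: "('e, 'x) bundle_data \<Rightarrow> 'e \<Rightarrow> 'e \<Rightarrow> complex" where
  "ratio E v w = (THE c. v = fscale E c w)"

lemma nonzero_chart:
  assumes lb: "line_bundle X E" and c: "chart X E U k g" and x: "x \<in> U" and v: "v \<in> fibre E x"
  shows "nonzero_vector E v \<longleftrightarrow> k v \<noteq> 0"
proof -
  have "k (fscale E 0 v) = 0" using chartD(8) [OF c x v] by simp
  then show ?thesis
    unfolding nonzero_vector_def
    using chart_inj [OF c x fscale_in_fibre [OF lb v] v] by metis
qed

lemma ratio_chart:
  assumes lb: "line_bundle X E" and c: "chart X E U k g" and x: "x \<in> U" and v: "v \<in> fibre E x"
    and w: "w \<in> fibre E x" "nonzero_vector E w"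
  shows "ratio E v w = k v / k w" and "v = fscale E (ratio E v w) w"
proof -
  have kw: "k w \<noteq> 0" using nonzero_chart [OF lb c x w(1)] w by simp
  have eq: "v = fscale E (k v / k w) w"
    by (rule chart_inj [OF c x v fscale_in_fibre [OF lb w(1)]])
      (use kw chartD(8) [OF c x w(1)] in simp)
  have "d = k v / k w" if "v = fscale E d w" for d
  proof -
    have "k v = d * k w" unfolding that by (rule chartD(8) [OF c x w(1)])
    then show ?thesis using kw by simp
  qed
  with eq show r: "ratio E v w = k v / k w"
    unfolding ratio_def by (rule the_equality)
  show "v = fscale E (ratio E v w) w"
    by (subst r) (rule eq)
qed

lemma
  assumes E: "line_bundle X E" and v: "v \<in> fibre E x"
  shows fscale_fscale: "fscale E a (fscale E b v) = fscale E (a * b) v"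
    and fscale_add: "fscale E (a + b) v = fadd E (fscale E a v) (fscale E b v)"
    and nonzero_fscale: "nonzero_vector E (fscale E c v) \<longleftrightarrow> c \<noteq> 0 \<and> nonzero_vector E v"
proof -
  obtain U k g where x: "x \<in> U" and c: "chart X E U k g" by (rule fibre_chart [OF E v])
  note sv = fscale_in_fibre [OF E v]
  show "fscale E a (fscale E b v) = fscale E (a * b) v"
    by (rule chart_inj [OF c x])
      (simp_all add: v sv fscale_in_fibre [OF E sv] chartD(8) [OF c x])
  show "fscale E (a + b) v = fadd E (fscale E a v) (fscale E b v)"
    by (rule chart_inj [OF c x])
      (simp_all add: v sv fadd_in_fibre [OF E] chartD(7,8) [OF c x] algebra_simps)
  show "nonzero_vector E (fscale E c v) \<longleftrightarrow> c \<noteq> 0 \<and> nonzero_vector E v" for c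
    using nonzero_chart [OF E c x] sv v chartD(8) [OF c x v] by simp
qed

lemma fscale_fadd:
  assumes "line_bundle X E" "v \<in> fibre E x" "w \<in> fibre E x"
  shows "fscale E a (fadd E v w) = fadd E (fscale E a v) (fscale E a w)"
proof -
  obtain U k g where c: "x \<in> U" "chart X E U k g" by (rule fibre_chart [OF assms(1,2)])
  show ?thesis
    by (rule chart_inj [OF c(2,1)])
      (use assms in \<open>simp_all add: fscale_in_fibre [OF assms(1)] fadd_in_fibre [OF assms(1)]
        chartD(7,8) [OF c(2,1)] algebra_simps\<close>)
qed

lemma
  assumes E: "line_bundle X E" and v: "v \<in> fibre E x" and w: "w \<in> fibre E x" "nonzero_vector E w"
  shows ratio_works: "fscale E (ratio E v w) w = v"
    and ratio_fscale: "ratio E (fscale E c v) w = c * ratio E v w"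
    and ratio_eq_0: "ratio E v w = 0 \<longleftrightarrow> \<not> nonzero_vector E v"
proof -
  obtain U k g where x: "x \<in> U" and c: "chart X E U k g" by (rule fibre_chart [OF E v])
  show "fscale E (ratio E v w) w = v"
    by (rule ratio_chart(2) [OF E c x v w, symmetric])
  show "ratio E (fscale E a v) w = a * ratio E v w" for a
    using ratio_chart(1) [OF E c x _ w] fscale_in_fibre [OF E v] v chartD(8) [OF c x v] by simp
  show "ratio E v w = 0 \<longleftrightarrow> \<not> nonzero_vector E v"
    using ratio_chart(1) [OF E c x v w] nonzero_chart [OF E c x] v w by simp
qed

lemma ratio_fscale_self:
  assumes "line_bundle X E" "w \<in> fibre E x" "nonzero_vector E w"
  shows "ratio E (fscale E c w) w = c"
proof -
  obtain U k g where c: "x \<in> U" "chart X E U k g" by (rule fibre_chart [OF assms(1,2)])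
  show ?thesis
    using ratio_chart(1) [OF assms(1) c(2,1) fscale_in_fibre [OF assms(1,2)] assms(2,3)]
     chartD(8) [OF c(2,1) assms(2)] nonzero_chart [OF assms(1) c(2,1) assms(2)] assms(3) by simp
qed

lemma ratio_fadd:
  assumes "line_bundle X E" "v \<in> fibre E x" "v' \<in> fibre E x" "w \<in> fibre E x" "nonzero_vector E w"
  shows "ratio E (fadd E v v') w = ratio E v w + ratio E v' w"
proof -
  obtain U k g where c: "x \<in> U" "chart X E U k g" by (rule fibre_chart [OF assms(1,2)])
  show ?thesis
    using ratio_chart(1) [OF assms(1) c(2,1) _ assms(4,5)] fadd_in_fibre [OF assms(1)] assms(2,3)
     chartD(7) [OF c(2,1)] by (simp add: add_divide_distrib)
qed

lemma ratio_ratio: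
  assumes "line_bundle X E" "v \<in> fibre E x" "w \<in> fibre E x" "w' \<in> fibre E x"
    "nonzero_vector E w" "nonzero_vector E w'"
  shows "ratio E v w * ratio E w w' = ratio E v w'"
  using ratio_fscale [OF assms(1,3,4,6), of "ratio E v w"] ratio_works [OF assms(1-3,5)] by simp

lemma nonzero_exists:
  assumes "line_bundle X E" "x \<in> topspace X"
  obtains v where "v \<in> fibre E x" "nonzero_vector E v"
proof -
  obtain U k g where c: "x \<in> U" "chart X E U k g" by (rule line_bundle_chart [OF assms])
  have "g x 1 \<in> fibre E x" "k (g x 1) = 1" using chartD(4,5) [OF c(2,1)] by auto
  then show ?thesis using that [of "g x 1"] nonzero_chart [OF assms(1) c(2,1)] by simp
qed

subsection \<open>Continuity\<close>

lemma continuous_map_apply: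
  assumes "continuous_on S h" "continuous_map X euclidean f" "\<And>x. x \<in> topspace X \<Longrightarrow> f x \<in> S"
  shows "continuous_map X euclidean (\<lambda>x. h (f x))"
proof -
  have "continuous_map X (top_of_set S) f"
    using assms by (intro continuous_map_into_subtopology) auto
  moreover have "continuous_map (top_of_set S) euclidean h"
    using assms(1) by simp
  ultimately show ?thesis
    using continuous_map_compose [of X "top_of_set S" f euclidean h] by (simp add: o_def)
qed

lemma continuous_map_apply2:
  assumes "continuous_on S (\<lambda>p. h (fst p) (snd p))"
    and "continuous_map X euclidean f" "continuous_map X euclidean g"
    and "\<And>x. x \<in> topspace X \<Longrightarrow> (f x, g x) \<in> S"
  shows "continuous_map X euclidean (\<lambda>x. h (f x) (g x))"
proof -
  have "continuous_map X euclidean (\<lambda>x. (f x, g x))"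
    using continuous_map_pairedI [OF assms(2,3)] by simp
  from continuous_map_apply [OF assms(1) this assms(4)] show ?thesis by simp
qed

lemma continuous_map_complex_mult:
  fixes f g :: "'a \<Rightarrow> complex"
  assumes "continuous_map X euclidean f" "continuous_map X euclidean g"
  shows "continuous_map X euclidean (\<lambda>x. f x * g x)"
  by (rule continuous_map_apply2 [where S = UNIV]) (auto intro!: continuous_intros assms)

lemma continuous_map_complex_divide:
  fixes f g :: "'a \<Rightarrow> complex"
  assumes "continuous_map X euclidean f" "continuous_map X euclidean g"
    and "\<And>x. x \<in> topspace X \<Longrightarrow> g x \<noteq> 0"
  shows "continuous_map X euclidean (\<lambda>x. f x / g x)"
  by (rule continuous_map_apply2 [where S = "UNIV \<times> (- {0})"]) (auto intro!: continuous_intros simp: assms)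

lemma continuous_coordinate:
  assumes c: "chart X E U k g" and f: "continuous_map Z (total_space E) f"
  shows "continuous_map (subtopology Z {z. proj E (f z) \<in> U}) euclidean (\<lambda>z. k (f z))"
proof -
  have "continuous_map (subtopology Z {z. proj E (f z) \<in> U})
      (subtopology (total_space E) {v. proj E v \<in> U}) f"
    by (intro continuous_map_into_subtopology continuous_map_from_subtopology f) auto
  from continuous_map_compose [OF this chartD(2) [OF c]] show ?thesis by (simp add: o_def)
qed

text \<open>For a total space with a quotient topology, continuity of a coordinate can be tested upstairs,
  because a quotient map restricted to the preimage of an open set is again a quotient map.\<close>

lemma continuous_coordinate_of_quotient:
  assumes q: "quotient_map W (total_space E) q" and p: "continuous_map (total_space E) X (proj E)"
    and U: "openin X U"
    and k: "continuous_map (subtopology W {w. proj E (q w) \<in> U}) euclidean (\<lambda>w. k (q w))"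
  shows "continuous_map (subtopology (total_space E) {v. proj E v \<in> U}) euclidean k"
proof -
  let ?V = "{v \<in> topspace (total_space E). proj E v \<in> U}"
  have V: "openin (total_space E) ?V"
    by (rule openin_continuous_map_preimage [OF p U])
  have "q w \<in> topspace (total_space E)" if "w \<in> topspace W" for w
    by (rule continuous_map_in_topspace [OF quotient_imp_continuous_map [OF q] that])
  then have e: "subtopology W {w \<in> topspace W. q w \<in> ?V} = subtopology W {w. proj E (q w) \<in> U}"
    by (intro subtopology_cong) simp
  have "quotient_map (subtopology W {w \<in> topspace W. q w \<in> ?V}) (subtopology (total_space E) ?V) q"
    by (rule quotient_map_restriction [OF q refl]) (rule disjI1 [OF V])
  then have "quotient_map (subtopology W {w. proj E (q w) \<in> U}) (subtopology (total_space E) ?V) q"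
    unfolding e .
  then have "continuous_map (subtopology (total_space E) ?V) euclidean k"
    by (rule continuous_compose_quotient_map) (use k in \<open>simp add: o_def\<close>)
  moreover have "subtopology (total_space E) ?V = subtopology (total_space E) {v. proj E v \<in> U}"
    by (rule subtopology_cong) auto
  ultimately show ?thesis by simp
qed

text \<open>Over the domain of a chart the bundle is a product, so a map into it is continuous as soon as
  its base point and its coordinate are.\<close>

lemma continuous_map_into_bundle:
  assumes lb: "line_bundle X E"
    and f: "\<And>z. z \<in> topspace Z \<Longrightarrow> f z \<in> topspace (total_space E)"
    and p: "continuous_map Z X (\<lambda>z. proj E (f z))"
    and loc: "\<And>U k g. chart X E U k g \<Longrightarrow>
       continuous_map (subtopology Z {z. proj E (f z) \<in> U}) euclidean (\<lambda>z. k (f z))"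
  shows "continuous_map Z (total_space E) f"
proof (rule continuous_map_locally)
  fix z assume z: "z \<in> topspace Z"
  then have "proj E (f z) \<in> topspace X"
    using continuous_map_image_subset_topspace [OF p] by blast
  then obtain U k g where U: "proj E (f z) \<in> U" and c: "chart X E U k g"
    using line_bundle_chart [OF lb] by blast
  let ?W = "{z \<in> topspace Z. proj E (f z) \<in> U}"
  have sub: "subtopology Z ?W = subtopology Z {z. proj E (f z) \<in> U}"
    by (rule subtopology_cong) auto
  have pw: "continuous_map (subtopology Z ?W) (prod_topology (subtopology X U) euclidean)
      (\<lambda>z. (proj E (f z), k (f z)))"
    by (intro continuous_map_pairedI continuous_map_into_subtopology continuous_map_from_subtopology [OF p])
      (use loc [OF c] sub in auto)
  have "continuous_map (subtopology Z ?W) (total_space E) (\<lambda>z. g (proj E (f z)) (k (f z)))"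
    using continuous_map_compose [OF pw chartD(3) [OF c]] by (simp add: o_def)
  then have "continuous_map (subtopology Z ?W) (total_space E) f"
    by (rule continuous_map_eq) (rule chartD(6) [OF c], use f in \<open>auto simp: fibre_def\<close>)
  moreover have "openin Z ?W"
    by (rule openin_continuous_map_preimage [OF p chartD(1) [OF c]])
  ultimately show "\<exists>W. openin Z W \<and> z \<in> W \<and> continuous_map (subtopology Z W) (total_space E) f"
    using z U by blast
qed

lemma continuous_map_proj:
  assumes "line_bundle X E" "continuous_map Z (total_space E) f"
  shows "continuous_map Z X (\<lambda>z. proj E (f z))"
  using continuous_map_compose [OF assms(2) line_bundle_proj [OF assms(1)]] by (simp add: o_def)

lemma continuous_fscale:
  assumes lb: "line_bundle X E" and f: "continuous_map Z (total_space E) f"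
    and a: "continuous_map Z euclidean a"
  shows "continuous_map Z (total_space E) (\<lambda>z. fscale E (a z) (f z))"
proof (rule continuous_map_into_bundle [OF lb])
  have fz: "f z \<in> fibre E (proj E (f z))" if "z \<in> topspace Z" for z
    by (rule fibreI [OF continuous_map_in_topspace [OF f that]])
  have pr: "proj E (fscale E (a z) (f z)) = proj E (f z)" if "z \<in> topspace Z" for z
    using fscale_in_fibre [OF lb fz [OF that]] by (rule fibreD)
  show "fscale E (a z) (f z) \<in> topspace (total_space E)" if "z \<in> topspace Z" for z
    using fscale_in_fibre [OF lb fz [OF that]] by (rule fibreD)
  show "continuous_map Z X (\<lambda>z. proj E (fscale E (a z) (f z)))"
    by (rule continuous_map_eq [OF continuous_map_proj [OF lb f]]) (simp add: pr)
  fix U k g assume c: "chart X E U k g"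
  have "subtopology Z {z. proj E (fscale E (a z) (f z)) \<in> U} = subtopology Z {z. proj E (f z) \<in> U}"
    by (rule subtopology_cong) (use pr in auto)
  moreover have "continuous_map (subtopology Z {z. proj E (f z) \<in> U}) euclidean (\<lambda>z. a z * k (f z))"
    by (intro continuous_map_complex_mult continuous_coordinate [OF c f] continuous_map_from_subtopology [OF a])
  then have "continuous_map (subtopology Z {z. proj E (f z) \<in> U}) euclidean (\<lambda>z. k (fscale E (a z) (f z)))"
    by (rule continuous_map_eq) (use chartD(8) [OF c] fz in auto)
  ultimately show "continuous_map (subtopology Z {z. proj E (fscale E (a z) (f z)) \<in> U}) euclidean
      (\<lambda>z. k (fscale E (a z) (f z)))" by simp
qed

lemma continuous_fadd:
  assumes lb: "line_bundle X E" and f: "continuous_map Z (total_space E) f"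
    and f': "continuous_map Z (total_space E) f'"
    and p: "\<And>z. z \<in> topspace Z \<Longrightarrow> proj E (f' z) = proj E (f z)"
  shows "continuous_map Z (total_space E) (\<lambda>z. fadd E (f z) (f' z))"
proof (rule continuous_map_into_bundle [OF lb])
  have fz: "f z \<in> fibre E (proj E (f z))" "f' z \<in> fibre E (proj E (f z))" if "z \<in> topspace Z" for z
    using fibreI [OF continuous_map_in_topspace [OF f that]] fibreI [OF continuous_map_in_topspace [OF f' that]]
     p [OF that] by auto
  have pr: "proj E (fadd E (f z) (f' z)) = proj E (f z)" if "z \<in> topspace Z" for z
    using fadd_in_fibre [OF lb fz [OF that]] by (rule fibreD)
  show "fadd E (f z) (f' z) \<in> topspace (total_space E)" if "z \<in> topspace Z" for z
    using fadd_in_fibre [OF lb fz [OF that]] by (rule fibreD)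
  show "continuous_map Z X (\<lambda>z. proj E (fadd E (f z) (f' z)))"
    by (rule continuous_map_eq [OF continuous_map_proj [OF lb f]]) (simp add: pr)
  fix U k g assume c: "chart X E U k g"
  have eq: "subtopology Z {z. proj E (fadd E (f z) (f' z)) \<in> U} = subtopology Z {z. proj E (f z) \<in> U}"
    by (rule subtopology_cong) (use pr in auto)
  have eq': "subtopology Z {z. proj E (f' z) \<in> U} = subtopology Z {z. proj E (f z) \<in> U}"
    by (rule subtopology_cong) (use p in auto)
  have "continuous_map (subtopology Z {z. proj E (f z) \<in> U}) euclidean (\<lambda>z. k (f z) + k (f' z))"
    using continuous_coordinate [OF c f'] eq'
    by (intro continuous_intros continuous_coordinate [OF c f]) auto
  then have "continuous_map (subtopology Z {z. proj E (f z) \<in> U}) euclidean (\<lambda>z. k (fadd E (f z) (f' z)))"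
    by (rule continuous_map_eq) (use chartD(7) [OF c] fz in auto)
  then show "continuous_map (subtopology Z {z. proj E (fadd E (f z) (f' z)) \<in> U}) euclidean
      (\<lambda>z. k (fadd E (f z) (f' z)))" by (simp add: eq)
qed

text \<open>In a chart the ratio is the quotient of the two coordinates.\<close>

lemma continuous_ratio:
  assumes lb: "line_bundle X E" and f: "continuous_map Z (total_space E) f"
    and f': "continuous_map Z (total_space E) f'"
    and p: "\<And>z. z \<in> topspace Z \<Longrightarrow> proj E (f' z) = proj E (f z)"
    and nz: "\<And>z. z \<in> topspace Z \<Longrightarrow> nonzero_vector E (f' z)"
  shows "continuous_map Z euclidean (\<lambda>z. ratio E (f z) (f' z))"
proof (rule continuous_map_locally)
  fix z assume z: "z \<in> topspace Z"
  have fz: "f z \<in> fibre E (proj E (f z))" "f' z \<in> fibre E (proj E (f z))" if "z \<in> topspace Z" for z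
    using fibreI [OF continuous_map_in_topspace [OF f that]] fibreI [OF continuous_map_in_topspace [OF f' that]]
     p [OF that] by auto
  obtain U k g where U: "proj E (f z) \<in> U" and c: "chart X E U k g"
    using fibre_chart [OF lb fz(1) [OF z]] by blast
  let ?W = "{z \<in> topspace Z. proj E (f z) \<in> U}"
  have sub: "subtopology Z {z. proj E (f z) \<in> U} = subtopology Z ?W"
     "subtopology Z {z. proj E (f' z) \<in> U} = subtopology Z ?W"
    by (rule subtopology_cong, use p in auto)+
  have "continuous_map (subtopology Z ?W) euclidean (\<lambda>z. k (f z) / k (f' z))"
  proof (rule continuous_map_complex_divide)
    show "continuous_map (subtopology Z ?W) euclidean (\<lambda>z. k (f z))"
      "continuous_map (subtopology Z ?W) euclidean (\<lambda>z. k (f' z))"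
      using continuous_coordinate [OF c f] continuous_coordinate [OF c f'] by (simp_all add: sub)
    show "k (f' z) \<noteq> 0" if "z \<in> topspace (subtopology Z ?W)" for z
      using that nonzero_chart [OF lb c _ fz(2)] nz by auto
  qed
  then have "continuous_map (subtopology Z ?W) euclidean (\<lambda>z. ratio E (f z) (f' z))"
    by (rule continuous_map_eq) (rule ratio_chart(1) [OF lb c, symmetric], use fz nz in auto)
  moreover have "openin Z ?W"
    by (rule openin_continuous_map_preimage [OF continuous_map_proj [OF lb f] chartD(1) [OF c]])
  ultimately show "\<exists>W. openin Z W \<and> z \<in> W \<and> continuous_map (subtopology Z W) euclidean (\<lambda>z. ratio E (f z) (f' z))"
    using z U by blast
qed

section \<open>Isomorphisms and frames\<close>

lemma bundle_iso_refl: "bundle_iso E E"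
  unfolding bundle_iso_def by (rule exI [of _ id]) (auto simp: fibre_def)

lemma bundle_isoE:
  assumes lb: "line_bundle X E" and "bundle_iso E F"
  obtains h where "homeomorphic_map (total_space E) (total_space F) h"
    "\<And>x v. v \<in> fibre E x \<Longrightarrow> h v \<in> fibre F x"
    "\<And>x v w. v \<in> fibre E x \<Longrightarrow> w \<in> fibre E x \<Longrightarrow> h (fadd E v w) = fadd F (h v) (h w)"
    "\<And>x v c. v \<in> fibre E x \<Longrightarrow> h (fscale E c v) = fscale F c (h v)"
    "\<And>x v. v \<in> fibre E x \<Longrightarrow> nonzero_vector F (h v) \<longleftrightarrow> nonzero_vector E v"
proof -
  obtain h where h: "homeomorphic_map (total_space E) (total_space F) h"
    "\<And>x v. v \<in> fibre E x \<Longrightarrow> proj F (h v) = x \<and> (\<forall>w\<in>fibre E x. h (fadd E v w) = fadd F (h v) (h w)) \<and>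
           (\<forall>c. h (fscale E c v) = fscale F c (h v))"
    using assms(2) unfolding bundle_iso_def by blast
  have hf: "h v \<in> fibre F x" if "v \<in> fibre E x" for v x
    using h that continuous_map_in_topspace [OF homeomorphic_imp_continuous_map [OF h(1)]]
    by (auto simp: fibre_def)
  have inj: "inj_on h (topspace (total_space E))"
    using h(1) by (simp add: homeomorphic_map_def)
  have nz: "nonzero_vector F (h v) \<longleftrightarrow> nonzero_vector E v" if v: "v \<in> fibre E x" for x v
  proof -
    have "h (fscale E 0 v) = h v \<longleftrightarrow> fscale E 0 v = v"
      using inj_on_eq_iff [OF inj] fibreD(1) [OF v] fibreD(1) [OF fscale_in_fibre [OF lb v]] by blast
    then show ?thesis
      using h(2) [OF v] by (simp add: nonzero_vector_def)
  qed
  show ?thesis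
    by (rule that [OF h(1) hf _ _ nz]) (use h(2) in auto)
qed

text \<open>An isomorphism \<open>h\<close> enters only through its values on the line spanned by \<open>w\<close>.\<close>

lemma ratio_bundle_iso:
  assumes E: "line_bundle X E" and F: "line_bundle X F" and v: "v \<in> fibre E x" "w \<in> fibre E x" "nonzero_vector E w"
    and hf: "h w \<in> fibre F x" and hs: "\<And>c. h (fscale E c w) = fscale F c (h w)" and nz: "nonzero_vector F (h w)"
  shows "ratio F (h v) (h w) = ratio E v w"
proof -
  have "h v = fscale F (ratio E v w) (h w)"
    using hs [of "ratio E v w"] ratio_works [OF E v] by simp
  then show ?thesis using ratio_fscale_self [OF F hf nz] by simp
qed

definition frame :: "'x topology \<Rightarrow> ('e, 'x) bundle_data \<Rightarrow> 'x set \<Rightarrow> ('x \<Rightarrow> 'e) \<Rightarrow> bool" where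
  "frame X E S \<sigma> \<longleftrightarrow>
     continuous_map (subtopology X S) (total_space E) \<sigma> \<and>
     (\<forall>x\<in>S. \<sigma> x \<in> fibre E x \<and> nonzero_vector E (\<sigma> x))"

lemma frameD:
  assumes "frame X E S \<sigma>"
  shows "continuous_map (subtopology X S) (total_space E) \<sigma>"
    "\<And>x. x \<in> S \<Longrightarrow> \<sigma> x \<in> fibre E x" "\<And>x. x \<in> S \<Longrightarrow> nonzero_vector E (\<sigma> x)"
  using assms by (auto simp: frame_def)

text \<open>The fibrewise linear map that carries \<open>\<sigma>\<close> to \<open>\<tau>\<close>. Here \<open>\<sigma>\<close> and \<open>\<tau>\<close> may be discontinuous, so that
  frames given on the pieces of a cover can be combined into one function.\<close>

definition frame_map ::
  "('e, 'x) bundle_data \<Rightarrow> ('f, 'x) bundle_data \<Rightarrow> ('x \<Rightarrow> 'e) \<Rightarrow> ('x \<Rightarrow> 'f) \<Rightarrow> 'e \<Rightarrow> 'f" where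
  "frame_map E F \<sigma> \<tau> v = fscale F (ratio E v (\<sigma> (proj E v))) (\<tau> (proj E v))"

lemma frame_map_in_fibre:
  assumes "line_bundle X F" "v \<in> fibre E x" "\<tau> x \<in> fibre F x"
  shows "frame_map E F \<sigma> \<tau> v \<in> fibre F x"
  using fscale_in_fibre [OF assms(1,3)] fibreD(2) [OF assms(2)] by (simp add: frame_map_def)

lemma frame_map_inverse:
  assumes E: "line_bundle X E" and F: "line_bundle X F" and v: "v \<in> fibre E x"
    and \<sigma>: "\<sigma> x \<in> fibre E x" "nonzero_vector E (\<sigma> x)" and \<tau>: "\<tau> x \<in> fibre F x" "nonzero_vector F (\<tau> x)"
  shows "frame_map F E \<tau> \<sigma> (frame_map E F \<sigma> \<tau> v) = v"
proof -
  have "proj F (frame_map E F \<sigma> \<tau> v) = x"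
    using frame_map_in_fibre [where \<sigma> = \<sigma> and \<tau> = \<tau>, OF F v \<tau>(1)] by (rule fibreD)
  then have "frame_map F E \<tau> \<sigma> (frame_map E F \<sigma> \<tau> v)
      = fscale E (ratio F (fscale F (ratio E v (\<sigma> x)) (\<tau> x)) (\<tau> x)) (\<sigma> x)"
    using fibreD(2) [OF v] by (simp add: frame_map_def)
  also have "\<dots> = v"
    using ratio_fscale_self [OF F \<tau>] ratio_works [OF E v \<sigma>] by simp
  finally show ?thesis .
qed

lemma continuous_frame_map:
  assumes E: "line_bundle X E" and F: "line_bundle X F" and \<sigma>: "frame X E S \<sigma>" and \<tau>: "frame X F S \<tau>"
  shows "continuous_map (subtopology (total_space E) {v. proj E v \<in> S}) (total_space F) (frame_map E F \<sigma> \<tau>)"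
proof -
  let ?Z = "subtopology (total_space E) {v. proj E v \<in> S}"
  have id: "continuous_map ?Z (total_space E) (\<lambda>v. v)"
    by (rule continuous_map_from_subtopology) simp
  have p: "continuous_map ?Z (subtopology X S) (proj E)"
    by (intro continuous_map_into_subtopology continuous_map_from_subtopology line_bundle_proj [OF E]) auto
  have s: "continuous_map ?Z (total_space E) (\<lambda>v. \<sigma> (proj E v))"
    using continuous_map_compose [OF p frameD(1) [OF \<sigma>]] by (simp add: o_def)
  have t: "continuous_map ?Z (total_space F) (\<lambda>v. \<tau> (proj E v))"
    using continuous_map_compose [OF p frameD(1) [OF \<tau>]] by (simp add: o_def)
  have "continuous_map ?Z (total_space F) (\<lambda>v. fscale F (ratio E v (\<sigma> (proj E v))) (\<tau> (proj E v)))"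
    by (intro continuous_fscale [OF F t] continuous_ratio [OF E id s])
      (use frameD [OF \<sigma>] in \<open>auto simp: fibre_def\<close>)
  then show ?thesis by (rule continuous_map_eq) (simp add: frame_map_def)
qed

text \<open>Multiplying both frames by the same number does not change the map between the lines.\<close>

lemma frame_map_glue:
  assumes E: "line_bundle X E" and F: "line_bundle X F"
    and v: "v \<in> fibre E x"
    and \<sigma>: "\<sigma> x \<in> fibre E x" "nonzero_vector E (\<sigma> x)" and \<tau>: "\<tau> x \<in> fibre F x" "nonzero_vector F (\<tau> x)"
    and \<sigma>': "\<sigma>' x \<in> fibre E x" "nonzero_vector E (\<sigma>' x)" and \<tau>': "\<tau>' x \<in> fibre F x"
    and eq: "ratio E (\<sigma>' x) (\<sigma> x) = ratio F (\<tau>' x) (\<tau> x)"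
  shows "frame_map E F \<sigma> \<tau> v = frame_map E F \<sigma>' \<tau>' v"
proof -
  have "frame_map E F \<sigma>' \<tau>' v = fscale F (ratio E v (\<sigma>' x)) (fscale F (ratio F (\<tau>' x) (\<tau> x)) (\<tau> x))"
    using ratio_works [OF F \<tau>' \<tau>] fibreD(2) [OF v] by (simp add: frame_map_def)
  also have "\<dots> = fscale F (ratio E v (\<sigma>' x) * ratio E (\<sigma>' x) (\<sigma> x)) (\<tau> x)"
    using fscale_fscale [OF F \<tau>(1)] eq by simp
  also have "\<dots> = fscale F (ratio E v (\<sigma> x)) (\<tau> x)"
    using ratio_ratio [OF E v \<sigma>'(1) \<sigma>(1) \<sigma>'(2) \<sigma>(2)] by simp
  finally show ?thesis using fibreD(2) [OF v] by (simp add: frame_map_def)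
qed

lemma continuous_frame_map_glued:
  assumes E: "line_bundle X E" and F: "line_bundle X F"
    and AB: "closedin X A" "closedin X B" "A \<union> B = topspace X"
    and \<sigma>A: "frame X E A \<sigma>A" and \<sigma>B: "frame X E B \<sigma>B" and \<tau>A: "frame X F A \<tau>A" and \<tau>B: "frame X F B \<tau>B"
    and eq: "\<And>x. x \<in> A \<inter> B \<Longrightarrow> ratio E (\<sigma>B x) (\<sigma>A x) = ratio F (\<tau>B x) (\<tau>A x)"
  shows "continuous_map (total_space E) (total_space F)
    (frame_map E F (\<lambda>x. if x \<in> A then \<sigma>A x else \<sigma>B x) (\<lambda>x. if x \<in> A then \<tau>A x else \<tau>B x))"
    (is "continuous_map _ _ ?\<Phi>")
proof (rule pasting_lemma_closed [of "{True, False}" _ "\<lambda>i. {v \<in> topspace (total_space E). proj E v \<in> (if i then A else B)}"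
      _ "\<lambda>_. ?\<Phi>"])
  fix i
  have *: "closedin (total_space E) {v \<in> topspace (total_space E). proj E v \<in> C}" if "closedin X C" for C
    by (rule closedin_continuous_map_preimage [OF line_bundle_proj [OF E] that])
  show "closedin (total_space E) {v \<in> topspace (total_space E). proj E v \<in> (if i then A else B)}"
    using * AB by simp
  have s: "subtopology (total_space E) {v \<in> topspace (total_space E). proj E v \<in> C}
      = subtopology (total_space E) {v. proj E v \<in> C}" for C
    by (rule subtopology_cong) auto
  have a: "continuous_map (subtopology (total_space E) {v. proj E v \<in> A}) (total_space F) ?\<Phi>"
    by (rule continuous_map_eq [OF continuous_frame_map [OF E F \<sigma>A \<tau>A]]) (simp add: frame_map_def)
  have b: "continuous_map (subtopology (total_space E) {v. proj E v \<in> B}) (total_space F) ?\<Phi>"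
  proof (rule continuous_map_eq [OF continuous_frame_map [OF E F \<sigma>B \<tau>B]])
    fix v assume "v \<in> topspace (subtopology (total_space E) {v. proj E v \<in> B})"
    then have v: "v \<in> fibre E (proj E v)" and vB: "proj E v \<in> B" by (auto simp: fibre_def)
    show "frame_map E F \<sigma>B \<tau>B v = ?\<Phi> v"
    proof (cases "proj E v \<in> A")
      case True
      then have "frame_map E F \<sigma>A \<tau>A v = frame_map E F \<sigma>B \<tau>B v"
        using vB frameD [OF \<sigma>A] frameD [OF \<sigma>B] frameD [OF \<tau>A] frameD [OF \<tau>B] eq
        by (intro frame_map_glue [OF E F v]) auto
      then show ?thesis using True by (simp add: frame_map_def)
    qed (simp add: frame_map_def)
  qed
  show "continuous_map (subtopology (total_space E)
      {v \<in> topspace (total_space E). proj E v \<in> (if i then A else B)}) (total_space F) ?\<Phi>"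
    using a b by (cases i) (simp_all add: s)
next
  fix v assume "v \<in> topspace (total_space E)"
  then have "proj E v \<in> A \<union> B"
    using continuous_map_in_topspace [OF line_bundle_proj [OF E]] AB(3) by blast
  then show "\<exists>j. j \<in> {True, False} \<and> v \<in> {v \<in> topspace (total_space E). proj E v \<in> (if j then A else B)} \<and> ?\<Phi> v = ?\<Phi> v"
    using \<open>v \<in> topspace (total_space E)\<close> by auto
qed auto

text \<open>Two bundles with the same transition function are isomorphic: over \<open>A\<close> and over \<open>B\<close> the frame
  maps are continuous, they agree on \<open>A \<inter> B\<close>, and exchanging the roles of the two bundles gives the
  inverse. The pieces may be closed because a map is continuous if its restrictions to two closed
  sets that cover the space are.\<close>

lemma bundle_iso_of_frames:
  assumes E: "line_bundle X E" and F: "line_bundle X F"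
    and AB: "closedin X A" "closedin X B" "A \<union> B = topspace X"
    and \<sigma>A: "frame X E A \<sigma>A" and \<sigma>B: "frame X E B \<sigma>B" and \<tau>A: "frame X F A \<tau>A" and \<tau>B: "frame X F B \<tau>B"
    and eq: "\<And>x. x \<in> A \<inter> B \<Longrightarrow> ratio E (\<sigma>B x) (\<sigma>A x) = ratio F (\<tau>B x) (\<tau>A x)"
  shows "bundle_iso E F"
proof -
  let ?\<sigma> = "\<lambda>x. if x \<in> A then \<sigma>A x else \<sigma>B x" and ?\<tau> = "\<lambda>x. if x \<in> A then \<tau>A x else \<tau>B x"
  have \<sigma>: "?\<sigma> x \<in> fibre E x" "nonzero_vector E (?\<sigma> x)" and \<tau>: "?\<tau> x \<in> fibre F x" "nonzero_vector F (?\<tau> x)"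
    if "x \<in> topspace X" for x
    using that AB(3) frameD [OF \<sigma>A] frameD [OF \<sigma>B] frameD [OF \<tau>A] frameD [OF \<tau>B] by auto
  have "homeomorphic_maps (total_space E) (total_space F) (frame_map E F ?\<sigma> ?\<tau>) (frame_map F E ?\<tau> ?\<sigma>)"
    unfolding homeomorphic_maps_def
  proof (intro conjI ballI)
    show "continuous_map (total_space E) (total_space F) (frame_map E F ?\<sigma> ?\<tau>)"
      by (rule continuous_frame_map_glued [OF E F AB \<sigma>A \<sigma>B \<tau>A \<tau>B eq])
    show "continuous_map (total_space F) (total_space E) (frame_map F E ?\<tau> ?\<sigma>)"
      by (rule continuous_frame_map_glued [OF F E AB \<tau>A \<tau>B \<sigma>A \<sigma>B eq [symmetric]])
    show "frame_map F E ?\<tau> ?\<sigma> (frame_map E F ?\<sigma> ?\<tau> v) = v" if "v \<in> topspace (total_space E)" for v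
    proof -
      have v: "v \<in> fibre E (proj E v)" using that by (rule fibreI)
      note x = fibre_base [OF E v]
      show ?thesis
        by (rule frame_map_inverse [where \<sigma> = ?\<sigma> and \<tau> = ?\<tau>, OF E F v \<sigma> [OF x] \<tau> [OF x]])
    qed
    show "frame_map E F ?\<sigma> ?\<tau> (frame_map F E ?\<tau> ?\<sigma> v) = v" if "v \<in> topspace (total_space F)" for v
    proof -
      have v: "v \<in> fibre F (proj F v)" using that by (rule fibreI)
      note x = fibre_base [OF F v]
      show ?thesis
        by (rule frame_map_inverse [where \<sigma> = ?\<tau> and \<tau> = ?\<sigma>, OF F E v \<tau> [OF x] \<sigma> [OF x]])
    qed
  qed
  then have "homeomorphic_map (total_space E) (total_space F) (frame_map E F ?\<sigma> ?\<tau>)"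
    using homeomorphic_map_maps by blast
  moreover have "proj F (frame_map E F ?\<sigma> ?\<tau> v) = x \<and>
      (\<forall>w\<in>fibre E x. frame_map E F ?\<sigma> ?\<tau> (fadd E v w) = fadd F (frame_map E F ?\<sigma> ?\<tau> v) (frame_map E F ?\<sigma> ?\<tau> w)) \<and>
      (\<forall>c. frame_map E F ?\<sigma> ?\<tau> (fscale E c v) = fscale F c (frame_map E F ?\<sigma> ?\<tau> v))"
    if v: "v \<in> fibre E x" for v x
  proof -
    note x = fibre_base [OF E v]
    have fm: "frame_map E F ?\<sigma> ?\<tau> w = fscale F (ratio E w (?\<sigma> x)) (?\<tau> x)" if "w \<in> fibre E x" for w
      using fibreD(2) [OF that] by (simp only: frame_map_def)
    show ?thesis
    proof (intro conjI ballI allI)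
      show "proj F (frame_map E F ?\<sigma> ?\<tau> v) = x"
        using frame_map_in_fibre [where \<sigma> = ?\<sigma> and \<tau> = ?\<tau>, OF F v \<tau>(1) [OF x]] by (rule fibreD)
      show "frame_map E F ?\<sigma> ?\<tau> (fscale E c v) = fscale F c (frame_map E F ?\<sigma> ?\<tau> v)" for c
        unfolding fm [OF v] fm [OF fscale_in_fibre [OF E v]] ratio_fscale [OF E v \<sigma> [OF x]]
        by (rule fscale_fscale [OF F \<tau>(1) [OF x], symmetric])
      show "frame_map E F ?\<sigma> ?\<tau> (fadd E v w) = fadd F (frame_map E F ?\<sigma> ?\<tau> v) (frame_map E F ?\<sigma> ?\<tau> w)"
        if w: "w \<in> fibre E x" for w
        unfolding fm [OF v] fm [OF w] fm [OF fadd_in_fibre [OF E v w]] ratio_fadd [OF E v w \<sigma> [OF x]]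
        by (rule fscale_add [OF F \<tau>(1) [OF x]])
    qed
  qed
  ultimately show ?thesis
    unfolding bundle_iso_def by blast
qed

section \<open>Constructions of line bundles\<close>

lemma bundle_data_simps_trivial:
  "total_space (trivial_bundle X) = prod_topology X euclidean" "proj (trivial_bundle X) = fst"
  "fadd (trivial_bundle X) (x, a) (y, b) = (x, a + b)" "fscale (trivial_bundle X) c (x, a) = (x, c * a)"
  by (simp_all add: trivial_bundle_def)

lemma fibre_trivial: "v \<in> fibre (trivial_bundle X) x \<longleftrightarrow> x \<in> topspace X \<and> fst v = x"
  by (cases v) (auto simp: fibre_def bundle_data_simps_trivial)

lemma line_bundle_trivial: "line_bundle X (trivial_bundle X)"
proof (rule line_bundleI)
  show "continuous_map (total_space (trivial_bundle X)) X (proj (trivial_bundle X))"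
    by (simp add: bundle_data_simps_trivial continuous_map_fst)
  fix x assume "x \<in> topspace X"
  moreover have "chart X (trivial_bundle X) (topspace X) snd Pair"
    unfolding chart_def
    by (auto simp: fibre_trivial bundle_data_simps_trivial intro: continuous_map_from_subtopology continuous_map_snd)
  ultimately show "\<exists>U k g. x \<in> U \<and> chart X (trivial_bundle X) U k g" by blast
qed (auto simp: fibre_trivial bundle_data_simps_trivial)

lemma pullback_simps:
  "total_space (pullback_bundle Y f E) = subtopology (prod_topology Y (total_space E)) {(y, v). proj E v = f y}"
  "proj (pullback_bundle Y f E) = fst"
  "fadd (pullback_bundle Y f E) (y, v) (y', w) = (y, fadd E v w)"
  "fscale (pullback_bundle Y f E) c (y, v) = (y, fscale E c v)"
  by (simp_all add: pullback_bundle_def)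

lemma fibre_pullback:
  "v \<in> fibre (pullback_bundle Y f E) y \<longleftrightarrow> y \<in> topspace Y \<and> fst v = y \<and> snd v \<in> fibre E (f y)"
  by (cases v) (auto simp: fibre_def pullback_simps)

lemma continuous_map_into_pullback:
  assumes "continuous_map Z Y a" "continuous_map Z (total_space E) b"
    and "\<And>z. z \<in> topspace Z \<Longrightarrow> proj E (b z) = f (a z)"
  shows "continuous_map Z (total_space (pullback_bundle Y f E)) (\<lambda>z. (a z, b z))"
  unfolding pullback_simps
  by (intro continuous_map_into_subtopology continuous_map_pairedI assms) (use assms in auto)

lemma chart_pullback:
  assumes c: "chart X E U k g" and f: "continuous_map Y X f"
  shows "chart Y (pullback_bundle Y f E) {y \<in> topspace Y. f y \<in> U} (\<lambda>v. k (snd v)) (\<lambda>y c. (y, g (f y) c))"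
  unfolding chart_def
proof (intro conjI ballI allI)
  let ?V = "{y \<in> topspace Y. f y \<in> U}"
  show "openin Y ?V"
    by (rule openin_continuous_map_preimage [OF f chartD(1) [OF c]])
  have "continuous_map (subtopology (total_space (pullback_bundle Y f E)) {v. proj (pullback_bundle Y f E) v \<in> ?V})
     (subtopology (total_space E) {v. proj E v \<in> U}) snd"
    unfolding pullback_simps
    by (intro continuous_map_into_subtopology continuous_map_from_subtopology continuous_map_snd) auto
  from continuous_map_compose [OF this chartD(2) [OF c]]
  show "continuous_map (subtopology (total_space (pullback_bundle Y f E)) {v. proj (pullback_bundle Y f E) v \<in> ?V})
     euclidean (\<lambda>v. k (snd v))" by (simp add: o_def)
  let ?P = "prod_topology (subtopology Y ?V) euclidean :: ('c \<times> complex) topology"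
  have y: "continuous_map ?P Y fst"
    using continuous_map_fst [of "subtopology Y ?V" euclidean] by (rule continuous_map_into_fulltopology)
  have "continuous_map ?P (prod_topology (subtopology X U) euclidean) (\<lambda>p. (f (fst p), snd p))"
    by (intro continuous_map_pairedI continuous_map_into_subtopology continuous_map_snd
         continuous_map_compose [OF y f, unfolded o_def]) auto
  from continuous_map_compose [OF this chartD(3) [OF c]]
  have "continuous_map ?P (total_space E) (\<lambda>p. g (f (fst p)) (snd p))" by (simp add: o_def)
  then have "continuous_map ?P (total_space (pullback_bundle Y f E)) (\<lambda>p. (fst p, g (f (fst p)) (snd p)))"
    by (rule continuous_map_into_pullback [OF y]) (use chartD(4) [OF c] in \<open>auto simp: fibre_def\<close>)
  then show "continuous_map ?P (total_space (pullback_bundle Y f E)) (\<lambda>(y, c). (y, g (f y) c))"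
    by (simp add: case_prod_unfold)
qed (use chartD(4-8) [OF c] in \<open>auto simp: fibre_pullback pullback_simps\<close>)

lemma line_bundle_pullback:
  assumes lb: "line_bundle X E" and f: "continuous_map Y X f"
  shows "line_bundle Y (pullback_bundle Y f E)"
proof (rule line_bundleI)
  show "continuous_map (total_space (pullback_bundle Y f E)) Y (proj (pullback_bundle Y f E))"
    by (simp add: pullback_simps continuous_map_from_subtopology continuous_map_fst)
  fix y assume y: "y \<in> topspace Y"
  then have "f y \<in> topspace X" using continuous_map_in_topspace [OF f] by blast
  then obtain U k g where "f y \<in> U" "chart X E U k g" by (rule line_bundle_chart [OF lb])
  then have "y \<in> {y \<in> topspace Y. f y \<in> U}"
    "chart Y (pullback_bundle Y f E) {y \<in> topspace Y. f y \<in> U} (\<lambda>v. k (snd v)) (\<lambda>y c. (y, g (f y) c))"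
    using chart_pullback [OF _ f] y by simp_all
  then show "\<exists>V k g. y \<in> V \<and> chart Y (pullback_bundle Y f E) V k g"
    by (intro exI conjI)
qed (use fadd_in_fibre [OF lb] fscale_in_fibre [OF lb] in \<open>auto simp: fibre_pullback pullback_simps\<close>)

lemma nonzero_pullback: "nonzero_vector (pullback_bundle Y f E) (y, v) \<longleftrightarrow> nonzero_vector E v"
  by (simp add: nonzero_vector_def pullback_simps)

lemma ratio_pullback: "ratio (pullback_bundle Y f E) (y, v) (y, w) = ratio E v w"
  by (simp add: ratio_def pullback_simps)

lemma line_bundle_bundle_iso:
  assumes lb: "line_bundle X E" and iso: "bundle_iso E F"
  shows "line_bundle X F"
proof -
  obtain h where h: "homeomorphic_map (total_space E) (total_space F) h"
    and hf: "\<And>x v. v \<in> fibre E x \<Longrightarrow> h v \<in> fibre F x"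
    and ha: "\<And>x v w. v \<in> fibre E x \<Longrightarrow> w \<in> fibre E x \<Longrightarrow> h (fadd E v w) = fadd F (h v) (h w)"
    and hs: "\<And>x v c. v \<in> fibre E x \<Longrightarrow> h (fscale E c v) = fscale F c (h v)"
    and "\<And>x v. v \<in> fibre E x \<Longrightarrow> nonzero_vector F (h v) \<longleftrightarrow> nonzero_vector E v"
    by (rule bundle_isoE [OF assms]) blast
  obtain h' where g: "homeomorphic_maps (total_space E) (total_space F) h h'"
    using h unfolding homeomorphic_map_maps by blast
  have hc: "continuous_map (total_space E) (total_space F) h"
    and hc': "continuous_map (total_space F) (total_space E) h'"
    using g by (auto simp: homeomorphic_maps_def)
  have hh: "h' (h v) = v" if "v \<in> fibre E x" for v x
    using g that by (simp add: homeomorphic_maps_def fibre_def)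
  have pr: "proj F w = proj E (h' w)" "h (h' w) = w" "h' w \<in> topspace (total_space E)"
    if "w \<in> topspace (total_space F)" for w
  proof -
    show t: "h' w \<in> topspace (total_space E)" by (rule continuous_map_in_topspace [OF hc' that])
    show hw: "h (h' w) = w" using g that by (simp add: homeomorphic_maps_def)
    show "proj F w = proj E (h' w)" using fibreD(2) [OF hf [OF fibreI [OF t]]] hw by simp
  qed
  have onto: "\<exists>v \<in> fibre E x. w = h v" if "w \<in> fibre F x" for w x
    using pr [OF fibreD(1) [OF that]] fibreD(2) [OF that] by (intro bexI [of _ "h' w"]) (auto simp: fibre_def)
  show ?thesis
  proof (rule line_bundleI)
    show "continuous_map (total_space F) X (proj F)"
      by (rule continuous_map_eq [OF continuous_map_proj [OF lb hc']]) (use pr in simp)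
    show "fadd F v w \<in> fibre F x" if vw: "v \<in> fibre F x" "w \<in> fibre F x" for v w x
    proof -
      obtain v' w' where v': "v' \<in> fibre E x" "v = h v'" and w': "w' \<in> fibre E x" "w = h w'"
        using onto [OF vw(1)] onto [OF vw(2)] by blast
      show ?thesis
        unfolding v'(2) w'(2) ha [OF v'(1) w'(1), symmetric]
        by (rule hf [OF fadd_in_fibre [OF lb v'(1) w'(1)]])
    qed
    show "fscale F c v \<in> fibre F x" if v: "v \<in> fibre F x" for v c x
    proof -
      obtain v' where v': "v' \<in> fibre E x" "v = h v'"
        using onto [OF v] by blast
      show ?thesis
        unfolding v'(2) hs [OF v'(1), symmetric] by (rule hf [OF fscale_in_fibre [OF lb v'(1)]])
    qed
    fix x assume "x \<in> topspace X"
    then obtain U k g where xU: "x \<in> U" and c: "chart X E U k g" by (rule line_bundle_chart [OF lb])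
    have "chart X F U (\<lambda>w. k (h' w)) (\<lambda>x c. h (g x c))"
      unfolding chart_def
    proof (intro conjI ballI allI)
      show "openin X U" by (rule chartD(1) [OF c])
      have "continuous_map (subtopology (total_space F) {v. proj F v \<in> U})
          (subtopology (total_space E) {v. proj E v \<in> U}) h'"
        by (intro continuous_map_into_subtopology continuous_map_from_subtopology hc') (use pr in auto)
      from continuous_map_compose [OF this chartD(2) [OF c]]
      show "continuous_map (subtopology (total_space F) {v. proj F v \<in> U}) euclidean (\<lambda>w. k (h' w))"
        by (simp add: o_def)
      from continuous_map_compose [OF chartD(3) [OF c] hc]
      show "continuous_map (prod_topology (subtopology X U) euclidean) (total_space F) (\<lambda>(x, c). h (g x c))"
        by (simp add: o_def case_prod_unfold)
    next
      fix x c' assume x: "x \<in> U"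
      show "h (g x c') \<in> fibre F x" by (rule hf [OF chartD(4) [OF c x]])
      show "k (h' (h (g x c'))) = c'" by (simp add: hh [OF chartD(4) [OF c x]] chartD(5) [OF c x])
    next
      fix x v assume x: "x \<in> U" and v: "v \<in> fibre F x"
      obtain v' where v': "v' \<in> fibre E x" "v = h v'" using onto [OF v] by blast
      show "h (g x (k (h' v))) = v" by (simp add: v' hh [OF v'(1)] chartD(6) [OF c x v'(1)])
      show "k (h' (fscale F c' v)) = c' * k (h' v)" for c'
        unfolding v'(2) hs [OF v'(1), symmetric] hh [OF v'(1)] hh [OF fscale_in_fibre [OF lb v'(1)]]
        by (rule chartD(8) [OF c x v'(1)])
      show "k (h' (fadd F v w)) = k (h' v) + k (h' w)" if w: "w \<in> fibre F x" for w
      proof -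
        obtain w' where w': "w' \<in> fibre E x" "w = h w'" using onto [OF w] by blast
        show ?thesis
          unfolding v'(2) w'(2) ha [OF v'(1) w'(1), symmetric] hh [OF v'(1)] hh [OF w'(1)]
            hh [OF fadd_in_fibre [OF lb v'(1) w'(1)]]
          by (rule chartD(7) [OF c x v'(1) w'(1)])
      qed
    qed
    with xU show "\<exists>U k g. x \<in> U \<and> chart X F U k g" by (intro exI conjI)
  qed
qed

text \<open>A nonzero vector \<open>r x\<close> in each fibre, chosen without any continuity, turns every vector into a
  pair of its base point and its ratio to \<open>r x\<close>; topology and operations are carried along this
  injection.\<close>

lemma exists_isomorphic_copy:
  fixes E :: "('e, 'x) bundle_data"
  assumes lb: "line_bundle X E"
  obtains F :: "('x \<times> complex, 'x) bundle_data" where "line_bundle X F" "bundle_iso E F"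
proof -
  define r where "r x = (SOME v. v \<in> fibre E x \<and> nonzero_vector E v)" for x
  have r: "r x \<in> fibre E x" "nonzero_vector E (r x)" if "x \<in> topspace X" for x
  proof -
    obtain v where "v \<in> fibre E x \<and> nonzero_vector E v"
      using nonzero_exists [OF lb \<open>x \<in> topspace X\<close>] by blast
    then have "r x \<in> fibre E x \<and> nonzero_vector E (r x)" unfolding r_def by (rule someI)
    then show "r x \<in> fibre E x" "nonzero_vector E (r x)" by auto
  qed
  define b where "b v = (proj E v, ratio E v (r (proj E v)))" for v
  have inj: "inj_on b (topspace (total_space E))"
  proof (rule inj_onI)
    fix v w assume v: "v \<in> topspace (total_space E)" and w: "w \<in> topspace (total_space E)" and eq: "b v = b w"
    have p: "proj E w = proj E v" using eq by (simp add: b_def)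
    note fv = fibreI [OF v] and fw = fibreI [OF w, unfolded p]
    note rx = r [OF fibre_base [OF lb fv]]
    have "ratio E v (r (proj E v)) = ratio E w (r (proj E v))"
      using eq p by (simp add: b_def)
    then have "fscale E (ratio E v (r (proj E v))) (r (proj E v)) = fscale E (ratio E w (r (proj E v))) (r (proj E v))"
      by (rule arg_cong)
    then show "v = w"
      unfolding ratio_works [OF lb fv rx] ratio_works [OF lb fw rx] .
  qed
  let ?b' = "inv_into (topspace (total_space E)) b"
  define F where "F = \<lparr> total_space = quotient_topology (total_space E) b, proj = fst,
       fadd = (\<lambda>v w. b (fadd E (?b' v) (?b' w))), fscale = (\<lambda>c v. b (fscale E c (?b' v))) \<rparr>"
  have F: "total_space F = quotient_topology (total_space E) b" "proj F = fst"
    "\<And>v w. fadd F v w = b (fadd E (?b' v) (?b' w))" "\<And>c v. fscale F c v = b (fscale E c (?b' v))"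
    by (simp_all add: F_def)
  have "homeomorphic_map (total_space E) (total_space F) b"
    unfolding homeomorphic_map_def F using inj quotient_map_quotient_topology by blast
  then have "bundle_iso E F"
    unfolding bundle_iso_def F
    by (intro exI [of _ b]) (auto simp: fibre_def inv_into_f_f [OF inj], simp_all add: b_def)
  from line_bundle_bundle_iso [OF lb this] this show ?thesis by (rule that)
qed

subsection \<open>Tensor products\<close>

lemma tensor_simps:
  "total_space (tensor_bundle E F) = quotient_topology
     (subtopology (prod_topology (total_space E) (total_space F)) {(v, w). proj E v = proj F w}) (tensor_vec E F)"
  "proj (tensor_bundle E F) = fst"
  "fadd (tensor_bundle E F) s t = (fst s, \<lambda>B\<in>bilinear_forms E F (fst s). snd s B + snd t B)"
  "fscale (tensor_bundle E F) c s = (fst s, \<lambda>B\<in>bilinear_forms E F (fst s). c * snd s B)"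
  by (simp_all add: tensor_bundle_def case_prod_unfold)

lemma tensor_vec_fibre:
  "v \<in> fibre E x \<Longrightarrow> tensor_vec E F (v, w) = (x, \<lambda>B\<in>bilinear_forms E F x. B v w)"
  by (auto simp: tensor_vec_def fibre_def)

lemma topspace_tensor:
  "topspace (total_space (tensor_bundle E F)) =
     {tensor_vec E F (v, w) | v w x. v \<in> fibre E x \<and> w \<in> fibre F x}"
  unfolding tensor_simps topspace_quotient_topology by (fastforce simp: fibre_def)

lemma fibre_tensor:
  "t \<in> fibre (tensor_bundle E F) x \<longleftrightarrow> (\<exists>v\<in>fibre E x. \<exists>w\<in>fibre F x. t = tensor_vec E F (v, w))"
proof
  assume "t \<in> fibre (tensor_bundle E F) x"
  then have t: "t \<in> topspace (total_space (tensor_bundle E F))" "fst t = x"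
    by (simp_all add: fibre_def tensor_simps(2))
  then obtain v w y where "v \<in> fibre E y" "w \<in> fibre F y" "t = tensor_vec E F (v, w)"
    unfolding topspace_tensor by blast
  moreover have "y = x" using t(2) calculation by (simp add: tensor_vec_fibre)
  ultimately show "\<exists>v\<in>fibre E x. \<exists>w\<in>fibre F x. t = tensor_vec E F (v, w)" by blast
next
  assume "\<exists>v\<in>fibre E x. \<exists>w\<in>fibre F x. t = tensor_vec E F (v, w)"
  then obtain v w where vw: "v \<in> fibre E x" "w \<in> fibre F x" "t = tensor_vec E F (v, w)" by blast
  then have "t \<in> topspace (total_space (tensor_bundle E F))" unfolding topspace_tensor by blast
  then show "t \<in> fibre (tensor_bundle E F) x"
    by (simp add: fibre_def [of "tensor_bundle E F"] tensor_simps(2) vw(3) tensor_vec_fibre [OF vw(1)])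
qed

lemma quotient_map_tensor_vec:
  "quotient_map (subtopology (prod_topology (total_space E) (total_space F)) {(v, w). proj E v = proj F w})
     (total_space (tensor_bundle E F)) (tensor_vec E F)"
  unfolding tensor_simps by (rule quotient_map_quotient_topology)

lemma continuous_tensor_vec:
  assumes "continuous_map Z (total_space E) f" "continuous_map Z (total_space F) g"
    and "\<And>z. z \<in> topspace Z \<Longrightarrow> proj E (f z) = proj F (g z)"
  shows "continuous_map Z (total_space (tensor_bundle E F)) (\<lambda>z. tensor_vec E F (f z, g z))"
proof -
  have "continuous_map Z (subtopology (prod_topology (total_space E) (total_space F)) {(v, w). proj E v = proj F w})
      (\<lambda>z. (f z, g z))"
    by (intro continuous_map_into_subtopology continuous_map_pairedI assms) (use assms(3) in auto)
  from continuous_map_compose [OF this quotient_imp_continuous_map [OF quotient_map_tensor_vec]]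
  show ?thesis by (simp add: o_def)
qed

lemma continuous_proj_tensor:
  assumes "line_bundle X E"
  shows "continuous_map (total_space (tensor_bundle E F)) X (proj (tensor_bundle E F))"
proof (rule continuous_compose_quotient_map [OF quotient_map_tensor_vec])
  let ?W = "subtopology (prod_topology (total_space E) (total_space F)) {(v, w). proj E v = proj F w}"
  have "continuous_map ?W (total_space E) fst"
    by (intro continuous_map_from_subtopology continuous_map_fst)
  from continuous_map_proj [OF assms this]
  show "continuous_map ?W X (proj (tensor_bundle E F) \<circ> tensor_vec E F)"
    by (simp add: o_def tensor_simps tensor_vec_def case_prod_unfold)
qed

context
  fixes X :: "'x topology" and E :: "('e, 'x) bundle_data" and F :: "('f, 'x) bundle_data" and U k g k' g'
  assumes E: "line_bundle X E" and F: "line_bundle X F"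
    and c: "chart X E U k g" and c': "chart X F U k' g'"
begin

text \<open>The product of the two coordinates is a bilinear form on the fibres over all points of \<open>U\<close>;
  evaluating tensors at this single form gives a coordinate of the tensor product.\<close>

lemma product_form_bilinear:
  assumes x: "x \<in> U"
  shows "(\<lambda>v w. k v * k' w) \<in> bilinear_forms E F x"
  unfolding bilinear_forms_def
  using chartD(7,8) [OF c x] chartD(7,8) [OF c' x] by (auto simp: algebra_simps)

text \<open>A bilinear form on a pair of lines is determined by its value on one pair of basis vectors.\<close>

lemma bilinear_form_chart:
  assumes x: "x \<in> U" and B: "B \<in> bilinear_forms E F x" and v: "v \<in> fibre E x" and w: "w \<in> fibre F x"
  shows "B v w = k v * k' w * B (g x 1) (g' x 1)"
proof -
  have g1: "g x 1 \<in> fibre E x" "g' x 1 \<in> fibre F x" using chartD(4) [OF c x] chartD(4) [OF c' x] by auto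
  have "v = fscale E (k v) (g x 1)" "w = fscale F (k' w) (g' x 1)"
    using chart_inj [OF c x v fscale_in_fibre [OF E g1(1)]] chartD(5,8) [OF c x] g1
      chart_inj [OF c' x w fscale_in_fibre [OF F g1(2)]] chartD(5,8) [OF c' x] by auto
  then have "B v w = B (fscale E (k v) (g x 1)) (fscale F (k' w) (g' x 1))" by (rule arg_cong2)
  also have "\<dots> = k v * B (g x 1) (fscale F (k' w) (g' x 1))"
    using B g1(1) fscale_in_fibre [OF F g1(2)] unfolding bilinear_forms_def by blast
  also have "B (g x 1) (fscale F (k' w) (g' x 1)) = k' w * B (g x 1) (g' x 1)"
    using B g1 unfolding bilinear_forms_def by blast
  finally show ?thesis by simp
qed

lemma tensor_vec_chart:
  assumes x: "x \<in> U" and v: "v \<in> fibre E x" and w: "w \<in> fibre F x"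
  shows "tensor_vec E F (v, w) = (x, \<lambda>B\<in>bilinear_forms E F x. k v * k' w * B (g x 1) (g' x 1))"
  unfolding tensor_vec_fibre [OF v] using bilinear_form_chart [OF x _ v w] by (auto intro: restrict_ext)

lemma tensor_vec_chart_g:
  assumes x: "x \<in> U"
  shows "tensor_vec E F (g x a, g' x 1) = (x, \<lambda>B\<in>bilinear_forms E F x. a * B (g x 1) (g' x 1))"
  using tensor_vec_chart [OF x, of "g x a" "g' x 1"] chartD(4,5) [OF c x] chartD(4,5) [OF c' x] by simp

lemma tensor_fadd_chart:
  assumes x: "x \<in> U"
  shows "fadd (tensor_bundle E F) (tensor_vec E F (g x a, g' x 1)) (tensor_vec E F (g x b, g' x 1))
    = tensor_vec E F (g x (a + b), g' x 1)"
  unfolding tensor_vec_chart_g [OF x] tensor_simps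
  by (auto simp: algebra_simps intro: restrict_ext)

lemma tensor_fscale_chart:
  assumes x: "x \<in> U"
  shows "fscale (tensor_bundle E F) b (tensor_vec E F (g x a, g' x 1)) = tensor_vec E F (g x (b * a), g' x 1)"
  unfolding tensor_vec_chart_g [OF x] tensor_simps
  by (auto simp: algebra_simps intro: restrict_ext)

lemma fibre_tensor_chart:
  assumes x: "x \<in> U"
  shows "t \<in> fibre (tensor_bundle E F) x \<longleftrightarrow> (\<exists>a. t = tensor_vec E F (g x a, g' x 1))"
proof
  assume "t \<in> fibre (tensor_bundle E F) x"
  then obtain v w where "v \<in> fibre E x" "w \<in> fibre F x" "t = tensor_vec E F (v, w)"
    unfolding fibre_tensor by blast
  then have "t = tensor_vec E F (g x (k v * k' w), g' x 1)"
    using tensor_vec_chart [OF x] tensor_vec_chart_g [OF x] by simp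
  then show "\<exists>a. t = tensor_vec E F (g x a, g' x 1)" by blast
next
  assume "\<exists>a. t = tensor_vec E F (g x a, g' x 1)"
  then show "t \<in> fibre (tensor_bundle E F) x"
    unfolding fibre_tensor using chartD(4) [OF c x] chartD(4) [OF c' x] by blast
qed

lemma tensor_coordinate:
  assumes x: "x \<in> U" and v: "v \<in> fibre E x" and w: "w \<in> fibre F x"
  shows "snd (tensor_vec E F (v, w)) (\<lambda>v w. k v * k' w) = k v * k' w"
  using product_form_bilinear [OF x] by (simp add: tensor_vec_fibre [OF v])

text \<open>The tensors over \<open>x\<close> are exactly the \<open>a \<cdot> (g x 1 \<otimes> g' x 1)\<close>, and \<open>a\<close> is recovered by evaluation at
  the product form. This evaluation is continuous because it is continuous on pairs of vectors.\<close>

lemma chart_tensor: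
  "chart X (tensor_bundle E F) U (\<lambda>t. snd t (\<lambda>v w. k v * k' w)) (\<lambda>x a. tensor_vec E F (g x a, g' x 1))"
  unfolding chart_def
proof (intro conjI ballI allI)
  let ?T = "tensor_bundle E F"
  let ?W = "subtopology (prod_topology (total_space E) (total_space F)) {(v, w). proj E v = proj F w}"
  let ?k = "\<lambda>t. snd t (\<lambda>v w. k v * k' w)"
  show U: "openin X U" by (rule chartD(1) [OF c])
  define W' where "W' = subtopology ?W {p. proj ?T (tensor_vec E F p) \<in> U}"
  have W': "fst p \<in> fibre E (proj E (fst p))" "snd p \<in> fibre F (proj E (fst p))" "proj E (fst p) \<in> U"
    if "p \<in> topspace W'" for p
    using that unfolding W'_def by (auto simp: fibre_def tensor_simps(2) tensor_vec_def)
  have f: "continuous_map W' (total_space E) fst" "continuous_map W' (total_space F) snd"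
    unfolding W'_def by (intro continuous_map_from_subtopology continuous_map_fst continuous_map_snd)+
  have "subtopology W' {p. proj E (fst p) \<in> U} = subtopology W' (topspace W')"
    "subtopology W' {p. proj F (snd p) \<in> U} = subtopology W' (topspace W')"
    by (rule subtopology_cong, use W' fibreD(2) [OF W'(2)] in simp)+
  then have s: "subtopology W' {p. proj E (fst p) \<in> U} = W'" "subtopology W' {p. proj F (snd p) \<in> U} = W'"
    by simp_all
  have "continuous_map W' euclidean (\<lambda>p. k (fst p) * k' (snd p))"
    using continuous_coordinate [OF c f(1)] continuous_coordinate [OF c' f(2)] unfolding s
    by (rule continuous_map_complex_mult)
  then have "continuous_map W' euclidean (\<lambda>p. ?k (tensor_vec E F p))"
  proof (rule continuous_map_eq)
    fix p assume "p \<in> topspace W'"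
    from tensor_coordinate [OF W'(3,1,2) [OF this]]
    show "k (fst p) * k' (snd p) = ?k (tensor_vec E F p)" by simp
  qed
  then show "continuous_map (subtopology (total_space ?T) {t. proj ?T t \<in> U}) euclidean ?k"
    unfolding W'_def
    by (rule continuous_coordinate_of_quotient [OF quotient_map_tensor_vec continuous_proj_tensor [OF E] U])
  let ?P = "prod_topology (subtopology X U) euclidean :: ('x \<times> complex) topology"
  have "continuous_map ?P ?P (\<lambda>p. (fst p, 1))"
    by (intro continuous_map_pairedI continuous_map_fst) auto
  from continuous_map_compose [OF this chartD(3) [OF c']]
  have "continuous_map ?P (total_space F) (\<lambda>p. g' (fst p) 1)" by (simp add: o_def)
  moreover have "continuous_map ?P (total_space E) (\<lambda>p. g (fst p) (snd p))"
    using chartD(3) [OF c] by (simp add: case_prod_unfold)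
  ultimately have "continuous_map ?P (total_space ?T) (\<lambda>p. tensor_vec E F (g (fst p) (snd p), g' (fst p) 1))"
    by (intro continuous_tensor_vec) (use chartD(4) [OF c] chartD(4) [OF c'] in \<open>auto simp: fibre_def\<close>)
  then show "continuous_map ?P (total_space ?T) (\<lambda>(x, a). tensor_vec E F (g x a, g' x 1))"
    by (simp add: case_prod_unfold)
next
  fix x a assume x: "x \<in> U"
  show "tensor_vec E F (g x a, g' x 1) \<in> fibre (tensor_bundle E F) x"
    using fibre_tensor_chart [OF x] by blast
  show k: "snd (tensor_vec E F (g x a, g' x 1)) (\<lambda>v w. k v * k' w) = a" for a
    using tensor_coordinate [OF x chartD(4) [OF c x] chartD(4) [OF c' x]] chartD(5) [OF c x] chartD(5) [OF c' x] by simp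
  fix t assume "t \<in> fibre (tensor_bundle E F) x"
  then obtain a where t: "t = tensor_vec E F (g x a, g' x 1)" using fibre_tensor_chart [OF x] by blast
  show "tensor_vec E F (g x (snd t (\<lambda>v w. k v * k' w)), g' x 1) = t" by (simp add: t k)
  show "snd (fscale (tensor_bundle E F) b t) (\<lambda>v w. k v * k' w) = b * snd t (\<lambda>v w. k v * k' w)" for b
    unfolding t tensor_fscale_chart [OF x] k ..
  fix t' assume "t' \<in> fibre (tensor_bundle E F) x"
  then obtain b where t': "t' = tensor_vec E F (g x b, g' x 1)" using fibre_tensor_chart [OF x] by blast
  show "snd (fadd (tensor_bundle E F) t t') (\<lambda>v w. k v * k' w)
      = snd t (\<lambda>v w. k v * k' w) + snd t' (\<lambda>v w. k v * k' w)"
    unfolding t t' tensor_fadd_chart [OF x] k ..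
qed

end

lemma common_charts:
  assumes E: "line_bundle X E" and F: "line_bundle X F" and x: "x \<in> topspace X"
  obtains U k g k' g' where "x \<in> U" "chart X E U k g" "chart X F U k' g'"
proof -
  obtain U k g where 1: "x \<in> U" "chart X E U k g" by (rule line_bundle_chart [OF E x])
  obtain V k' g' where 2: "x \<in> V" "chart X F V k' g'" by (rule line_bundle_chart [OF F x])
  have "openin X (U \<inter> V)" using chartD(1) [OF 1(2)] chartD(1) [OF 2(2)] by blast
  then have "chart X E (U \<inter> V) k g" "chart X F (U \<inter> V) k' g'"
    by (auto intro: chart_subset [OF 1(2)] chart_subset [OF 2(2)])
  then show ?thesis using that 1 2 by blast
qed

lemma line_bundle_tensor:
  assumes E: "line_bundle X E" and F: "line_bundle X F"
  shows "line_bundle X (tensor_bundle E F)"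
proof (rule line_bundleI)
  show "continuous_map (total_space (tensor_bundle E F)) X (proj (tensor_bundle E F))"
    by (rule continuous_proj_tensor [OF E])
  have base: "x \<in> topspace X" if "t \<in> fibre (tensor_bundle E F) x" for t x
    using that fibre_base [OF E] unfolding fibre_tensor by blast
  show "fadd (tensor_bundle E F) s t \<in> fibre (tensor_bundle E F) x"
    if s: "s \<in> fibre (tensor_bundle E F) x" and t: "t \<in> fibre (tensor_bundle E F) x" for s t x
  proof -
    obtain U k g k' g' where x: "x \<in> U" and c: "chart X E U k g" "chart X F U k' g'"
      by (rule common_charts [OF E F base [OF s]])
    show ?thesis
      using s t unfolding fibre_tensor_chart [OF E F c x] by (auto simp: tensor_fadd_chart [OF E F c x])
  qed
  show "fscale (tensor_bundle E F) b t \<in> fibre (tensor_bundle E F) x"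
    if t: "t \<in> fibre (tensor_bundle E F) x" for b t x
  proof -
    obtain U k g k' g' where x: "x \<in> U" and c: "chart X E U k g" "chart X F U k' g'"
      by (rule common_charts [OF E F base [OF t]])
    show ?thesis
      using t unfolding fibre_tensor_chart [OF E F c x] by (auto simp: tensor_fscale_chart [OF E F c x])
  qed
  fix x assume x: "x \<in> topspace X"
  obtain U k g k' g' where "x \<in> U" and c: "chart X E U k g" "chart X F U k' g'"
    by (rule common_charts [OF E F x])
  with chart_tensor [OF E F c] show "\<exists>U k g. x \<in> U \<and> chart X (tensor_bundle E F) U k g"
    by (intro exI conjI)
qed

lemma nonzero_tensor:
  assumes E: "line_bundle X E" and F: "line_bundle X F"
    and v: "v \<in> fibre E x" "nonzero_vector E v" and w: "w \<in> fibre F x" "nonzero_vector F w"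
  shows "nonzero_vector (tensor_bundle E F) (tensor_vec E F (v, w))"
proof -
  obtain U k g k' g' where x: "x \<in> U" and c: "chart X E U k g" "chart X F U k' g'"
    by (rule common_charts [OF E F fibre_base [OF E v(1)]])
  have t: "tensor_vec E F (v, w) \<in> fibre (tensor_bundle E F) x" unfolding fibre_tensor using v w by blast
  show ?thesis
    unfolding nonzero_chart [OF line_bundle_tensor [OF E F] chart_tensor [OF E F c] x t]
      tensor_coordinate [OF E F c x v(1) w(1)]
    using nonzero_chart [OF E c(1) x] nonzero_chart [OF F c(2) x] v w by simp
qed

lemma ratio_tensor:
  assumes E: "line_bundle X E" and F: "line_bundle X F"
    and v: "v \<in> fibre E x" "v' \<in> fibre E x" "nonzero_vector E v'"
    and w: "w \<in> fibre F x" "w' \<in> fibre F x" "nonzero_vector F w'"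
  shows "ratio (tensor_bundle E F) (tensor_vec E F (v, w)) (tensor_vec E F (v', w')) = ratio E v v' * ratio F w w'"
proof -
  obtain U k g k' g' where x: "x \<in> U" and c: "chart X E U k g" "chart X F U k' g'"
    by (rule common_charts [OF E F fibre_base [OF E v(1)]])
  have t: "tensor_vec E F (v, w) \<in> fibre (tensor_bundle E F) x" "tensor_vec E F (v', w') \<in> fibre (tensor_bundle E F) x"
    unfolding fibre_tensor using v w by blast+
  show ?thesis
    unfolding ratio_chart(1) [OF line_bundle_tensor [OF E F] chart_tensor [OF E F c] x t
        nonzero_tensor [OF E F v(2,3) w(2,3)]]
      tensor_coordinate [OF E F c x v(1) w(1)] tensor_coordinate [OF E F c x v(2) w(2)]
      ratio_chart(1) [OF E c(1) x v] ratio_chart(1) [OF F c(2) x w]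
    by simp
qed

lemma frame_tensor:
  assumes E: "line_bundle X E" and F: "line_bundle X F" and \<sigma>: "frame X E S \<sigma>" and \<tau>: "frame X F S \<tau>"
  shows "frame X (tensor_bundle E F) S (\<lambda>x. tensor_vec E F (\<sigma> x, \<tau> x))"
  unfolding frame_def
proof (intro conjI ballI)
  show "continuous_map (subtopology X S) (total_space (tensor_bundle E F)) (\<lambda>x. tensor_vec E F (\<sigma> x, \<tau> x))"
    by (rule continuous_tensor_vec [OF frameD(1) [OF \<sigma>] frameD(1) [OF \<tau>]])
      (use frameD(2) [OF \<sigma>] frameD(2) [OF \<tau>] in \<open>auto simp: fibre_def\<close>)
  fix x assume x: "x \<in> S"
  show "tensor_vec E F (\<sigma> x, \<tau> x) \<in> fibre (tensor_bundle E F) x"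
    unfolding fibre_tensor using frameD(2) [OF \<sigma> x] frameD(2) [OF \<tau> x] by blast
  show "nonzero_vector (tensor_bundle E F) (tensor_vec E F (\<sigma> x, \<tau> x))"
    using frameD(2,3) [OF \<sigma> x] frameD(2,3) [OF \<tau> x] by (intro nonzero_tensor [OF E F])
qed

section \<open>The complex projective line\<close>

lemma proj_line_eq_iff:
  assumes "v \<noteq> 0"
  shows "proj_line v = proj_line w \<longleftrightarrow> (\<exists>c. c \<noteq> 0 \<and> w = (c * fst v, c * snd v))"
proof
  assume eq: "proj_line v = proj_line w"
  have "w \<in> proj_line w" by (auto simp: proj_line_def intro: exI [of _ 1])
  then obtain c where c: "w = (c * fst v, c * snd v)" using eq by (auto simp: proj_line_def)
  have "v \<in> proj_line v" by (auto simp: proj_line_def intro!: exI [of _ 1])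
  then obtain d where d: "v = (d * fst w, d * snd w)" using eq by (auto simp: proj_line_def)
  have "c \<noteq> 0"
  proof
    assume "c = 0"
    then have "v = 0" using c d by (simp add: zero_prod_def)
    then show False using assms by simp
  qed
  then show "\<exists>c. c \<noteq> 0 \<and> w = (c * fst v, c * snd v)" using c by blast
next
  assume "\<exists>c. c \<noteq> 0 \<and> w = (c * fst v, c * snd v)"
  then obtain c where c: "c \<noteq> 0" "w = (c * fst v, c * snd v)" by blast
  have "(d * fst v, d * snd v) = (d / c * fst w, d / c * snd w)" for d using c by simp
  moreover have "(d * fst w, d * snd w) = (d * c * fst v, d * c * snd v)" for d using c by simp
  ultimately show "proj_line v = proj_line w" unfolding proj_line_def by blast
qed

lemma topspace_CP1: "topspace CP1 = proj_line ` (- {0})"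
  by (simp add: CP1_def topspace_quotient_topology)

lemma quotient_map_proj_line: "quotient_map (top_of_set (- {0})) CP1 proj_line"
  unfolding CP1_def by (rule quotient_map_quotient_topology)

lemma continuous_map_into_CP1:
  fixes a b :: "'a \<Rightarrow> complex"
  assumes "continuous_map X euclidean a" "continuous_map X euclidean b"
    and "\<And>x. x \<in> topspace X \<Longrightarrow> a x \<noteq> 0 \<or> b x \<noteq> 0"
  shows "continuous_map X CP1 (\<lambda>x. proj_line (a x, b x))"
proof -
  have "continuous_map X euclidean (\<lambda>x. (a x, b x))"
    using continuous_map_pairedI [OF assms(1,2)] by simp
  then have "continuous_map X (top_of_set (- {0})) (\<lambda>x. (a x, b x))"
    using assms(3) by (auto simp: continuous_map_in_subtopology zero_prod_def)
  from continuous_map_compose [OF this quotient_imp_continuous_map [OF quotient_map_proj_line]]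
  show ?thesis by (simp add: o_def)
qed

text \<open>A line is recovered from the orthogonal projection onto it, whose matrix entries depend
  continuously on the line.\<close>

lemma Hausdorff_space_CP1: "Hausdorff_space CP1"
proof -
  \<comment> \<open>\<open>?n v\<close> is the squared norm of \<open>v\<close>, and \<open>?h v\<close> lists the entries of the projection onto the line of \<open>v\<close>.\<close>
  let ?n = "\<lambda>v :: complex \<times> complex. fst v * cnj (fst v) + snd v * cnj (snd v)"
  let ?h = "\<lambda>v. (fst v * cnj (fst v) / ?n v, fst v * cnj (snd v) / ?n v, snd v * cnj (snd v) / ?n v)"
  have n: "?n v \<noteq> 0" if "v \<noteq> 0" for v
  proof -
    have "?n v = of_real ((cmod (fst v))\<^sup>2 + (cmod (snd v))\<^sup>2)"
      by (simp add: complex_norm_square [symmetric])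
    moreover have "(cmod (fst v))\<^sup>2 + (cmod (snd v))\<^sup>2 \<noteq> 0"
      using that by (simp add: sum_power2_eq_zero_iff prod_eq_iff zero_prod_def)
    ultimately show ?thesis by (metis of_real_eq_0_iff)
  qed
  have hc: "continuous_map (top_of_set (- {0})) euclidean ?h"
    using n by (auto intro!: continuous_intros)
  have scale: "?h (c * fst v, c * snd v) = ?h v" if "c \<noteq> 0" "v \<noteq> 0" for c v
  proof -
    have "?n (c * fst v, c * snd v) = (c * cnj c) * ?n v" by (simp add: algebra_simps)
    then show ?thesis using that n [OF that(2)]
      by (simp add: divide_simps)
  qed
  have inv: "\<exists>c. c \<noteq> 0 \<and> w = (c * fst v, c * snd v)"
    if eq: "?h v = ?h w" and v: "v \<noteq> 0" and w: "w \<noteq> 0" for v w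
  proof -
    define r where "r = ?n w / ?n v"
    have r: "r \<noteq> 0" using n v w by (simp add: r_def)
    have e: "fst w * cnj (fst w) = r * (fst v * cnj (fst v))" "fst w * cnj (snd w) = r * (fst v * cnj (snd v))"
      "snd w * cnj (snd w) = r * (snd v * cnj (snd v))"
    proof -
      have frac: "b = q / p * a" if "a / p = b / q" "p \<noteq> 0" "q \<noteq> 0" for a b p q :: complex
        using that by (simp add: field_simps)
      note eq' = eq [unfolded prod.inject]
      show "fst w * cnj (fst w) = r * (fst v * cnj (fst v))" "fst w * cnj (snd w) = r * (fst v * cnj (snd v))"
        "snd w * cnj (snd w) = r * (snd v * cnj (snd v))"
        unfolding r_def
        by (rule frac [OF _ n [OF v] n [OF w]], use eq' in blast)+
    qed
    have e': "snd w * cnj (fst w) = cnj r * (snd v * cnj (fst v))"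
      using arg_cong [OF e(2), of cnj] by (simp add: algebra_simps)
    have "cnj r = r" by (simp add: r_def algebra_simps)
    note e' = e' [unfolded this]
    show ?thesis
    proof (cases "fst w = 0")
      case False
      then show ?thesis using e(1) e' r
        by (intro exI [of _ "r * cnj (fst v) / cnj (fst w)"]) (auto simp: prod_eq_iff field_simps)
    next
      case True
      then have s: "snd w \<noteq> 0" using w by (simp add: prod_eq_iff zero_prod_def)
      then show ?thesis using e(2,3) r True
        by (intro exI [of _ "r * cnj (snd v) / cnj (snd w)"]) (auto simp: prod_eq_iff field_simps)
    qed
  qed
  obtain g where g: "continuous_map CP1 euclidean g" "\<And>v. v \<in> topspace (top_of_set (- {0})) \<Longrightarrow> g (proj_line v) = ?h v"
  proof (rule quotient_map_lift_exists [OF quotient_map_proj_line hc])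
    fix v w :: "complex \<times> complex"
    assume v: "v \<in> topspace (top_of_set (- {0}))" and eq: "proj_line v = proj_line w"
    then obtain c where "c \<noteq> 0" "w = (c * fst v, c * snd v)" using proj_line_eq_iff [of v w] by auto
    then show "?h v = ?h w" using scale [of c v] v by simp
  qed blast
  have "inj_on g (topspace CP1)"
  proof (rule inj_onI)
    fix l m assume "l \<in> topspace CP1" "m \<in> topspace CP1" and gl: "g l = g m"
    then obtain v w where vw: "v \<noteq> 0" "w \<noteq> 0" "l = proj_line v" "m = proj_line w"
      by (auto simp: topspace_CP1)
    then have "?h v = ?h w" using gl g(2) by simp
    from inv [OF this vw(1,2)] show "l = m" using vw proj_line_eq_iff by blast
  qed
  with g(1) show ?thesis by (rule Hausdorff_space_injective_preimage [OF Hausdorff_space_euclidean])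
qed

section \<open>The Hopf bundle\<close>

definition linear_form :: "complex \<Rightarrow> complex \<Rightarrow> complex \<times> complex \<Rightarrow> complex" where
  "linear_form a b v = a * fst v + b * snd v"

text \<open>The lines on which the linear form \<open>a z\<^sub>0 + b z\<^sub>1\<close> does not vanish. The two domains that belong to
  \<open>z\<^sub>0\<close> and \<open>z\<^sub>1\<close> are the affine charts of the projective line.\<close>

definition form_domain :: "complex \<Rightarrow> complex \<Rightarrow> cp1_point set" where
  "form_domain a b = {l \<in> topspace CP1. \<exists>v\<in>l. linear_form a b v \<noteq> 0}"

definition unit_point :: "complex \<Rightarrow> complex \<Rightarrow> cp1_point \<Rightarrow> complex \<times> complex" where
  "unit_point a b l = (THE v. v \<in> l \<and> linear_form a b v = 1)"

text \<open>The section of the Hopf bundle given by the restriction of a linear form to each line.\<close>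

definition form_section :: "complex \<Rightarrow> complex \<Rightarrow> cp1_point \<Rightarrow> cp1_point \<times> (complex \<times> complex \<Rightarrow> complex)" where
  "form_section a b l = (l, \<lambda>v\<in>l. linear_form a b v)"

lemma linear_form_scale: "linear_form a b (c * fst v, c * snd v) = c * linear_form a b v"
  by (simp add: linear_form_def algebra_simps)

lemma linear_form_mult: "linear_form (c * a) (c * b) v = c * linear_form a b v"
  by (simp add: linear_form_def algebra_simps)

lemma proj_line_in_form_domain:
  assumes "v \<noteq> 0"
  shows "proj_line v \<in> form_domain a b \<longleftrightarrow> linear_form a b v \<noteq> 0"
proof
  assume "proj_line v \<in> form_domain a b"
  then obtain c where "linear_form a b (c * fst v, c * snd v) \<noteq> 0"
    by (auto simp: form_domain_def proj_line_def)
  then show "linear_form a b v \<noteq> 0" by (simp add: linear_form_scale)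
next
  assume "linear_form a b v \<noteq> 0"
  moreover have "v \<in> proj_line v" by (auto simp: proj_line_def intro!: exI [of _ 1])
  ultimately show "proj_line v \<in> form_domain a b"
    using assms by (auto simp: form_domain_def topspace_CP1)
qed

lemma in_proj_line: "w \<in> proj_line v \<longleftrightarrow> (\<exists>c. w = (c * fst v, c * snd v))"
  by (simp add: proj_line_def)

lemma unit_point_proj_line:
  assumes "linear_form a b v \<noteq> 0"
  shows "unit_point a b (proj_line v) = (fst v / linear_form a b v, snd v / linear_form a b v)"
  unfolding unit_point_def
proof (rule the_equality)
  let ?w = "(fst v / linear_form a b v, snd v / linear_form a b v)"
  have w: "?w = (1 / linear_form a b v * fst v, 1 / linear_form a b v * snd v)" by simp
  have "linear_form a b ?w = 1" unfolding w linear_form_scale using assms by simp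
  moreover have "?w \<in> proj_line v" unfolding w in_proj_line by blast
  ultimately show "?w \<in> proj_line v \<and> linear_form a b ?w = 1" by simp
  fix w assume "w \<in> proj_line v \<and> linear_form a b w = 1"
  then obtain c where c: "w = (c * fst v, c * snd v)" "c * linear_form a b v = 1"
    unfolding in_proj_line using linear_form_scale by metis
  then have "c = 1 / linear_form a b v" using assms by (simp add: field_simps)
  then show "w = ?w" using c by simp
qed

lemma unit_point:
  assumes "l \<in> form_domain a b"
  shows "unit_point a b l \<in> l" "linear_form a b (unit_point a b l) = 1"
    "\<And>w. w \<in> l \<Longrightarrow> w = (linear_form a b w * fst (unit_point a b l), linear_form a b w * snd (unit_point a b l))"
proof -
  obtain v where v: "v \<noteq> 0" "l = proj_line v" using assms by (auto simp: form_domain_def topspace_CP1)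
  then have nz: "linear_form a b v \<noteq> 0" using assms proj_line_in_form_domain by blast
  have u: "unit_point a b l = (1 / linear_form a b v * fst v, 1 / linear_form a b v * snd v)"
    unfolding v(2) unit_point_proj_line [OF nz] by simp
  show "unit_point a b l \<in> l" unfolding u unfolding v(2) in_proj_line by blast
  show "linear_form a b (unit_point a b l) = 1" unfolding u linear_form_scale using nz by simp
  fix w assume "w \<in> l"
  then obtain c where c: "w = (c * fst v, c * snd v)" unfolding v(2) in_proj_line by blast
  show "w = (linear_form a b w * fst (unit_point a b l), linear_form a b w * snd (unit_point a b l))"
    unfolding u c linear_form_scale using nz by simp
qed

lemma openin_form_domain: "openin CP1 (form_domain a b)"
proof -
  have "{v \<in> topspace (top_of_set (- {0})). proj_line v \<in> form_domain a b}
      = {v \<in> topspace (top_of_set (- {0})). linear_form a b v \<in> - {0}}"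
    by (intro Collect_cong conj_cong) (simp_all add: proj_line_in_form_domain)
  moreover have "openin (top_of_set (- {0})) {v \<in> topspace (top_of_set (- {0})). linear_form a b v \<in> - {0}}"
    by (rule openin_continuous_map_preimage [where Y = euclidean])
      (auto simp: linear_form_def open_Compl intro!: continuous_intros)
  moreover have "form_domain a b \<subseteq> proj_line ` topspace (top_of_set (- {0}))"
    by (auto simp: form_domain_def topspace_CP1)
  ultimately show ?thesis unfolding CP1_def openin_quotient_topology by simp
qed

lemma continuous_unit_point: "continuous_map (subtopology CP1 (form_domain a b)) euclidean (unit_point a b)"
proof (rule continuous_compose_quotient_map)
  show "quotient_map (subtopology (top_of_set (- {0})) {v \<in> topspace (top_of_set (- {0})). proj_line v \<in> form_domain a b})
      (subtopology CP1 (form_domain a b)) proj_line"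
    by (rule quotient_map_restriction [OF quotient_map_proj_line refl]) (simp add: openin_form_domain)
  let ?S = "{v \<in> topspace (top_of_set (- {0})). proj_line v \<in> form_domain a b}"
  have nz: "linear_form a b v \<noteq> 0" if "v \<in> ?S" for v using that proj_line_in_form_domain [of v] by simp
  have "continuous_on (- {0} \<inter> ?S) (\<lambda>v. (fst v / linear_form a b v, snd v / linear_form a b v))"
    using nz by (auto simp: linear_form_def intro!: continuous_intros)
  then have "continuous_map (subtopology (top_of_set (- {0})) ?S) euclidean
     (\<lambda>v. (fst v / linear_form a b v, snd v / linear_form a b v))"
    by (simp add: subtopology_subtopology)
  then show "continuous_map (subtopology (top_of_set (- {0})) ?S) euclidean (unit_point a b \<circ> proj_line)"
    by (rule continuous_map_eq) (use nz unit_point_proj_line in auto)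
qed

lemma hopf_simps:
  "total_space hopf_bundle = quotient_topology (prod_topology CP1 (euclidean :: (complex \<times> complex) topology))
     (\<lambda>(l, (a, b)). form_section a b l)"
  "proj hopf_bundle = fst"
  "fadd hopf_bundle s t = (fst s, \<lambda>v\<in>fst s. snd s v + snd t v)"
  "fscale hopf_bundle c s = (fst s, \<lambda>v\<in>fst s. c * snd s v)"
  by (simp_all add: hopf_bundle_def form_section_def linear_form_def case_prod_unfold)

lemma fibre_hopf: "t \<in> fibre hopf_bundle l \<longleftrightarrow> l \<in> topspace CP1 \<and> (\<exists>a b. t = form_section a b l)"
  unfolding fibre_def hopf_simps topspace_quotient_topology
  by (auto simp: form_section_def image_iff; blast)

lemma form_section_eqI:
  assumes "\<And>v. v \<in> l \<Longrightarrow> linear_form a b v = linear_form a' b' v"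
  shows "form_section a b l = form_section a' b' l"
  unfolding form_section_def using assms by (auto intro: restrict_ext)

lemma hopf_fadd: "fadd hopf_bundle (form_section a b l) (form_section a' b' l) = form_section (a + a') (b + b') l"
  unfolding hopf_simps form_section_def by (auto simp: linear_form_def algebra_simps intro: restrict_ext)

lemma hopf_fscale: "fscale hopf_bundle c (form_section a b l) = form_section (c * a) (c * b) l"
  unfolding hopf_simps form_section_def by (auto simp: linear_form_def algebra_simps intro: restrict_ext)

lemma quotient_map_form_section:
  "quotient_map (prod_topology CP1 euclidean) (total_space hopf_bundle) (\<lambda>(l, (a, b)). form_section a b l)"
  unfolding hopf_simps by (rule quotient_map_quotient_topology)

lemma continuous_form_section:
  assumes "continuous_map Z CP1 f" "continuous_map Z euclidean a" "continuous_map Z euclidean b"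
  shows "continuous_map Z (total_space hopf_bundle) (\<lambda>z. form_section (a z) (b z) (f z))"
proof -
  have "continuous_map Z euclidean (\<lambda>z. (a z, b z))"
    using continuous_map_pairedI [OF assms(2,3)] by simp
  from continuous_map_compose [OF continuous_map_pairedI [OF assms(1) this] quotient_imp_continuous_map [OF quotient_map_form_section]]
  show ?thesis by (simp add: o_def)
qed

lemma continuous_proj_hopf: "continuous_map (total_space hopf_bundle) CP1 (proj hopf_bundle)"
  by (rule continuous_compose_quotient_map [OF quotient_map_form_section])
    (rule continuous_map_eq [OF continuous_map_fst], auto simp: hopf_simps(2) form_section_def)

text \<open>A functional on a line \<open>l\<close> is a multiple of the given form, and the factor is its value at the
  point of \<open>l\<close> where the form takes the value \<open>1\<close>.\<close>

lemma chart_hopf: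
  "chart CP1 hopf_bundle (form_domain a b) (\<lambda>t. snd t (unit_point a b (fst t)))
     (\<lambda>l c. form_section (c * a) (c * b) l)"
  unfolding chart_def
proof (intro conjI ballI allI)
  let ?U = "form_domain a b" and ?k = "\<lambda>t. snd t (unit_point a b (fst t))"
  let ?P = "prod_topology CP1 (euclidean :: (complex \<times> complex) topology)"
  let ?q = "\<lambda>(l, (a, b)). form_section a b l"
  show U: "openin CP1 ?U" by (rule openin_form_domain)
  have k: "?k (form_section c d l) = linear_form c d (unit_point a b l)" if "l \<in> ?U" for c d l
    using unit_point(1) [OF that] by (simp add: form_section_def)
  define W where "W = subtopology ?P {p. proj hopf_bundle (?q p) \<in> ?U}"
  have WU: "fst p \<in> ?U" if "p \<in> topspace W" for p
    using that unfolding W_def by (auto simp: hopf_simps(2) form_section_def)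
  have "continuous_map W CP1 fst"
    unfolding W_def by (intro continuous_map_from_subtopology continuous_map_fst)
  then have "continuous_map W (subtopology CP1 ?U) fst"
    using WU by (intro continuous_map_into_subtopology) auto
  from continuous_map_compose [OF this continuous_unit_point]
  have "continuous_map W euclidean (\<lambda>p. unit_point a b (fst p))" by (simp add: o_def)
  moreover have "continuous_map W euclidean snd"
    unfolding W_def by (intro continuous_map_from_subtopology continuous_map_snd)
  ultimately have "continuous_map W euclidean (\<lambda>p. linear_form (fst (snd p)) (snd (snd p)) (unit_point a b (fst p)))"
    by (intro continuous_map_apply2 [where S = UNIV and h = "\<lambda>c v. linear_form (fst c) (snd c) v" and f = snd])
      (auto simp: linear_form_def intro!: continuous_intros)
  then have "continuous_map W euclidean (\<lambda>p. ?k (?q p))"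
  proof (rule continuous_map_eq)
    fix p assume "p \<in> topspace W"
    from k [OF WU [OF this]] show "linear_form (fst (snd p)) (snd (snd p)) (unit_point a b (fst p)) = ?k (?q p)"
      by (simp add: case_prod_unfold)
  qed
  then show "continuous_map (subtopology (total_space hopf_bundle) {t. proj hopf_bundle t \<in> ?U}) euclidean ?k"
    unfolding W_def
    by (rule continuous_coordinate_of_quotient [OF quotient_map_form_section continuous_proj_hopf U])
  let ?R = "prod_topology (subtopology CP1 ?U) euclidean :: (cp1_point \<times> complex) topology"
  have "continuous_map ?R CP1 fst"
    using continuous_map_fst [of "subtopology CP1 ?U" euclidean] by (rule continuous_map_into_fulltopology)
  moreover have "continuous_map ?R euclidean (\<lambda>p. snd p * d)" for d
    by (rule continuous_map_complex_mult [OF continuous_map_snd]) simp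
  ultimately have "continuous_map ?R (total_space hopf_bundle) (\<lambda>p. form_section (snd p * a) (snd p * b) (fst p))"
    by (intro continuous_form_section)
  then show "continuous_map ?R (total_space hopf_bundle) (\<lambda>(l, c). form_section (c * a) (c * b) l)"
    by (simp add: case_prod_unfold)
  fix l assume l: "l \<in> ?U"
  show "form_section (c * a) (c * b) l \<in> fibre hopf_bundle l" for c
    using l by (auto simp: fibre_hopf form_domain_def)
  show "?k (form_section (c * a) (c * b) l) = c" for c
    unfolding k [OF l] linear_form_mult unit_point(2) [OF l] by simp
  fix t assume "t \<in> fibre hopf_bundle l"
  then obtain c d where t: "t = form_section c d l" by (auto simp: fibre_hopf)
  show "form_section (?k t * a) (?k t * b) l = t"
    unfolding t k [OF l]
  proof (rule form_section_eqI)
    fix v assume v: "v \<in> l"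
    have "linear_form c d v = linear_form c d (linear_form a b v * fst (unit_point a b l), linear_form a b v * snd (unit_point a b l))"
      using unit_point(3) [OF l v] by simp
    then show "linear_form (linear_form c d (unit_point a b l) * a) (linear_form c d (unit_point a b l) * b) v = linear_form c d v"
      unfolding linear_form_scale by (simp add: linear_form_def algebra_simps)
  qed
  show "?k (fscale hopf_bundle e t) = e * ?k t" for e
    unfolding t hopf_fscale k [OF l] by (simp add: linear_form_def algebra_simps)
  fix s assume "s \<in> fibre hopf_bundle l"
  then obtain c' d' where s: "s = form_section c' d' l" by (auto simp: fibre_hopf)
  show "?k (fadd hopf_bundle t s) = ?k t + ?k s"
    unfolding t s hopf_fadd k [OF l] by (simp add: linear_form_def algebra_simps)
qed

lemma line_bundle_hopf: "line_bundle CP1 hopf_bundle"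
proof (rule line_bundleI [OF continuous_proj_hopf])
  show "fadd hopf_bundle s t \<in> fibre hopf_bundle l" if "s \<in> fibre hopf_bundle l" "t \<in> fibre hopf_bundle l" for s t l
    using that unfolding fibre_hopf by (metis hopf_fadd)
  show "fscale hopf_bundle c t \<in> fibre hopf_bundle l" if "t \<in> fibre hopf_bundle l" for c t l
    using that unfolding fibre_hopf by (metis hopf_fscale)
  fix l assume "l \<in> topspace CP1"
  then obtain v where v: "v \<noteq> 0" "l = proj_line v" by (auto simp: topspace_CP1)
  then have "linear_form 1 0 v \<noteq> 0 \<or> linear_form 0 1 v \<noteq> 0"
    by (auto simp: linear_form_def prod_eq_iff zero_prod_def)
  then have "l \<in> form_domain 1 0 \<or> l \<in> form_domain 0 1" using proj_line_in_form_domain v by blast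
  then show "\<exists>U k g. l \<in> U \<and> chart CP1 hopf_bundle U k g" using chart_hopf by (metis (no_types))
qed

lemma form_section_in_fibre: "l \<in> topspace CP1 \<Longrightarrow> form_section a b l \<in> fibre hopf_bundle l"
  by (auto simp: fibre_hopf)

lemma form_section_nonzero:
  assumes "l \<in> form_domain a b"
  shows "nonzero_vector hopf_bundle (form_section a b l)"
proof -
  have "l \<in> topspace CP1" using assms by (simp add: form_domain_def)
  then show ?thesis
    using nonzero_chart [OF line_bundle_hopf chart_hopf assms form_section_in_fibre] unit_point(1,2) [OF assms]
    by (simp add: form_section_def)
qed

lemma ratio_form_section:
  assumes "v \<noteq> 0" "linear_form a b v \<noteq> 0"
  shows "ratio hopf_bundle (form_section c d (proj_line v)) (form_section a b (proj_line v))
    = linear_form c d v / linear_form a b v"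
proof -
  let ?l = "proj_line v"
  have l: "?l \<in> form_domain a b" using assms proj_line_in_form_domain by blast
  then have lt: "?l \<in> topspace CP1" by (simp add: form_domain_def)
  have "unit_point a b ?l = (1 / linear_form a b v * fst v, 1 / linear_form a b v * snd v)"
    unfolding unit_point_proj_line [OF assms(2)] by simp
  then have "linear_form c d (unit_point a b ?l) = linear_form c d v / linear_form a b v"
    by (simp only: linear_form_scale) simp
  then show ?thesis
    using ratio_chart(1) [OF line_bundle_hopf chart_hopf l form_section_in_fibre [OF lt] form_section_in_fibre [OF lt]
        form_section_nonzero [OF l]] unit_point(1,2) [OF l]
    by (simp add: form_section_def)
qed

section \<open>Homotopies on compact spaces\<close>

text \<open>The triples \<open>(y, s, r)\<close> for which \<open>(H (y, s), H (y, r))\<close> lies outside \<open>N\<close> form a compact set on which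
  \<open>\<bar>s - r\<bar>\<close> does not vanish, hence is bounded below.\<close>

lemma compact_homotopy_steps:
  fixes H :: "'a \<times> real \<Rightarrow> 'b"
  assumes Y: "compact_space Y" and H: "continuous_map (prod_topology Y (top_of_set {0..1})) Z H"
    and N: "openin (prod_topology Z Z) N" and diag: "\<And>z. z \<in> topspace Z \<Longrightarrow> (z, z) \<in> N"
  obtains n where "0 < n"
    "\<And>y i. y \<in> topspace Y \<Longrightarrow> i < n \<Longrightarrow> (H (y, real i / real n), H (y, real (Suc i) / real n)) \<in> N"
proof -
  let ?I = "top_of_set {0..1::real}"
  let ?P = "prod_topology Y (prod_topology ?I ?I)"
  let ?M = "\<lambda>w. (H (fst w, fst (snd w)), H (fst w, snd (snd w)))"
  let ?D = "\<lambda>w :: 'a \<times> real \<times> real. \<bar>fst (snd w) - snd (snd w)\<bar>"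
  have "compact_space ?I" by (simp add: compact_space_subtopology)
  then have "compact_space (prod_topology ?I ?I)"
    unfolding compact_space_prod_topology by blast
  then have cP: "compact_space ?P"
    unfolding compact_space_prod_topology using Y by blast
  have f1: "continuous_map ?P Y fst" by (rule continuous_map_fst)
  have f2: "continuous_map ?P ?I (\<lambda>w. fst (snd w))"
    by (rule continuous_map_compose [OF continuous_map_snd continuous_map_fst, unfolded o_def])
  have f3: "continuous_map ?P ?I (\<lambda>w. snd (snd w))"
    by (rule continuous_map_compose [OF continuous_map_snd continuous_map_snd, unfolded o_def])
  have M: "continuous_map ?P (prod_topology Z Z) ?M"
    using continuous_map_compose [OF continuous_map_pairedI [OF f1 f2] H]
      continuous_map_compose [OF continuous_map_pairedI [OF f1 f3] H]
    by (intro continuous_map_pairedI) (simp_all add: o_def)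
  define C where "C = topspace ?P - {w \<in> topspace ?P. ?M w \<in> N}"
  have "closedin ?P C"
    unfolding C_def
    by (intro closedin_diff closedin_topspace openin_continuous_map_preimage [OF M N])
  then have "compactin ?P C" by (rule closedin_compact_space [OF cP])
  moreover have "continuous_map ?P euclidean ?D"
    using f2 f3 by (intro continuous_intros) (auto simp: continuous_map_in_subtopology)
  ultimately have "compactin euclidean (?D ` C)" by (rule image_compactin)
  then have "closed (?D ` C)" by (simp add: compact_imp_closed)
  moreover have "0 \<notin> ?D ` C"
    using diag continuous_map_in_topspace [OF H] by (auto simp: C_def)
  ultimately have "open (- ?D ` C)" "0 \<in> - ?D ` C" by auto
  then obtain e where e: "e > 0" "ball 0 e \<subseteq> - ?D ` C"
    using open_contains_ball by metis
  obtain m where m: "inverse (real (Suc m)) < e" using reals_Archimedean e(1) by blast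
  show ?thesis
  proof (rule that [of "Suc m"])
    fix y i assume y: "y \<in> topspace Y" and i: "i < Suc m"
    let ?w = "(y, real i / real (Suc m), real (Suc i) / real (Suc m))"
    have w: "?w \<in> topspace ?P" using y i by (auto simp: divide_simps)
    have "real i / real (Suc m) - real (Suc i) / real (Suc m) = - inverse (real (Suc m))"
      by (simp add: diff_divide_distrib [symmetric] inverse_eq_divide del: of_nat_Suc) (simp add: field_simps)
    then have "?D ?w \<in> ball 0 e" using m by simp
    then have "?w \<notin> C" using e(2) by blast
    then show "(H (y, real i / real (Suc m)), H (y, real (Suc i) / real (Suc m))) \<in> N"
      using w by (auto simp: C_def)
  qed simp
qed

text \<open>For a fine enough subdivision the quotients of consecutive values lie in the right half-plane,
  where the principal logarithm is continuous; \<open>L\<close> is the sum of their logarithms.\<close>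

lemma log_along_homotopy:
  fixes H :: "'a \<times> real \<Rightarrow> complex"
  assumes Y: "compact_space Y" and H: "continuous_map (prod_topology Y (top_of_set {0..1})) euclidean H"
    and nz: "\<And>y s. y \<in> topspace Y \<Longrightarrow> s \<in> {0..1} \<Longrightarrow> H (y, s) \<noteq> 0"
  obtains L where "continuous_map Y euclidean L" "\<And>y. y \<in> topspace Y \<Longrightarrow> H (y, 1) = H (y, 0) * exp (L y)"
proof -
  let ?Z = "top_of_set (- {0 :: complex})"
  let ?N = "{p \<in> topspace (prod_topology ?Z ?Z). snd p / fst p \<in> {z. Re z > 0}}"
  have HZ: "continuous_map (prod_topology Y (top_of_set {0..1})) ?Z H"
    using H nz by (auto simp: continuous_map_in_subtopology)
  have "continuous_map (prod_topology ?Z ?Z) euclidean (\<lambda>p. snd p / fst p)"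
    by (auto intro!: continuous_intros)
  moreover have "openin euclidean {z. Re z > 0}"
    using open_halfspace_Re_gt [of 0] by simp
  ultimately have N: "openin (prod_topology ?Z ?Z) ?N"
    by (rule openin_continuous_map_preimage)
  obtain n where n: "0 < n" and step:
    "\<And>y i. y \<in> topspace Y \<Longrightarrow> i < n \<Longrightarrow> (H (y, real i / real n), H (y, real (Suc i) / real n)) \<in> ?N"
    by (rule compact_homotopy_steps [OF Y HZ N]) auto
  define q where "q = (\<lambda>i y. H (y, real (Suc i) / real n) / H (y, real i / real n))"
  define L where "L = (\<lambda>y. \<Sum>i<n. Ln (q i y))"
  have Hc: "continuous_map Y euclidean (\<lambda>y. H (y, s))" if "s \<in> {0..1}" for s
  proof -
    have "continuous_map Y (prod_topology Y (top_of_set {0..1})) (\<lambda>y. (y, s))"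
      using that by (intro continuous_map_pairedI) auto
    from continuous_map_compose [OF this H] show ?thesis by (simp add: o_def)
  qed
  have q: "Re (q i y) > 0" if "i < n" "y \<in> topspace Y" for i y
    using step [OF that(2,1)] by (simp add: q_def)
  have "continuous_map Y euclidean (\<lambda>y. Ln (q i y))" if i: "i < n" for i
  proof (rule continuous_map_apply [where S = "{z. Re z > 0}" and h = Ln and f = "q i"])
    show "continuous_on {z. Re z > 0} Ln"
      by (rule continuous_on_Ln) (auto simp: complex_nonpos_Reals_iff)
    show "continuous_map Y euclidean (q i)"
      unfolding q_def using i nz by (intro continuous_map_complex_divide Hc) auto
  qed (use q i in auto)
  then have "continuous_map Y euclidean L"
    unfolding L_def by (intro continuous_map_sum) auto
  moreover have "H (y, 1) = H (y, 0) * exp (L y)" if y: "y \<in> topspace Y" for y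
  proof -
    have "H (y, real m / real n) = H (y, 0) * exp (\<Sum>i<m. Ln (q i y))" if "m \<le> n" for m
      using that
    proof (induction m)
      case (Suc m)
      have "q m y \<noteq> 0" using q [of m y] Suc.prems y by auto
      moreover have "H (y, real (Suc m) / real n) = H (y, real m / real n) * q m y"
        using nz [OF y, of "real m / real n"] Suc.prems by (simp add: q_def)
      ultimately show ?case
        using Suc by (simp add: exp_add)
    qed simp
    from this [of n] show ?thesis using n by (simp add: L_def)
  qed
  ultimately show ?thesis by (rule that)
qed

section \<open>Transport along paths\<close>

lemma openin_nonzero:
  assumes lb: "line_bundle X E"
  shows "openin (total_space E) {v \<in> topspace (total_space E). nonzero_vector E v}"
proof (subst openin_subopen, clarify)
  fix v assume v: "v \<in> topspace (total_space E)" and nz: "nonzero_vector E v"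
  note fv = fibreI [OF v]
  obtain U k g where x: "proj E v \<in> U" and c: "chart X E U k g" by (rule fibre_chart [OF lb fv])
  let ?V = "{w \<in> topspace (total_space E). proj E w \<in> U}"
  have V: "openin (total_space E) ?V"
    by (rule openin_continuous_map_preimage [OF line_bundle_proj [OF lb] chartD(1) [OF c]])
  have s: "subtopology (total_space E) {w. proj E w \<in> U} = subtopology (total_space E) ?V"
    by (rule subtopology_cong) auto
  have "openin (subtopology (total_space E) ?V) {w \<in> topspace (subtopology (total_space E) ?V). k w \<in> - {0}}"
    by (rule openin_continuous_map_preimage [OF chartD(2) [OF c, unfolded s]]) (simp add: open_Compl)
  then have "openin (total_space E) {w \<in> topspace (subtopology (total_space E) ?V). k w \<in> - {0}}" (is "openin _ ?T")
    by (rule openin_trans_full [OF _ V])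
  moreover have "v \<in> ?T" using v x nz nonzero_chart [OF lb c x fv] by auto
  moreover have "?T \<subseteq> {v \<in> topspace (total_space E). nonzero_vector E v}"
    using nonzero_chart [OF lb c _ fibreI] by auto
  ultimately show "\<exists>T. openin (total_space E) T \<and> v \<in> T \<and> T \<subseteq> {v \<in> topspace (total_space E). nonzero_vector E v}"
    by blast
qed

text \<open>A continuous zero section allows a family of vectors to be extended by zero.\<close>

lemma exists_zero_section:
  assumes lb: "line_bundle X E"
  obtains z where "continuous_map X (total_space E) z"
    "\<And>x. x \<in> topspace X \<Longrightarrow> z x \<in> fibre E x" "\<And>x v. v \<in> fibre E x \<Longrightarrow> z x = fscale E 0 v"
proof -
  define z where "z x = fscale E 0 (SOME v. v \<in> fibre E x)" for x
  have some: "(SOME v. v \<in> fibre E x) \<in> fibre E x" if x: "x \<in> topspace X" for x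
  proof -
    obtain v where "v \<in> fibre E x" by (rule nonzero_exists [OF lb x])
    then show ?thesis by (rule someI)
  qed
  have zf: "z x \<in> fibre E x" if "x \<in> topspace X" for x
    unfolding z_def by (rule fscale_in_fibre [OF lb some [OF that]])
  have z0: "k (z x) = 0" if "chart X E U k g" "x \<in> U" "x \<in> topspace X" for x U k g
    unfolding z_def using chartD(8) [OF that(1,2) some [OF that(3)]] by simp
  have "continuous_map X (total_space E) z"
  proof (rule continuous_map_into_bundle [OF lb])
    show "z x \<in> topspace (total_space E)" if "x \<in> topspace X" for x using zf [OF that] by (rule fibreD)
    show "continuous_map X X (\<lambda>x. proj E (z x))"
      by (rule continuous_map_eq [OF continuous_map_id]) (use zf in \<open>auto simp: fibre_def\<close>)
    fix U k g assume c: "chart X E U k g"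
    show "continuous_map (subtopology X {x. proj E (z x) \<in> U}) euclidean (\<lambda>x. k (z x))"
    proof (rule continuous_map_eq [of _ _ "\<lambda>_. 0"])
      fix x assume "x \<in> topspace (subtopology X {x. proj E (z x) \<in> U})"
      then show "0 = k (z x)" using z0 [OF c] fibreD(2) [OF zf] by auto
    qed simp
  qed
  moreover have "z x = fscale E 0 v" if v: "v \<in> fibre E x" for x v
  proof -
    note x = fibre_base [OF lb v]
    obtain U k g where c: "x \<in> U" "chart X E U k g" by (rule fibre_chart [OF lb v])
    show ?thesis
      by (rule chart_inj [OF c(2,1) zf [OF x] fscale_in_fibre [OF lb v]])
        (simp add: z0 [OF c(2,1) x] chartD(8) [OF c(2,1) v])
  qed
  ultimately show ?thesis using zf by (intro that)
qed

text \<open>A substitute for parallel transport: \<open>K x\<close> maps every fibre linearly to the fibre over \<open>x\<close>,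
  continuously in all arguments, and on the fibre over \<open>x\<close> itself it is multiplication by \<open>r x\<close>.
  If \<open>r\<close> is positive, then by continuity \<open>K x\<close> is invertible on the fibres over points near \<open>x\<close>.\<close>

definition transport_kernel :: "'x topology \<Rightarrow> ('e, 'x) bundle_data \<Rightarrow> ('x \<Rightarrow> 'e \<Rightarrow> 'e) \<Rightarrow> ('x \<Rightarrow> real) \<Rightarrow> bool" where
  "transport_kernel X E K r \<longleftrightarrow>
     continuous_map (prod_topology X (total_space E)) (total_space E) (\<lambda>p. K (fst p) (snd p)) \<and>
     (\<forall>x\<in>topspace X. \<forall>v\<in>topspace (total_space E). K x v \<in> fibre E x \<and> (\<forall>c. K x (fscale E c v) = fscale E c (K x v))) \<and>
     (\<forall>x. \<forall>v\<in>fibre E x. K x v = fscale E (of_real (r x)) v)"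

lemma transport_kernelD:
  assumes "transport_kernel X E K r"
  shows "continuous_map (prod_topology X (total_space E)) (total_space E) (\<lambda>p. K (fst p) (snd p))"
    "\<And>x v. x \<in> topspace X \<Longrightarrow> v \<in> topspace (total_space E) \<Longrightarrow> K x v \<in> fibre E x"
    "\<And>x v c. x \<in> topspace X \<Longrightarrow> v \<in> topspace (total_space E) \<Longrightarrow> K x (fscale E c v) = fscale E c (K x v)"
    "\<And>x v. v \<in> fibre E x \<Longrightarrow> K x v = fscale E (of_real (r x)) v"
  using assms unfolding transport_kernel_def by blast+

text \<open>In a chart, vectors are transported by keeping their coordinate. Multiplication with a bump
  function at the start and at the end makes the extension by zero continuous: the bump function
  vanishes off a closed subset \<open>C\<close> of the domain of the chart, not merely off the domain itself.\<close>

lemma transport_kernel_of_chart: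
  assumes lb: "line_bundle X E" and c: "chart X E U k g"
    and C: "closedin X C" "C \<subseteq> U" and \<phi>: "continuous_map X euclideanreal \<phi>"
    and \<phi>0: "\<And>x. x \<in> topspace X - C \<Longrightarrow> \<phi> x = 0"
  obtains K where "transport_kernel X E K (\<lambda>x. \<phi> x * \<phi> x)"
proof -
  obtain z where z: "continuous_map X (total_space E) z"
    "\<And>x. x \<in> topspace X \<Longrightarrow> z x \<in> fibre E x" "\<And>x v. v \<in> fibre E x \<Longrightarrow> z x = fscale E 0 v"
    by (rule exists_zero_section [OF lb]) blast
  define K where "K x v = (if x \<in> U \<and> proj E v \<in> U then g x (of_real (\<phi> x * \<phi> (proj E v)) * k v) else z x)" for x v
  let ?P = "prod_topology X (total_space E)"
  let ?A = "{p \<in> topspace ?P. fst p \<in> U} \<inter> {p \<in> topspace ?P. proj E (snd p) \<in> U}"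
  let ?B = "topspace ?P - {p \<in> topspace ?P. fst p \<in> C} \<inter> {p \<in> topspace ?P. proj E (snd p) \<in> C}"
  have UX: "U \<subseteq> topspace X" by (rule openin_subset [OF chartD(1) [OF c]])
  have pr: "proj E v \<in> topspace X" if "v \<in> topspace (total_space E)" for v
    using continuous_map_in_topspace [OF line_bundle_proj [OF lb] that] .
  have p1: "continuous_map ?P X fst" by (rule continuous_map_fst)
  have p2: "continuous_map ?P (total_space E) snd" by (rule continuous_map_snd)
  have p3: "continuous_map ?P X (\<lambda>p. proj E (snd p))" by (rule continuous_map_proj [OF lb p2])
  have kz: "k (z x) = 0" if "x \<in> U" for x
    using chartD(8) [OF c that z(2)] z(3) [OF z(2)] UX that by (metis mult_zero_left subsetD)
  have Kz: "K x v = z x" if "x \<in> topspace X" "v \<in> topspace (total_space E)" "x \<notin> C \<or> proj E v \<notin> C" for x v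
  proof (cases "x \<in> U \<and> proj E v \<in> U")
    case True
    have "\<phi> x * \<phi> (proj E v) = 0" using that \<phi>0 pr [OF that(2)] by auto
    then have "K x v = g x 0" using True by (auto simp: K_def)
    also have "\<dots> = z x" using chartD(6) [OF c _ z(2) [OF that(1)]] kz True by metis
    finally show ?thesis .
  qed (auto simp: K_def)
  have A: "openin ?P ?A"
    by (intro openin_Int openin_continuous_map_preimage [OF p1] openin_continuous_map_preimage [OF p3] chartD(1) [OF c])
  have B: "openin ?P ?B"
    by (intro openin_diff openin_topspace closedin_Int closedin_continuous_map_preimage [OF p1]
        closedin_continuous_map_preimage [OF p3] C(1))
  have KA: "continuous_map (subtopology ?P ?A) (total_space E) (\<lambda>p. K (fst p) (snd p))"
  proof -
    have s: "subtopology (subtopology ?P ?A) {p. proj E (snd p) \<in> U} = subtopology ?P ?A"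
      unfolding subtopology_subtopology by (rule arg_cong [where f = "subtopology ?P"]) auto
    have k: "continuous_map (subtopology ?P ?A) euclidean (\<lambda>p. k (snd p))"
      using continuous_coordinate [OF c continuous_map_from_subtopology [OF p2, of ?A]] unfolding s .
    have "continuous_map ?P euclideanreal (\<lambda>p. \<phi> (fst p) * \<phi> (proj E (snd p)))"
      using continuous_map_compose [OF p1 \<phi>] continuous_map_compose [OF p3 \<phi>]
      by (intro continuous_intros) (simp_all add: o_def)
    then have "continuous_map ?P euclidean (\<lambda>p. complex_of_real (\<phi> (fst p) * \<phi> (proj E (snd p))))"
      by (rule continuous_map_apply [where S = UNIV, rotated]) (auto intro!: continuous_intros)
    then have "continuous_map (subtopology ?P ?A) euclidean (\<lambda>p. of_real (\<phi> (fst p) * \<phi> (proj E (snd p))) * k (snd p))"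
      by (intro continuous_map_complex_mult k continuous_map_from_subtopology)
    moreover have "continuous_map (subtopology ?P ?A) (subtopology X U) fst"
      by (intro continuous_map_into_subtopology continuous_map_from_subtopology p1) auto
    ultimately have "continuous_map (subtopology ?P ?A) (prod_topology (subtopology X U) euclidean)
        (\<lambda>p. (fst p, of_real (\<phi> (fst p) * \<phi> (proj E (snd p))) * k (snd p)))"
      by (intro continuous_map_pairedI)
    from continuous_map_compose [OF this chartD(3) [OF c]]
    show ?thesis by (rule continuous_map_eq) (auto simp: K_def)
  qed
  have KB: "continuous_map (subtopology ?P ?B) (total_space E) (\<lambda>p. K (fst p) (snd p))"
    using continuous_map_from_subtopology [OF continuous_map_compose [OF p1 z(1)], of ?B]
    by (rule continuous_map_eq) (auto simp: Kz)
  have "transport_kernel X E K (\<lambda>x. \<phi> x * \<phi> x)"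
    unfolding transport_kernel_def
  proof (intro conjI ballI allI)
    show "continuous_map ?P (total_space E) (\<lambda>p. K (fst p) (snd p))"
    proof (rule continuous_map_locally)
      fix p assume p: "p \<in> topspace ?P"
      have "p \<in> ?A \<or> p \<in> ?B" using p C(2) by auto
      then show "\<exists>W. openin ?P W \<and> p \<in> W \<and> continuous_map (subtopology ?P W) (total_space E) (\<lambda>p. K (fst p) (snd p))"
        using A B KA KB by blast
    qed
  next
    fix x v assume x: "x \<in> topspace X" and v: "v \<in> topspace (total_space E)"
    note fv = fibreI [OF v]
    show "K x v \<in> fibre E x" unfolding K_def using chartD(4) [OF c] z(2) [OF x] by simp
    fix a
    have pa: "proj E (fscale E a v) = proj E v" by (rule fibreD(2) [OF fscale_in_fibre [OF lb fv]])
    show "K x (fscale E a v) = fscale E a (K x v)"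
    proof (cases "x \<in> U \<and> proj E v \<in> U")
      case True
      note cx = chartD(4) [OF c conjunct1 [OF True]]
      have "g x (of_real (\<phi> x * \<phi> (proj E v)) * (a * k v)) = fscale E a (g x (of_real (\<phi> x * \<phi> (proj E v)) * k v))"
        by (rule chart_inj [OF c conjunct1 [OF True] cx fscale_in_fibre [OF lb cx]])
          (simp add: chartD(5) [OF c conjunct1 [OF True]] chartD(8) [OF c conjunct1 [OF True] cx])
      then show ?thesis using True chartD(8) [OF c _ fv] by (simp add: K_def pa)
    next
      case False
      then have "K x v = z x" "K x (fscale E a v) = z x" by (auto simp: K_def pa)
      moreover have "fscale E a (z x) = z x"
        using fscale_fscale [OF lb z(2) [OF x], of a 0] z(3) [OF z(2) [OF x]] by simp
      ultimately show ?thesis by simp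
    qed
  next
    fix x v assume v: "v \<in> fibre E x"
    note x = fibre_base [OF lb v]
    show "K x v = fscale E (of_real (\<phi> x * \<phi> x)) v"
    proof (cases "x \<in> U")
      case True
      have "g x (of_real (\<phi> x * \<phi> x) * k v) = fscale E (of_real (\<phi> x * \<phi> x)) v"
        by (rule chart_inj [OF c True chartD(4) [OF c True] fscale_in_fibre [OF lb v]])
          (simp add: chartD(5) [OF c True] chartD(8) [OF c True v])
      then show ?thesis using True fibreD(2) [OF v] by (simp add: K_def)
    next
      case False
      then have "\<phi> x = 0" using C(2) x \<phi>0 by blast
      then show ?thesis using False z(3) [OF v] by (simp add: K_def)
    qed
  qed
  then show ?thesis by (rule that)
qed

lemma transport_kernel_zero:
  assumes lb: "line_bundle X E"
  obtains K where "transport_kernel X E K (\<lambda>x. 0)"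
proof -
  obtain z where z: "continuous_map X (total_space E) z"
    "\<And>x. x \<in> topspace X \<Longrightarrow> z x \<in> fibre E x" "\<And>x v. v \<in> fibre E x \<Longrightarrow> z x = fscale E 0 v"
    by (rule exists_zero_section [OF lb]) blast
  have "fscale E c (z x) = z x" if x: "x \<in> topspace X" for c x
    using fscale_fscale [OF lb z(2) [OF x], of c 0] z(3) [OF z(2) [OF x]] by simp
  moreover have "continuous_map (prod_topology X (total_space E)) (total_space E) (\<lambda>p. z (fst p))"
    using continuous_map_compose [OF continuous_map_fst z(1)] by (simp add: o_def)
  ultimately have "transport_kernel X E (\<lambda>x v. z x) (\<lambda>x. 0)"
    unfolding transport_kernel_def using z by simp
  then show ?thesis by (rule that)
qed

lemma transport_kernel_add:
  assumes lb: "line_bundle X E" and K: "transport_kernel X E K r" and K': "transport_kernel X E K' r'"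
  shows "transport_kernel X E (\<lambda>x v. fadd E (K x v) (K' x v)) (\<lambda>x. r x + r' x)"
  unfolding transport_kernel_def
proof (intro conjI ballI allI)
  show "continuous_map (prod_topology X (total_space E)) (total_space E)
      (\<lambda>p. fadd E (K (fst p) (snd p)) (K' (fst p) (snd p)))"
    by (rule continuous_fadd [OF lb transport_kernelD(1) [OF K] transport_kernelD(1) [OF K']])
      (use fibreD(2) [OF transport_kernelD(2) [OF K]] fibreD(2) [OF transport_kernelD(2) [OF K']] in auto)
  fix x v assume x: "x \<in> topspace X" and v: "v \<in> topspace (total_space E)"
  note f = transport_kernelD(2) [OF K x v] transport_kernelD(2) [OF K' x v]
  show "fadd E (K x v) (K' x v) \<in> fibre E x" by (rule fadd_in_fibre [OF lb f])
  show "fadd E (K x (fscale E c v)) (K' x (fscale E c v)) = fscale E c (fadd E (K x v) (K' x v))" for c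
    unfolding transport_kernelD(3) [OF K x v] transport_kernelD(3) [OF K' x v] by (rule fscale_fadd [OF lb f, symmetric])
next
  fix x v assume v: "v \<in> fibre E x"
  show "fadd E (K x v) (K' x v) = fscale E (of_real (r x + r' x)) v"
    unfolding transport_kernelD(4) [OF K v] transport_kernelD(4) [OF K' v] of_real_add
    by (rule fscale_add [OF lb v, symmetric])
qed

text \<open>The kernels of finitely many charts are added; the sum of their factors \<open>r\<close> is positive where one
  of them is.\<close>

lemma exists_transport_kernel:
  assumes lb: "line_bundle X E" and X: "compact_space X" "Hausdorff_space X"
  obtains K r where "transport_kernel X E K r" "\<And>x. x \<in> topspace X \<Longrightarrow> r x > 0"
proof -
  have "\<exists>K r. transport_kernel X E K r \<and> continuous_map X euclideanreal r \<and> (\<forall>y. r y \<ge> 0) \<and> r x > 0"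
    if x: "x \<in> topspace X" for x
  proof -
    obtain U k g where xU: "x \<in> U" and c: "chart X E U k g" by (rule line_bundle_chart [OF lb x])
    have "completely_regular_space X"
      using X by (intro normal_imp_completely_regular_space)
        (auto intro: compact_Hausdorff_or_regular_imp_normal_space)
    moreover have "closedin X (topspace X - U)" using chartD(1) [OF c] by blast
    ultimately obtain f :: "'a \<Rightarrow> real" where f: "continuous_map X (top_of_set {0..1}) f" "f x = 0"
        "f ` (topspace X - U) \<subseteq> {1}"
      unfolding completely_regular_space_def using x xU by (metis DiffD2 DiffI)
    have fr: "continuous_map X euclideanreal f" using f(1) by (simp add: continuous_map_in_subtopology)
    \<comment> \<open>The bump function vanishes off the closed set where \<open>f \<le> 1/2\<close>, which lies in \<open>U\<close>.\<close>
    define \<phi> where "\<phi> y = max 0 (1/2 - f y)" for y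
    have \<phi>: "continuous_map X euclideanreal \<phi>" unfolding \<phi>_def by (intro continuous_intros fr)
    have "closedin X {y \<in> topspace X. f y \<in> {..1/2}}"
      by (rule closedin_continuous_map_preimage [OF fr]) simp
    moreover have "{y \<in> topspace X. f y \<in> {..1/2}} \<subseteq> U" using f(3) by force
    ultimately obtain K where "transport_kernel X E K (\<lambda>y. \<phi> y * \<phi> y)"
      by (rule transport_kernel_of_chart [OF lb c _ _ \<phi>]) (auto simp: \<phi>_def)
    moreover have "\<phi> x * \<phi> x > 0" by (simp add: \<phi>_def f(2))
    moreover have "continuous_map X euclideanreal (\<lambda>y. \<phi> y * \<phi> y)" by (intro continuous_intros \<phi>)
    ultimately show ?thesis by (intro exI conjI) auto
  qed
  then obtain K r where K: "\<And>x. x \<in> topspace X \<Longrightarrow> transport_kernel X E (K x) (r x)"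
    and rc: "\<And>x. x \<in> topspace X \<Longrightarrow> continuous_map X euclideanreal (r x)"
    and r0: "\<And>x y. x \<in> topspace X \<Longrightarrow> r x y \<ge> 0" and rx: "\<And>x. x \<in> topspace X \<Longrightarrow> r x x > (0::real)"
    by metis
  let ?O = "\<lambda>x. {y \<in> topspace X. r x y \<in> {0<..}}"
  have "openin X (?O x)" if "x \<in> topspace X" for x
    by (rule openin_continuous_map_preimage [OF rc [OF that]]) simp
  then have "\<forall>U\<in>?O ` topspace X. openin X U" by blast
  moreover have "topspace X \<subseteq> \<Union> (?O ` topspace X)" using rx by auto
  ultimately obtain \<F> where F: "finite \<F>" "\<F> \<subseteq> ?O ` topspace X" "topspace X \<subseteq> \<Union>\<F>"
    using X(1) unfolding compact_space_alt by meson
  obtain D where D: "finite D" "D \<subseteq> topspace X" "topspace X \<subseteq> \<Union> (?O ` D)"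
    using finite_subset_image [OF F(1,2)] F(3) by blast
  have "\<exists>K'. transport_kernel X E K' (\<lambda>y. \<Sum>x\<in>D. r x y)"
    using D(1,2)
  proof (induction D rule: finite_induct)
    case empty
    then show ?case using transport_kernel_zero [OF lb] by auto
  next
    case (insert x D)
    then have x: "x \<in> topspace X" by simp
    obtain K' where K': "transport_kernel X E K' (\<lambda>y. \<Sum>x\<in>D. r x y)" using insert by auto
    from transport_kernel_add [OF lb K [OF x] K'] insert.hyps show ?case by auto
  qed
  then obtain K' where "transport_kernel X E K' (\<lambda>y. \<Sum>x\<in>D. r x y)" by blast
  moreover have "(\<Sum>x\<in>D. r x y) > 0" if y: "y \<in> topspace X" for y
  proof -
    obtain x where x: "x \<in> D" "r x y > 0" using D(3) y by auto
    then have "0 < r x y" "r x y \<le> (\<Sum>x\<in>D. r x y)"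
      using D(1,2) r0 by (auto intro!: member_le_sum)
    then show ?thesis by simp
  qed
  ultimately show ?thesis by (rule that)
qed

text \<open>A vector at the common starting point of the paths \<open>H (y, \<cdot>)\<close> is carried to their end points by
  composing transport kernels over a subdivision so fine that each step is invertible. The last
  property makes the result descend to quotients of \<open>Y\<close>.\<close>

lemma transport_along_homotopy:
  fixes H :: "'y \<times> real \<Rightarrow> 'x"
  assumes lb: "line_bundle X E" and X: "compact_space X" "Hausdorff_space X" and Y: "compact_space Y"
    and H: "continuous_map (prod_topology Y (top_of_set {0..1})) X H"
    and H0: "\<And>y. y \<in> topspace Y \<Longrightarrow> H (y, 0) = x0" and v0: "v0 \<in> fibre E x0" "nonzero_vector E v0"
  obtains \<sigma> where "continuous_map Y (total_space E) \<sigma>"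
    "\<And>y. y \<in> topspace Y \<Longrightarrow> \<sigma> y \<in> fibre E (H (y, 1)) \<and> nonzero_vector E (\<sigma> y)"
    "\<And>y y'. \<forall>s\<in>{0..1}. H (y, s) = H (y', s) \<Longrightarrow> \<sigma> y = \<sigma> y'"
proof -
  obtain K r where K: "transport_kernel X E K r" and r: "\<And>x. x \<in> topspace X \<Longrightarrow> r x > 0"
    by (rule exists_transport_kernel [OF lb X]) blast
  let ?XX = "prod_topology X X"
  \<comment> \<open>The pairs of points between which the kernel is invertible: an open neighbourhood of the diagonal.\<close>
  define N where "N = {p \<in> topspace ?XX. \<forall>v\<in>fibre E (fst p). nonzero_vector E v \<longrightarrow> nonzero_vector E (K (snd p) v)}"
  have N: "openin ?XX N"
  proof (subst openin_subopen, rule ballI)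
    fix p assume p: "p \<in> N"
    then have pX: "fst p \<in> topspace X" "snd p \<in> topspace X" by (auto simp: N_def)
    obtain U k g where pU: "fst p \<in> U" and c: "chart X E U k g" by (rule line_bundle_chart [OF lb pX(1)])
    let ?V = "{q \<in> topspace ?XX. fst q \<in> U}"
    have V: "openin ?XX ?V"
      by (rule openin_continuous_map_preimage [OF continuous_map_fst chartD(1) [OF c]])
    have "continuous_map (subtopology ?XX ?V) (prod_topology (subtopology X U) euclidean) (\<lambda>q. (fst q, 1))"
      by (intro continuous_map_pairedI continuous_map_into_subtopology continuous_map_from_subtopology
          continuous_map_fst) auto
    from continuous_map_compose [OF this chartD(3) [OF c]]
    have "continuous_map (subtopology ?XX ?V) (total_space E) (\<lambda>q. g (fst q) 1)" by (simp add: o_def)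
    with continuous_map_from_subtopology [OF continuous_map_snd]
    have "continuous_map (subtopology ?XX ?V) (prod_topology X (total_space E)) (\<lambda>q. (snd q, g (fst q) 1))"
      by (rule continuous_map_pairedI)
    from continuous_map_compose [OF this transport_kernelD(1) [OF K]]
    have "continuous_map (subtopology ?XX ?V) (total_space E) (\<lambda>q. K (snd q) (g (fst q) 1))" by (simp add: o_def)
    from openin_continuous_map_preimage [OF this openin_nonzero [OF lb]]
    have T: "openin ?XX {q \<in> topspace (subtopology ?XX ?V). K (snd q) (g (fst q) 1) \<in>
        {v \<in> topspace (total_space E). nonzero_vector E v}}" (is "openin _ ?T")
      by (rule openin_trans_full [OF _ V])
    have g1: "g x 1 \<in> fibre E x" "nonzero_vector E (g x 1)" if "x \<in> U" for x
      using chartD(4) [OF c that] nonzero_chart [OF lb c that] chartD(5) [OF c that] by auto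
    have "p \<in> ?T"
      using p pU pX g1 [OF pU] transport_kernelD(2) [OF K pX(2)] unfolding N_def
      by (auto simp: fibre_def mem_Times_iff)
    moreover have "?T \<subseteq> N"
    proof
      fix q assume "q \<in> ?T"
      then have q: "fst q \<in> U" "fst q \<in> topspace X" "snd q \<in> topspace X" "nonzero_vector E (K (snd q) (g (fst q) 1))"
        by auto
      note gq = g1 [OF q(1)]
      have "nonzero_vector E (K (snd q) v)" if v: "v \<in> fibre E (fst q)" "nonzero_vector E v" for v
      proof -
        have "fscale E (ratio E v (g (fst q) 1)) (K (snd q) (g (fst q) 1)) = K (snd q) v"
          using transport_kernelD(3) [OF K q(3) fibreD(1) [OF gq(1)], of "ratio E v (g (fst q) 1)"]
          unfolding ratio_works [OF lb v(1) gq] by simp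
        moreover have "ratio E v (g (fst q) 1) \<noteq> 0" using ratio_eq_0 [OF lb v(1) gq] v(2) by simp
        ultimately show ?thesis
          using nonzero_fscale [OF lb transport_kernelD(2) [OF K q(3) fibreD(1) [OF gq(1)]]] q(4) by metis
      qed
      then show "q \<in> N" using q by (auto simp: N_def mem_Times_iff)
    qed
    ultimately show "\<exists>T. openin ?XX T \<and> p \<in> T \<and> T \<subseteq> N" using T by blast
  qed
  have diag: "(x, x) \<in> N" if x: "x \<in> topspace X" for x
  proof -
    have "nonzero_vector E (K x v)" if v: "v \<in> fibre E x" "nonzero_vector E v" for v
      unfolding transport_kernelD(4) [OF K v(1)] nonzero_fscale [OF lb v(1)] using r [OF x] v(2) by simp
    then show ?thesis using x by (simp add: N_def)
  qed
  obtain n where n: "0 < n"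
    and step: "\<And>y i. y \<in> topspace Y \<Longrightarrow> i < n \<Longrightarrow> (H (y, real i / real n), H (y, real (Suc i) / real n)) \<in> N"
    by (rule compact_homotopy_steps [OF Y H N diag]) auto
  define s where "s y = rec_nat v0 (\<lambda>i v. K (H (y, real (Suc i) / real n)) v)" for y
  have s0: "s y 0 = v0" and sS: "s y (Suc i) = K (H (y, real (Suc i) / real n)) (s y i)" for y i
    by (simp_all add: s_def)
  have Hc: "continuous_map Y X (\<lambda>y. H (y, t))" if "t \<in> {0..1}" for t
  proof -
    have "continuous_map Y (prod_topology Y (top_of_set {0..1})) (\<lambda>y. (y, t))"
      using that by (intro continuous_map_pairedI) auto
    from continuous_map_compose [OF this H] show ?thesis by (simp add: o_def)
  qed
  have main: "continuous_map Y (total_space E) (\<lambda>y. s y i) \<and>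
      (\<forall>y\<in>topspace Y. s y i \<in> fibre E (H (y, real i / real n)) \<and> nonzero_vector E (s y i))" if "i \<le> n" for i
    using that
  proof (induction i)
    case 0
    show ?case using v0 H0 fibreD(1) [OF v0(1)] by (simp add: s0)
  next
    case (Suc i)
    let ?t = "real (Suc i) / real n"
    have IH: "continuous_map Y (total_space E) (\<lambda>y. s y i)"
      "\<And>y. y \<in> topspace Y \<Longrightarrow> s y i \<in> fibre E (H (y, real i / real n))"
      "\<And>y. y \<in> topspace Y \<Longrightarrow> nonzero_vector E (s y i)"
      using Suc by auto
    have t: "?t \<in> {0..1}" using Suc.prems by (auto simp: divide_simps)
    have "continuous_map Y (prod_topology X (total_space E)) (\<lambda>y. (H (y, ?t), s y i))"
      by (intro continuous_map_pairedI Hc t IH(1))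
    from continuous_map_compose [OF this transport_kernelD(1) [OF K]]
    have "continuous_map Y (total_space E) (\<lambda>y. s y (Suc i))" by (simp add: sS o_def)
    moreover have "s y (Suc i) \<in> fibre E (H (y, ?t))" "nonzero_vector E (s y (Suc i))" if y: "y \<in> topspace Y" for y
    proof -
      show "s y (Suc i) \<in> fibre E (H (y, ?t))"
        unfolding sS by (rule transport_kernelD(2) [OF K continuous_map_in_topspace [OF Hc [OF t] y] fibreD(1) [OF IH(2) [OF y]]])
      show "nonzero_vector E (s y (Suc i))"
        unfolding sS using step [OF y, of i] Suc.prems IH(2,3) [OF y] by (simp add: N_def)
    qed
    ultimately show ?case by blast
  qed
  show ?thesis
  proof (rule that [of "\<lambda>y. s y n"])
    show "continuous_map Y (total_space E) (\<lambda>y. s y n)" using main [of n] by simp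
    show "s y n \<in> fibre E (H (y, 1)) \<and> nonzero_vector E (s y n)" if "y \<in> topspace Y" for y
      using main [of n] that n by simp
    show "s y n = s y' n" if eq: "\<forall>t\<in>{0..1}. H (y, t) = H (y', t)" for y y'
    proof -
      have "s y i = s y' i" if "i \<le> n" for i
        using that
      proof (induction i)
        case (Suc i)
        then show ?case using bspec [OF eq, of "real (Suc i) / real n"] by (simp add: sS divide_simps)
      qed (simp add: s0)
      then show ?thesis by simp
    qed
  qed
qed

section \<open>Maps from the solenoid to the punctured plane\<close>

lemma S1_Q_iff:
  "u \<in> topspace S1_Q \<longleftrightarrow> u \<in> extensional {0<..} \<and> (\<forall>n>0. cmod (u n) = 1) \<and>
     (\<forall>i>0. \<forall>j>0. i dvd j \<longrightarrow> u j ^ (j div i) = u i)"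
  by (auto simp: S1_Q_def inverse_limit_def S1_def PiE_def Pi_def)

lemma S1_Q_norm: "u \<in> topspace S1_Q \<Longrightarrow> 0 < n \<Longrightarrow> cmod (u n) = 1"
  by (simp add: S1_Q_iff)

lemma S1_Q_power:
  assumes "u \<in> topspace S1_Q" "0 < n" "0 < d"
  shows "u (n * d) ^ d = u n"
proof -
  have "u (n * d) ^ (n * d div n) = u n"
    using assms unfolding S1_Q_iff by (metis dvd_triv_left nat_0_less_mult_iff)
  then show ?thesis using assms by simp
qed

lemma continuous_S1_Q_coordinate:
  assumes "0 < n"
  shows "continuous_map S1_Q euclidean (\<lambda>u. u n)"
proof -
  have "continuous_map S1_Q S1 (\<lambda>u. u n)"
    unfolding S1_Q_def inverse_limit_def
    by (intro continuous_map_from_subtopology continuous_map_product_projection) (use assms in simp)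
  then show ?thesis by (simp add: S1_def continuous_map_in_subtopology)
qed

lemma continuous_map_into_S1_Q:
  assumes "\<And>n. 0 < n \<Longrightarrow> continuous_map Z euclidean (\<lambda>z. f z n)"
    and f: "\<And>z. z \<in> topspace Z \<Longrightarrow> f z \<in> topspace S1_Q"
  shows "continuous_map Z S1_Q f"
  unfolding S1_Q_def inverse_limit_def
proof (intro continuous_map_into_subtopology)
  show "continuous_map Z (product_topology (\<lambda>_. S1) {0<..}) f"
    unfolding continuous_map_componentwise
  proof (intro conjI ballI)
    show "f ` topspace Z \<subseteq> extensional {0<..}" using f by (auto simp: S1_Q_iff)
    show "continuous_map Z S1 (\<lambda>z. f z n)" if "n \<in> {0<..}" for n
      unfolding S1_def using that assms(1) f by (auto simp: continuous_map_in_subtopology S1_Q_iff)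
  qed
  show "f \<in> topspace Z \<rightarrow> {x. \<forall>i\<in>{0<..}. \<forall>j\<in>{0<..}. i dvd j \<longrightarrow> x j ^ (j div i) = x i}"
    using f by (auto simp: S1_Q_iff)
qed

lemma compact_space_S1_Q: "compact_space S1_Q"
proof -
  let ?P = "product_topology (\<lambda>_. S1) {0<..} :: (nat \<Rightarrow> complex) topology"
  let ?R = "{(i, j). 0 < i \<and> 0 < j \<and> i dvd j} :: (nat \<times> nat) set"
  let ?C = "\<lambda>(i, j). {x \<in> topspace ?P. x j ^ (j div i) - x i \<in> {0}}"
  have "compact_space S1" by (simp add: S1_def compact_space_subtopology)
  then have P: "compact_space ?P" by (simp add: compact_space_product_topology)
  have pr: "continuous_map ?P euclidean (\<lambda>x. x i)" if "0 < i" for i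
  proof -
    have "continuous_map ?P S1 (\<lambda>x. x i)"
      by (rule continuous_map_product_projection) (use that in simp)
    then show ?thesis by (simp add: S1_def continuous_map_in_subtopology)
  qed
  have "closedin ?P (?C r)" if rR: "r \<in> ?R" for r
  proof -
    obtain i j where r: "r = (i, j)" "0 < i" "0 < j" using rR by auto
    have "continuous_map ?P euclidean (\<lambda>x. x j ^ (j div i) - x i)"
      by (rule continuous_map_apply2 [where S = UNIV and h = "\<lambda>a b. a ^ (j div i) - b"])
        (auto intro!: continuous_intros pr r)
    from closedin_continuous_map_preimage [OF this, of "{0}"] show ?thesis by (simp add: r)
  qed
  moreover have "(1, 1) \<in> ?R" by simp
  ultimately have "closedin ?P (\<Inter> (?C ` ?R))" by (intro closedin_Inter) auto
  then have "compactin ?P (\<Inter> (?C ` ?R))" by (rule closedin_compact_space [OF P])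
  then have "compact_space (subtopology ?P (\<Inter> (?C ` ?R)))" by (simp add: compactin_subspace)
  moreover have "subtopology ?P (\<Inter> (?C ` ?R)) = S1_Q"
    unfolding S1_Q_def inverse_limit_def by (rule subtopology_cong) auto
  ultimately show ?thesis by simp
qed

lemma continuous_map_S1_Q_id: "continuous_map S1_Q euclidean (\<lambda>u. u)"
proof -
  have "continuous_map S1_Q euclidean (\<lambda>u. u n)" for n
  proof (cases "n = 0")
    case True
    show ?thesis
      by (rule continuous_map_eq [of _ _ "\<lambda>_. undefined"]) (auto simp: True S1_Q_iff extensional_def)
  qed (simp add: continuous_S1_Q_coordinate)
  then have "continuous_map S1_Q (product_topology (\<lambda>_. euclidean) UNIV) (\<lambda>u. u)"
    by (simp add: continuous_map_componentwise_UNIV)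
  then show ?thesis by (simp add: euclidean_product_topology)
qed

lemma compact_S1_Q: "compact (topspace S1_Q)"
proof -
  have "compactin euclidean ((\<lambda>u. u) ` topspace S1_Q)"
    using compact_space_S1_Q unfolding compact_space_def by (rule image_compactin [OF _ continuous_map_S1_Q_id])
  then show ?thesis by simp
qed

text \<open>The solenoid carries the topology of a compact subset of the type of all sequences, for which
  the theorem of Stone and Weierstrass can be used. Its elements have the value \<open>undefined\<close> at index
  \<open>0\<close>, so this coordinate is constant.\<close>

lemma continuous_on_S1_Q_iff:
  fixes f :: "(nat \<Rightarrow> complex) \<Rightarrow> 'b :: topological_space"
  shows "continuous_on (topspace S1_Q) f \<longleftrightarrow> continuous_map S1_Q euclidean f"
proof
  assume "continuous_on (topspace S1_Q) f"
  then have "continuous_map (top_of_set (topspace S1_Q)) euclidean f" by simp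
  moreover have "continuous_map S1_Q (top_of_set (topspace S1_Q)) (\<lambda>u. u)"
    by (intro continuous_map_into_subtopology continuous_map_S1_Q_id) auto
  ultimately show "continuous_map S1_Q euclidean f"
    using continuous_map_compose [of S1_Q _ "\<lambda>u. u" euclidean f] by (simp add: o_def)
next
  assume f: "continuous_map S1_Q euclidean f"
  have "continuous_map (top_of_set (topspace S1_Q)) S1_Q (\<lambda>u. u)"
    by (rule continuous_map_into_S1_Q)
      (auto intro!: continuous_on_product_then_coordinatewise [OF continuous_on_id])
  from continuous_map_compose [OF this f] show "continuous_on (topspace S1_Q) f" by (simp add: o_def)
qed

subsection \<open>The one-parameter subgroup\<close>

text \<open>A homomorphism from the real line to the solenoid, along which the character with index \<open>q\<close>
  becomes \<open>t \<mapsto> cis (2 \<pi> q t)\<close>.\<close>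

definition solenoid_line :: "real \<Rightarrow> nat \<Rightarrow> complex" where
  "solenoid_line t = (\<lambda>n\<in>{0<..}. cis (2 * pi * t / real n))"

lemma solenoid_line_in: "solenoid_line t \<in> topspace S1_Q"
proof -
  have "cis (2 * pi * t / real j) ^ (j div i) = cis (2 * pi * t / real i)" if ij: "0 < i" "0 < j" "i dvd j" for i j
  proof -
    obtain d where d: "j = i * d" using ij(3) by (rule dvdE)
    then have "d > 0" using ij by auto
    then have "i * d div i = d" using ij by simp
    moreover have "real d * (2 * pi * t / real (i * d)) = 2 * pi * t / real i"
      using ij \<open>d > 0\<close> by (simp add: field_simps)
    ultimately show ?thesis
      using Complex.DeMoivre [of "2 * pi * t / real (i * d)" d] by (simp only: d)
  qed
  then show ?thesis by (auto simp: S1_Q_iff solenoid_line_def)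
qed

lemma continuous_solenoid_line: "continuous_map euclidean S1_Q solenoid_line"
proof (rule continuous_map_into_S1_Q [OF _ solenoid_line_in])
  show "continuous_map euclidean euclidean (\<lambda>t. solenoid_line t n)" if "0 < n" for n
    using that by (auto simp: solenoid_line_def intro!: continuous_intros)
qed

lemma S1_Q_nonempty: "topspace S1_Q \<noteq> {}"
  using solenoid_line_in by blast

lemma S1_Q_projection_surj:
  assumes "0 < n" "cmod z = 1"
  obtains u where "u \<in> topspace S1_Q" "u n = z"
proof (rule that [OF solenoid_line_in])
  show "solenoid_line (real n * Arg z / (2 * pi)) n = z"
  proof -
    have "z \<noteq> 0" using assms(2) by auto
    then show ?thesis using assms cis_Arg [of z] by (simp add: solenoid_line_def sgn_div_norm)
  qed
qed

subsection \<open>Characters\<close>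

lemma rat_as_fraction:
  fixes q :: rat
  obtains m :: int and n :: nat where "0 < n" "q = of_int m / of_nat n"
proof -
  obtain a b where ab: "quotient_of q = (a, b)" by force
  have "b > 0" using quotient_of_denom_pos [OF ab] .
  then show ?thesis
    using that [of "nat b" a] quotient_of_div [OF ab] by simp
qed

text \<open>A character is defined through the reduced fraction; by compatibility of the coordinates of \<open>u\<close>
  every other fraction gives the same value. This allows common denominators.\<close>

lemma solenoid_character_fraction:
  assumes u: "u \<in> topspace S1_Q" and n: "0 < n"
  shows "solenoid_character (of_int m / of_nat n) u = u n powi m"
proof -
  obtain a b where ab: "quotient_of (of_int m / of_nat n) = (a, b)" by force
  have b: "b > 0" "coprime a b" using quotient_of_denom_pos [OF ab] quotient_of_coprime [OF ab] by auto
  have "(of_int m / of_nat n :: rat) = of_int a / of_int b" by (rule quotient_of_div [OF ab])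
  then have "(of_int (m * b) :: rat) = of_int (a * int n)"
    using n b by (simp add: field_simps)
  then have eq: "m * b = a * int n" by (simp only: of_int_eq_iff)
  then have "b dvd int n" using b(2) by (metis coprime_commute coprime_dvd_mult_right_iff dvd_triv_right)
  then obtain d where d: "int n = b * d" by blast
  have "d > 0" using d n b(1) by (metis of_nat_0_less_iff zero_less_mult_pos)
  then have n': "n = nat b * nat d" using d b(1) by (metis nat_int nat_mult_distrib less_imp_le)
  have m: "m = d * a" using eq d b(1) by simp
  have "u (nat b) = u n ^ nat d"
    unfolding n' using S1_Q_power [OF u, of "nat b" "nat d"] b(1) \<open>d > 0\<close> by simp
  then have "u (nat b) powi a = (u n powi d) powi a"
    using \<open>d > 0\<close> by (simp add: power_int_def)
  then show ?thesis
    unfolding solenoid_character_def ab by (simp add: m power_int_mult)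
qed

lemma solenoid_character_add:
  assumes u: "u \<in> topspace S1_Q"
  shows "solenoid_character (q + r) u = solenoid_character q u * solenoid_character r u"
proof -
  obtain a b where q: "0 < b" "q = of_int a / of_nat b" by (rule rat_as_fraction)
  obtain c d where r: "0 < d" "r = of_int c / of_nat d" by (rule rat_as_fraction)
  have "q = of_int (a * int d) / of_nat (b * d)" "r = of_int (c * int b) / of_nat (b * d)"
    "q + r = of_int (a * int d + c * int b) / of_nat (b * d)"
    using q r by (simp_all add: field_simps)
  moreover have "u (b * d) \<noteq> 0" using S1_Q_norm [OF u, of "b * d"] q r by auto
  moreover have "b * d > 0" using q r by simp
  ultimately show ?thesis
    using solenoid_character_fraction [OF u, of "b * d"] by (metis power_int_add)
qed

lemma solenoid_character_0: "solenoid_character 0 u = 1"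
  by (simp add: solenoid_character_def)

lemma norm_solenoid_character:
  assumes u: "u \<in> topspace S1_Q"
  shows "cmod (solenoid_character q u) = 1"
proof -
  obtain a b where q: "0 < b" "q = of_int a / of_nat b" by (rule rat_as_fraction)
  show ?thesis using solenoid_character_fraction [OF u q(1)] S1_Q_norm [OF u q(1)] q(2)
    by (simp add: norm_power_int)
qed

lemma continuous_solenoid_character: "continuous_map S1_Q euclidean (solenoid_character q)"
proof -
  obtain a b where q: "0 < b" "q = of_int a / of_nat b" by (rule rat_as_fraction)
  have "continuous_map S1_Q euclidean (\<lambda>u. u b powi a)"
  proof (rule continuous_map_apply [where S = "- {0}" and h = "\<lambda>z. z powi a"])
    show "continuous_on (- {0}) (\<lambda>z :: complex. z powi a)" by (intro continuous_intros) auto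
    show "u b \<in> - {0}" if "u \<in> topspace S1_Q" for u using S1_Q_norm [OF that q(1)] by auto
  qed (rule continuous_S1_Q_coordinate [OF q(1)])
  then show ?thesis
    by (rule continuous_map_eq) (simp add: q(2) solenoid_character_fraction [OF _ q(1)])
qed

lemma solenoid_character_line: "solenoid_character q (solenoid_line t) = cis (2 * pi * real_of_rat q * t)"
proof -
  obtain a b where q: "0 < b" "q = of_int a / of_nat b" by (rule rat_as_fraction)
  have "solenoid_character q (solenoid_line t) = cis (2 * pi * t / real b) powi a"
    unfolding q(2) solenoid_character_fraction [OF solenoid_line_in q(1)] using q(1) by (simp add: solenoid_line_def)
  also have "\<dots> = cis (2 * pi * real_of_rat q * t)"
    by (simp add: cis_power_int q(2) of_rat_divide mult_ac)
  finally show ?thesis .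
qed

subsection \<open>Logarithms\<close>

text \<open>The kernel of the exponential function is discrete.\<close>

lemma constant_of_exp_eq_1:
  fixes f :: "real \<Rightarrow> complex"
  assumes f: "continuous_on UNIV f" and e: "\<And>t. exp (f t) = 1"
  shows "f s = f t"
proof -
  have "f constant_on UNIV"
  proof (rule continuous_discrete_range_constant [OF _ f])
    fix x :: real
    show "\<exists>e>0. \<forall>y. y \<in> UNIV \<and> f y \<noteq> f x \<longrightarrow> e \<le> cmod (f y - f x)"
    proof (intro exI conjI allI impI)
      fix y assume "y \<in> UNIV \<and> f y \<noteq> f x"
      moreover obtain n :: int where "f y = f x + (of_int (2 * n) * pi) * \<i>"
        using e [of y] e [of x] exp_eq [of "f y" "f x"] by auto
      ultimately have "f y - f x = of_real (2 * pi * of_int n) * \<i>" "n \<noteq> 0" by auto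
      then have "cmod (f y - f x) = 2 * pi * \<bar>real_of_int n\<bar>"
        by (simp add: norm_mult abs_mult)
      moreover have "\<bar>real_of_int n\<bar> \<ge> 1" using \<open>n \<noteq> 0\<close> by linarith
      ultimately show "2 * pi \<le> cmod (f y - f x)" by simp
    qed simp
  qed simp
  then show ?thesis unfolding constant_on_def by auto
qed

text \<open>A logarithm of a character restricts to the line as a linear function; being bounded by
  compactness, it has slope zero.\<close>

lemma solenoid_character_has_log:
  assumes L: "continuous_map S1_Q euclidean L"
    and eq: "\<And>u. u \<in> topspace S1_Q \<Longrightarrow> solenoid_character q u = exp (L u)"
  shows "q = 0"
proof -
  have "compactin euclidean (L ` topspace S1_Q)"
    using compact_space_S1_Q unfolding compact_space_def by (rule image_compactin [OF _ L])
  then have "bounded (L ` topspace S1_Q)" by (simp add: compact_imp_bounded)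
  then obtain M where M: "\<And>u. u \<in> topspace S1_Q \<Longrightarrow> cmod (L u) \<le> M"
    unfolding bounded_iff by auto
  define c where "c = 2 * pi * real_of_rat q"
  let ?f = "\<lambda>t. L (solenoid_line t) - of_real (c * t) * \<i>"
  have "continuous_on UNIV (\<lambda>t. L (solenoid_line t))"
    using continuous_map_compose [OF continuous_solenoid_line L] by (simp add: o_def)
  then have f: "continuous_on UNIV ?f" by (intro continuous_intros)
  have "exp (?f t) = 1" for t
    using eq [OF solenoid_line_in, of t] solenoid_character_line [of q t]
    by (simp add: exp_diff c_def cis_conv_exp mult_ac)
  from constant_of_exp_eq_1 [OF f this]
  have lin: "?f t = ?f 0" for t .
  have bound: "\<bar>c * t\<bar> \<le> 2 * M" for t
  proof -
    have "of_real (c * t) * \<i> = L (solenoid_line t) - L (solenoid_line 0)"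
      using lin [of t] by (simp add: algebra_simps)
    then have "cmod (of_real (c * t) * \<i>) = cmod (L (solenoid_line t) - L (solenoid_line 0))"
      by (rule arg_cong)
    then have "\<bar>c * t\<bar> = cmod (L (solenoid_line t) - L (solenoid_line 0))"
      by (simp add: norm_mult abs_mult)
    then show ?thesis
      using norm_triangle_ineq4 [of "L (solenoid_line t)" "L (solenoid_line 0)"] M [OF solenoid_line_in, of t]
        M [OF solenoid_line_in, of 0] by linarith
  qed
  from bound [of "(2 * M + 1) / c"] have "c = 0" by (cases "c = 0") auto
  then show ?thesis by (simp add: c_def)
qed

text \<open>Along the universal cover of the circle, \<open>\<phi>\<close> has a logarithm \<open>g\<close>. Its increment over a period is
  \<open>2 \<pi> \<i> m\<close> with a constant integer \<open>m\<close>, the winding number; after subtraction of \<open>2 \<pi> \<i> m t\<close> it is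
  periodic and descends to the circle.\<close>

lemma circle_map_log:
  assumes \<phi>: "continuous_on (sphere 0 1) \<phi>" and nz: "\<And>z :: complex. cmod z = 1 \<Longrightarrow> \<phi> z \<noteq> 0"
  obtains m :: int and L where "continuous_on (sphere 0 1) L" "\<And>z. cmod z = 1 \<Longrightarrow> \<phi> z = z powi m * exp (L z)"
proof -
  have "continuous_on UNIV (\<lambda>t. \<phi> (cis (2 * pi * t)))"
    by (rule continuous_on_compose2 [OF \<phi>]) (auto intro!: continuous_intros)
  then obtain g where g: "continuous_on UNIV g" "\<And>t. \<phi> (cis (2 * pi * t)) = exp (g t)"
    by (rule continuous_logarithm_on_contractible) (auto simp: nz convex_imp_contractible)
  have c1: "cis (2 * pi * (t + 1)) = cis (2 * pi * t)" for t :: real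
    by (simp add: complex_eq_iff distrib_left)
  have "continuous_on UNIV (\<lambda>t. g (t + 1) - g t)"
    by (intro continuous_intros continuous_on_compose2 [OF g(1)]) auto
  moreover have "exp (g (t + 1) - g t) = 1" for t
    using g(2) [of t] g(2) [of "t + 1"] by (simp add: exp_diff c1)
  ultimately have const: "g (t + 1) - g t = g 1 - g 0" for t
    using constant_of_exp_eq_1 [of "\<lambda>t. g (t + 1) - g t" t 0] by simp
  have "exp (g 1) = exp (g 0)" using g(2) [of 0] g(2) [of 1] by simp
  then obtain m :: int where m: "g 1 = g 0 + (of_int (2 * m) * pi) * \<i>" unfolding exp_eq by blast
  define G where "G t = g t - of_real (2 * pi * of_int m * t) * \<i>" for t
  have Gc: "continuous_on UNIV G" unfolding G_def by (intro continuous_intros g(1))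
  have G1: "G 1 = G 0" unfolding G_def using m by simp
  have G: "\<phi> (cis (2 * pi * t)) = cis (2 * pi * t) powi m * exp (G t)" for t
  proof -
    have "cis (2 * pi * t) powi m = cis (of_int m * (2 * pi * t))"
      by (rule cis_power_int)
    then have "cis (2 * pi * t) powi m = exp (of_real (2 * pi * of_int m * t) * \<i>)"
      by (simp only: cis_conv_exp) (simp add: mult_ac)
    then show ?thesis unfolding g(2) G_def by (simp add: exp_diff)
  qed
  let ?I = "top_of_set {0..1::real}" and ?S = "top_of_set (sphere 0 1) :: complex topology"
  have q: "quotient_map ?I ?S (\<lambda>t. cis (2 * pi * t))"
  proof (rule continuous_imp_quotient_map)
    show "continuous_map ?I ?S (\<lambda>t. cis (2 * pi * t))"
      by (auto simp: continuous_map_in_subtopology intro!: continuous_intros)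
    show "compact_space ?I" by (simp add: compact_space_subtopology)
    show "Hausdorff_space ?S" by (simp add: Hausdorff_space_subtopology)
    show "(\<lambda>t. cis (2 * pi * t)) ` topspace ?I = topspace ?S"
    proof (intro equalityI subsetI)
      fix z assume "z \<in> topspace ?S"
      then have z: "cmod z = 1" by simp
      have "z = cis (2 * pi * (Arg2pi z / (2 * pi)))"
        using Arg2pi_eq [of z] z by (simp add: cis_conv_exp)
      moreover have "Arg2pi z / (2 * pi) \<in> {0..1}"
        using Arg2pi_ge_0 [of z] Arg2pi_lt_2pi [of z] by (auto simp: divide_simps)
      ultimately show "z \<in> (\<lambda>t. cis (2 * pi * t)) ` topspace ?I"
        unfolding topspace_euclidean_subtopology by (rule image_eqI)
    qed auto
  qed
  have "continuous_map ?I euclidean G" using continuous_on_subset [OF Gc] by simp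
  then obtain L where L: "continuous_map ?S euclidean L" "\<And>t. t \<in> {0..1} \<Longrightarrow> L (cis (2 * pi * t)) = G t"
  proof (rule quotient_map_lift_exists [OF q])
    fix s t assume st: "s \<in> topspace ?I" "t \<in> topspace ?I" and "cis (2 * pi * s) = cis (2 * pi * t)"
    then have "exp (\<i> * of_real (2 * pi * s)) = exp (\<i> * of_real (2 * pi * t))" by (simp add: cis_conv_exp)
    then obtain n :: int where "\<i> * of_real (2 * pi * s) = \<i> * of_real (2 * pi * t) + (of_int (2 * n) * pi) * \<i>"
      unfolding exp_eq by blast
    then have "2 * pi * s = 2 * pi * t + 2 * pi * of_int n"
      by (simp add: complex_eq_iff)
    then have "2 * pi * s = 2 * pi * (t + of_int n)" by (simp add: algebra_simps)
    then have n: "s = t + of_int n" by simp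
    then have "\<bar>real_of_int n\<bar> \<le> 1" using st by auto
    then have "n = -1 \<or> n = 0 \<or> n = 1" by linarith
    then show "G s = G t" using n st G1 by auto
  qed auto
  show ?thesis
  proof (rule that)
    show "continuous_on (sphere 0 1) L" using L(1) by simp
    fix z :: complex assume "cmod z = 1"
    then obtain t where t: "t \<in> {0..1}" "z = cis (2 * pi * t)"
      using quotient_imp_surjective_map [OF q] by (metis (no_types, lifting) imageE mem_sphere_0 topspace_euclidean_subtopology)
    show "\<phi> z = z powi m * exp (L z)" unfolding t(2) L(2) [OF t(1)] by (rule G)
  qed
qed

subsection \<open>Approximation from finite levels\<close>

text \<open>Functions of a single coordinate are closed under sums and products, since the coordinates \<open>n\<close> and
  \<open>m\<close> are both powers of the coordinate \<open>n m\<close>. They separate points, so the theorem of Stone and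
  Weierstrass applies.\<close>

lemma finite_level_approximation_real:
  fixes f :: "(nat \<Rightarrow> complex) \<Rightarrow> real"
  assumes f: "continuous_map S1_Q euclidean f" and e: "0 < e"
  obtains n \<phi> where "0 < n" "continuous_on (sphere 0 1) \<phi>" "\<And>u. u \<in> topspace S1_Q \<Longrightarrow> \<bar>f u - \<phi> (u n)\<bar> < e"
proof -
  define P where "P f \<longleftrightarrow> (\<exists>n>0. \<exists>\<phi>. continuous_on (sphere 0 1) \<phi> \<and> (\<forall>u\<in>topspace S1_Q. f u = \<phi> (u n)))"
    for f :: "(nat \<Rightarrow> complex) \<Rightarrow> real"
  have comb: "P (\<lambda>u. h (f u) (g u))" if "P f" "P g" and h: "continuous_on UNIV (\<lambda>p. h (fst p) (snd p))"
    for f g and h :: "real \<Rightarrow> real \<Rightarrow> real"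
  proof -
    obtain n \<phi> where n: "n > 0" "continuous_on (sphere 0 1) \<phi>" "\<And>u. u \<in> topspace S1_Q \<Longrightarrow> f u = \<phi> (u n)"
      using \<open>P f\<close> unfolding P_def by blast
    obtain m \<psi> where m: "m > 0" "continuous_on (sphere 0 1) \<psi>" "\<And>u. u \<in> topspace S1_Q \<Longrightarrow> g u = \<psi> (u m)"
      using \<open>P g\<close> unfolding P_def by blast
    show ?thesis
      unfolding P_def
    proof (intro exI [of _ "n * m"] exI [of _ "\<lambda>z. h (\<phi> (z ^ m)) (\<psi> (z ^ n))"] conjI ballI)
      show "0 < n * m" using n m by simp
      have "continuous_on (sphere 0 1) (\<lambda>z. (\<phi> (z ^ m), \<psi> (z ^ n)))"
        by (intro continuous_on_Pair continuous_on_compose2 [OF n(2)] continuous_on_compose2 [OF m(2)])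
          (auto intro!: continuous_intros simp: norm_power)
      from continuous_on_compose2 [OF h this] show "continuous_on (sphere 0 1) (\<lambda>z. h (\<phi> (z ^ m)) (\<psi> (z ^ n)))" by simp
      fix u assume u: "u \<in> topspace S1_Q"
      show "h (f u) (g u) = h (\<phi> (u (n * m) ^ m)) (\<psi> (u (n * m) ^ n))"
        using S1_Q_power [OF u n(1) m(1)] S1_Q_power [OF u m(1) n(1)] n(3) [OF u] m(3) [OF u]
        by (simp add: mult.commute)
    qed
  qed
  have "\<exists>g. P g \<and> (\<forall>x\<in>topspace S1_Q. \<bar>f x - g x\<bar> < e)"
  proof (rule Stone_Weierstrass_HOL [OF compact_S1_Q])
    show "P (\<lambda>x. c)" for c unfolding P_def by (rule exI [of _ 1]) (auto intro!: exI [of _ "\<lambda>_. c"])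
    show "continuous_on (topspace S1_Q) g" if Pg: "P g" for g
    proof -
      obtain n \<phi> where n: "n > 0" "continuous_on (sphere 0 1) \<phi>" "\<And>u. u \<in> topspace S1_Q \<Longrightarrow> g u = \<phi> (u n)"
        using Pg unfolding P_def by blast
      have "continuous_map S1_Q euclidean (\<lambda>u. \<phi> (u n))"
        by (rule continuous_map_apply [OF n(2) continuous_S1_Q_coordinate [OF n(1)]]) (use S1_Q_norm n(1) in auto)
      then have "continuous_map S1_Q euclidean g" by (rule continuous_map_eq) (simp add: n(3))
      then show ?thesis by (simp only: continuous_on_S1_Q_iff)
    qed
    show "P (\<lambda>x. g x + h x)" if "P g \<and> P h" for g h
      by (rule comb [where f = g and g = h and h = "(+)"]) (use that in \<open>auto intro!: continuous_intros\<close>)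
    show "P (\<lambda>x. g x * h x)" if "P g \<and> P h" for g h
      by (rule comb [where f = g and g = h and h = "(*)"]) (use that in \<open>auto intro!: continuous_intros\<close>)
    show "\<exists>g. P g \<and> g u \<noteq> g v" if uv: "u \<in> topspace S1_Q \<and> v \<in> topspace S1_Q \<and> u \<noteq> v" for u v
    proof -
      have "\<exists>n>0. u n \<noteq> v n"
      proof (rule ccontr)
        assume "\<not> (\<exists>n>0. u n \<noteq> v n)"
        then have "u n = v n" if "n \<in> {0<..}" for n using that by (metis greaterThan_iff)
        then have "u = v" using uv by (intro extensionalityI [of u "{0<..}" v]) (simp_all add: S1_Q_iff)
        then show False using uv by simp
      qed
      then obtain n where n: "n > 0" "u n \<noteq> v n" by blast
      have "P (\<lambda>u. Re (u n))"
        unfolding P_def using n(1) by (auto intro!: exI [of _ n] exI [of _ Re] continuous_intros)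
      moreover have "P (\<lambda>u. Im (u n))"
        unfolding P_def using n(1) by (auto intro!: exI [of _ n] exI [of _ Im] continuous_intros)
      moreover have "Re (u n) \<noteq> Re (v n) \<or> Im (u n) \<noteq> Im (v n)" using n(2) by (simp add: complex_eq_iff)
      ultimately show ?thesis by blast
    qed
    show "continuous_on (topspace S1_Q) f" using f by (simp only: continuous_on_S1_Q_iff)
  qed (rule e)
  then obtain g where "P g" and g: "\<And>u. u \<in> topspace S1_Q \<Longrightarrow> \<bar>f u - g u\<bar> < e" by blast
  then obtain n \<phi> where n: "n > 0" "continuous_on (sphere 0 1) \<phi>" "\<And>u. u \<in> topspace S1_Q \<Longrightarrow> g u = \<phi> (u n)"
    unfolding P_def by blast
  show ?thesis by (rule that [OF n(1,2)]) (use g n(3) in auto)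
qed

lemma finite_level_approximation:
  fixes f :: "(nat \<Rightarrow> complex) \<Rightarrow> complex"
  assumes f: "continuous_map S1_Q euclidean f" and e: "0 < e"
  obtains n \<phi> where "0 < n" "continuous_on (sphere 0 1) \<phi>" "\<And>u. u \<in> topspace S1_Q \<Longrightarrow> cmod (f u - \<phi> (u n)) < e"
proof -
  have "continuous_map S1_Q euclidean (\<lambda>u. Re (f u))"
    by (rule continuous_map_apply [where S = UNIV, OF _ f]) (auto intro!: continuous_intros)
  then obtain n \<phi> where n: "0 < n" "continuous_on (sphere 0 1) \<phi>" "\<And>u. u \<in> topspace S1_Q \<Longrightarrow> \<bar>Re (f u) - \<phi> (u n)\<bar> < e / 2"
    by (rule finite_level_approximation_real [where e = "e / 2"]) (use e in auto)
  have "continuous_map S1_Q euclidean (\<lambda>u. Im (f u))"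
    by (rule continuous_map_apply [where S = UNIV, OF _ f]) (auto intro!: continuous_intros)
  then obtain m \<psi> where m: "0 < m" "continuous_on (sphere 0 1) \<psi>" "\<And>u. u \<in> topspace S1_Q \<Longrightarrow> \<bar>Im (f u) - \<psi> (u m)\<bar> < e / 2"
    by (rule finite_level_approximation_real [where e = "e / 2"]) (use e in auto)
  show ?thesis
  proof (rule that [of "n * m" "\<lambda>z. Complex (\<phi> (z ^ m)) (\<psi> (z ^ n))"])
    show "0 < n * m" using n m by simp
    show "continuous_on (sphere 0 1) (\<lambda>z. Complex (\<phi> (z ^ m)) (\<psi> (z ^ n)))"
      by (intro continuous_on_Complex continuous_on_compose2 [OF n(2)] continuous_on_compose2 [OF m(2)])
        (auto intro!: continuous_intros simp: norm_power)
    fix u assume u: "u \<in> topspace S1_Q"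
    let ?d = "f u - Complex (\<phi> (u (n * m) ^ m)) (\<psi> (u (n * m) ^ n))"
    have "Re ?d = Re (f u) - \<phi> (u n)" "Im ?d = Im (f u) - \<psi> (u m)"
      using S1_Q_power [OF u n(1) m(1)] S1_Q_power [OF u m(1) n(1)] by (simp_all add: mult.commute)
    then show "cmod ?d < e" using cmod_le [of ?d] n(3) [OF u] m(3) [OF u] by linarith
  qed
qed

text \<open>The existence half of Scheffer's theorem. A function \<open>\<phi>\<close> of one coordinate that is closer to \<open>f\<close> than
  \<open>f\<close> is to zero has a quotient \<open>\<phi> / f\<close> with values in the right half-plane, hence with a logarithm;
  and \<open>\<phi>\<close> itself is a power times an exponential because it is defined on a circle.\<close>

lemma solenoid_map_log:
  assumes f: "continuous_map S1_Q euclidean f" and nz: "\<And>u. u \<in> topspace S1_Q \<Longrightarrow> f u \<noteq> (0::complex)"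
  obtains q L where "continuous_map S1_Q euclidean L"
    "\<And>u. u \<in> topspace S1_Q \<Longrightarrow> f u = solenoid_character q u * exp (L u)"
proof -
  have "continuous_on (topspace S1_Q) (\<lambda>u. cmod (f u))"
    using f unfolding continuous_on_S1_Q_iff [symmetric] by (intro continuous_intros)
  then obtain u0 where u0: "u0 \<in> topspace S1_Q" "\<And>u. u \<in> topspace S1_Q \<Longrightarrow> cmod (f u0) \<le> cmod (f u)"
    using continuous_attains_inf [OF compact_S1_Q S1_Q_nonempty] by blast
  have "0 < cmod (f u0)" using nz [OF u0(1)] by simp
  then obtain n \<phi> where n: "0 < n" and \<phi>: "continuous_on (sphere 0 1) \<phi>"
    and close: "\<And>u. u \<in> topspace S1_Q \<Longrightarrow> cmod (f u - \<phi> (u n)) < cmod (f u0)"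
    by (rule finite_level_approximation [OF f]) auto
  define w where "w u = \<phi> (u n) / f u" for u
  have w: "Re (w u) > 0" if u: "u \<in> topspace S1_Q" for u
  proof -
    have "1 - w u = (f u - \<phi> (u n)) / f u" using nz [OF u] by (simp add: w_def diff_divide_distrib)
    then have "cmod (1 - w u) = cmod (f u - \<phi> (u n)) / cmod (f u)" by (simp only: norm_divide)
    moreover have "cmod (f u - \<phi> (u n)) < cmod (f u)" using close [OF u] u0(2) [OF u] by linarith
    ultimately have "cmod (1 - w u) < 1"
      using nz [OF u] by simp
    moreover have "Re (1 - w u) \<le> cmod (1 - w u)" by (rule complex_Re_le_cmod)
    ultimately show ?thesis by simp
  qed
  have \<phi>c: "continuous_map S1_Q euclidean (\<lambda>u. \<phi> (u n))"
    by (rule continuous_map_apply [OF \<phi> continuous_S1_Q_coordinate [OF n]]) (use S1_Q_norm n in auto)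
  have wc: "continuous_map S1_Q euclidean w"
    unfolding w_def by (rule continuous_map_complex_divide [OF \<phi>c f nz])
  have "\<phi> z \<noteq> 0" if z: "cmod z = 1" for z
  proof -
    obtain u where u: "u \<in> topspace S1_Q" "u n = z" by (rule S1_Q_projection_surj [OF n z])
    then show ?thesis using w [OF u(1)] by (auto simp: w_def)
  qed
  then obtain m :: int and L where L: "continuous_on (sphere 0 1) L" "\<And>z. cmod z = 1 \<Longrightarrow> \<phi> z = z powi m * exp (L z)"
    by (rule circle_map_log [OF \<phi>]) auto
  show ?thesis
  proof (rule that)
    have "continuous_map S1_Q euclidean (\<lambda>u. Ln (w u))"
    proof (rule continuous_map_apply [where S = "{z. Re z > 0}" and h = Ln, OF _ wc])
      show "continuous_on {z. Re z > 0} Ln"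
        by (rule continuous_on_Ln) (auto simp: complex_nonpos_Reals_iff)
    qed (use w in auto)
    moreover have "continuous_map S1_Q euclidean (\<lambda>u. L (u n))"
      by (rule continuous_map_apply [OF L(1) continuous_S1_Q_coordinate [OF n]]) (use S1_Q_norm n in auto)
    ultimately show "continuous_map S1_Q euclidean (\<lambda>u. L (u n) - Ln (w u))"
      by (rule continuous_map_diff [rotated])
    fix u assume u: "u \<in> topspace S1_Q"
    have w0: "w u \<noteq> 0" using w [OF u] by auto
    have "f u = \<phi> (u n) / w u" using w0 nz [OF u] by (simp add: w_def)
    also have "\<dots> = u n powi m * exp (L (u n) - Ln (w u))"
      using L(2) [OF S1_Q_norm [OF u n]] w0 by (simp add: exp_diff)
    also have "u n powi m = solenoid_character (of_int m / of_nat n) u"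
      by (rule solenoid_character_fraction [OF u n, symmetric])
    finally show "f u = solenoid_character (of_int m / of_nat n) u * exp (L (u n) - Ln (w u))" .
  qed
qed

section \<open>The adelic projective line as a suspension\<close>

lemma CP1_Q_iff:
  "x \<in> topspace CP1_Q \<longleftrightarrow> x \<in> extensional {0<..} \<and> (\<forall>n>0. x n \<in> topspace CP1) \<and>
     (\<forall>i>0. \<forall>j>0. i dvd j \<longrightarrow> cp1_power (j div i) (x j) = x i)"
  by (auto simp: CP1_Q_def inverse_limit_def PiE_def Pi_def)

lemma continuous_map_into_CP1_Q:
  assumes "\<And>n. 0 < n \<Longrightarrow> continuous_map Z CP1 (\<lambda>z. f z n)"
    and f: "\<And>z. z \<in> topspace Z \<Longrightarrow> f z \<in> topspace CP1_Q"
  shows "continuous_map Z CP1_Q f"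
  unfolding CP1_Q_def inverse_limit_def
proof (intro continuous_map_into_subtopology)
  show "continuous_map Z (product_topology (\<lambda>_. CP1) {0<..}) f"
    unfolding continuous_map_componentwise
  proof (intro conjI ballI)
    show "f ` topspace Z \<subseteq> extensional {0<..}" using f by (auto simp: CP1_Q_iff)
    show "continuous_map Z CP1 (\<lambda>z. f z n)" if "n \<in> {0<..}" for n
      using that assms(1) by auto
  qed
  show "f \<in> topspace Z \<rightarrow> {x. \<forall>i\<in>{0<..}. \<forall>j\<in>{0<..}. i dvd j \<longrightarrow> cp1_power (j div i) (x j) = x i}"
    using f by (auto simp: CP1_Q_iff)
qed

lemma Hausdorff_space_CP1_Q: "Hausdorff_space CP1_Q"
  unfolding CP1_Q_def inverse_limit_def
  by (intro Hausdorff_space_subtopology) (simp add: Hausdorff_space_product_topology Hausdorff_space_CP1)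

lemma proj_line_eq_cross:
  assumes "v \<noteq> 0" "w \<noteq> 0"
  shows "proj_line v = proj_line w \<longleftrightarrow> fst v * snd w = fst w * snd v"
proof
  assume "proj_line v = proj_line w"
  then obtain c where "w = (c * fst v, c * snd v)" using proj_line_eq_iff [OF assms(1)] by blast
  then show "fst v * snd w = fst w * snd v" by simp
next
  assume eq: "fst v * snd w = fst w * snd v"
  show "proj_line v = proj_line w"
    unfolding proj_line_eq_iff [OF assms(1)]
  proof (cases "fst v = 0")
    case True
    then have "snd v \<noteq> 0" "fst w = 0" using assms(1) eq by (auto simp: prod_eq_iff zero_prod_def)
    moreover have "snd w \<noteq> 0" using assms(2) calculation by (auto simp: prod_eq_iff zero_prod_def)
    ultimately show "\<exists>c. c \<noteq> 0 \<and> w = (c * fst v, c * snd v)"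
      using True by (intro exI [of _ "snd w / snd v"]) (simp add: prod_eq_iff)
  next
    case False
    have "fst w \<noteq> 0" using eq False assms(2) by (auto simp: prod_eq_iff zero_prod_def)
    then show "\<exists>c. c \<noteq> 0 \<and> w = (c * fst v, c * snd v)"
      using False eq by (intro exI [of _ "fst w / fst v"]) (simp add: prod_eq_iff field_simps)
  qed
qed

lemma susp_vector_nonzero:
  assumes "u \<noteq> 0" "s \<in> {0..1}" "0 < n"
  shows "(of_real (root n s) * u, of_real (root n (1 - s))) \<noteq> (0 :: complex \<times> complex)"
  using assms by (auto simp: zero_prod_def)

lemma S1_Q_nonzero: "u \<in> topspace S1_Q \<Longrightarrow> 0 < n \<Longrightarrow> u n \<noteq> 0"
  using S1_Q_norm [of u n] by auto

lemma root_power_div: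
  assumes "0 < i" "0 < d" "0 \<le> s"
  shows "root (i * d) s ^ d = root i s"
proof -
  have "root (i * d) s = root d (root i s)" using real_root_mult_exp [of d i s] by (simp add: mult.commute)
  then show ?thesis using assms by (simp add: real_root_pow_pos2)
qed

lemma susp_S1_Q_in:
  assumes u: "u \<in> topspace S1_Q" and s: "s \<in> {0..1}"
  shows "susp_S1_Q u s \<in> topspace CP1_Q"
  unfolding CP1_Q_iff
proof (intro conjI allI impI)
  show "susp_S1_Q u s \<in> extensional {0<..}" by (simp add: susp_S1_Q_def)
  show "susp_S1_Q u s n \<in> topspace CP1" if n: "0 < n" for n
    using n susp_vector_nonzero [OF S1_Q_nonzero [OF u n] s n] by (auto simp: susp_S1_Q_def topspace_CP1)
  show "cp1_power (j div i) (susp_S1_Q u s j) = susp_S1_Q u s i" if ij: "0 < i" "0 < j" "i dvd j" for i j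
  proof -
    obtain d where d: "j = i * d" using ij(3) by (rule dvdE)
    then have d0: "0 < d" and jd: "j div i = d" using ij by auto
    have r: "(of_real (root (i * d) a) :: complex) ^ d = of_real (root i a)" if "0 \<le> a" for a
      using root_power_div [OF ij(1) d0 that] by (metis of_real_power)
    show ?thesis
      using ij d0 s S1_Q_power [OF u ij(1) d0]
      by (simp add: susp_S1_Q_def jd cp1_power_proj_line power_mult_distrib d r)
  qed
qed

text \<open>Absolute values at level \<open>1\<close> determine \<open>s\<close>; away from the poles, level \<open>n\<close> then determines \<open>u n\<close>.\<close>

lemma susp_S1_Q_eq_iff:
  assumes u: "u \<in> topspace S1_Q" and s: "s \<in> {0..1}" and u': "u' \<in> topspace S1_Q" and s': "s' \<in> {0..1}"
  shows "susp_S1_Q u s = susp_S1_Q u' s' \<longleftrightarrow> s = s' \<and> (s = 0 \<or> s = 1 \<or> u = u')"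
proof -
  have level: "susp_S1_Q u s n = susp_S1_Q u' s' n \<longleftrightarrow>
      of_real (root n s) * u n * of_real (root n (1 - s')) = of_real (root n s') * u' n * of_real (root n (1 - s))"
    if n: "0 < n" for n
    using proj_line_eq_cross [OF susp_vector_nonzero [OF S1_Q_nonzero [OF u n] s n]
      susp_vector_nonzero [OF S1_Q_nonzero [OF u' n] s' n]] n by (simp add: susp_S1_Q_def)
  show ?thesis
  proof
    assume eq: "susp_S1_Q u s = susp_S1_Q u' s'"
    have "of_real s * u 1 * of_real (1 - s') = of_real s' * u' 1 * of_real (1 - s)"
      using level [of 1] eq by simp
    then have "cmod (of_real s * u 1 * of_real (1 - s')) = cmod (of_real s' * u' 1 * of_real (1 - s))"
      by (rule arg_cong)
    then have "s * (1 - s') = s' * (1 - s)"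
      using s s' S1_Q_norm [OF u, of 1] S1_Q_norm [OF u', of 1]
      by (simp add: norm_mult abs_of_nonneg del: of_real_diff)
    then have ss: "s = s'" by (simp add: algebra_simps)
    moreover have "u = u'" if "s \<noteq> 0" "s \<noteq> 1"
    proof (rule extensionalityI [of u "{0<..}" u'])
      fix n :: nat assume "n \<in> {0<..}"
      then have n: "0 < n" by simp
      then show "u n = u' n" using level [OF n] eq that by (simp add: ss)
    qed (use u u' in \<open>simp_all add: S1_Q_iff\<close>)
    ultimately show "s = s' \<and> (s = 0 \<or> s = 1 \<or> u = u')" by blast
  next
    assume *: "s = s' \<and> (s = 0 \<or> s = 1 \<or> u = u')"
    show "susp_S1_Q u s = susp_S1_Q u' s'"
    proof (rule extensionalityI [of _ "{0<..}"])
      fix n :: nat assume "n \<in> {0<..}"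
      then have n: "0 < n" by simp
      show "susp_S1_Q u s n = susp_S1_Q u' s' n" unfolding level [OF n] using * by auto
    qed (simp_all add: susp_S1_Q_def)
  qed
qed

text \<open>The affine coordinates \<open>a n\<close> of a point other than the poles satisfy \<open>(a (i d)) ^ d = a i\<close>. Their phases
  form an element of the solenoid, and their absolute values are the roots of \<open>\<bar>a 1\<bar> = s / (1 - s)\<close>.\<close>

lemma susp_S1_Q_onto:
  assumes x: "x \<in> topspace CP1_Q"
  obtains u s where "u \<in> topspace S1_Q" "s \<in> {0..1}" "x = susp_S1_Q u s"
proof -
  have "\<exists>v. v \<noteq> 0 \<and> x n = proj_line v" if "0 < n" for n
  proof -
    have "x n \<in> topspace CP1" using x that by (simp add: CP1_Q_iff)
    then show ?thesis by (auto simp: topspace_CP1)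
  qed
  then obtain v where v: "\<And>n. 0 < n \<Longrightarrow> v n \<noteq> 0" "\<And>n. 0 < n \<Longrightarrow> x n = proj_line (v n)" by metis
  define z w where "z n = fst (v n)" and "w n = snd (v n)" for n
  have zw: "z n \<noteq> 0 \<or> w n \<noteq> 0" if "0 < n" for n
    using v(1) [OF that] by (auto simp: z_def w_def prod_eq_iff zero_prod_def)
  have xn: "x n = proj_line (z n, w n)" if "0 < n" for n using v(2) [OF that] by (simp add: z_def w_def)
  have compat: "z (i * d) ^ d * w i = z i * w (i * d) ^ d" if i: "0 < i" "0 < d" for i d
  proof -
    have "\<forall>i>0. \<forall>j>0. i dvd j \<longrightarrow> cp1_power (j div i) (x j) = x i" using x by (simp add: CP1_Q_iff)
    moreover have "0 < i * d" "i dvd i * d" using i by simp_all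
    ultimately have "cp1_power (i * d div i) (x (i * d)) = x i" using i(1) by blast
    then have "proj_line (z (i * d) ^ d, w (i * d) ^ d) = proj_line (z i, w i)"
      using i by (simp add: xn cp1_power_proj_line)
    moreover have "(z (i * d) ^ d, w (i * d) ^ d) \<noteq> 0" "(z i, w i) \<noteq> 0"
      using zw [of "i * d"] zw [of i] i by (auto simp: zero_prod_def)
    ultimately show ?thesis using proj_line_eq_cross by force
  qed
  \<comment> \<open>Cross-multiplication compares homogeneous coordinates without case distinctions at the poles.\<close>
  have crit: "x = susp_S1_Q u s" if u: "u \<in> topspace S1_Q" and s: "s \<in> {0..1}"
    and eq: "\<And>n. 0 < n \<Longrightarrow> z n * of_real (root n (1 - s)) = of_real (root n s) * u n * w n" for u s
  proof (rule extensionalityI [of _ "{0<..}"])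
    show "x \<in> extensional {0<..}" using x by (simp add: CP1_Q_iff)
    show "susp_S1_Q u s \<in> extensional {0<..}" by (simp add: susp_S1_Q_def)
    fix n :: nat assume "n \<in> {0<..}"
    then have n: "0 < n" by simp
    have "(z n, w n) \<noteq> 0" using zw [OF n] by (auto simp: zero_prod_def)
    then have "proj_line (z n, w n) = proj_line (of_real (root n s) * u n, of_real (root n (1 - s)))"
      using eq [OF n] proj_line_eq_cross [OF _ susp_vector_nonzero [OF S1_Q_nonzero [OF u n] s n]] by simp
    then show "x n = susp_S1_Q u s n" using n by (simp add: xn susp_S1_Q_def)
  qed
  have c1: "z n ^ n * w 1 = z 1 * w n ^ n" if "0 < n" for n using compat [of 1 n] that by simp
  have base: "solenoid_line 0 \<in> topspace S1_Q" by (rule solenoid_line_in)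
  show ?thesis
  proof (cases "z 1 = 0 \<or> w 1 = 0")
    case True
    then show ?thesis
    proof
      assume z1: "z 1 = 0"
      then have "w 1 \<noteq> 0" using zw [of 1] by simp
      then have "z n = 0" if "0 < n" for n using c1 [OF that] z1 that by simp
      then show ?thesis by (intro that [OF base, of 0] crit [OF base]) auto
    next
      assume w1: "w 1 = 0"
      then have "z 1 \<noteq> 0" using zw [of 1] by simp
      then have "w n = 0" if "0 < n" for n using c1 [OF that] w1 that by simp
      then show ?thesis by (intro that [OF base, of 1] crit [OF base]) auto
    qed
  next
    case False
    then have wn: "w n \<noteq> 0" if "0 < n" for n
      using c1 [OF that] zw [OF that] that by (metis mult_eq_0_iff power_eq_0_iff zero_power)
    have zn: "z n \<noteq> 0" if "0 < n" for n
      using c1 [OF that] False wn [OF that] that by (metis mult_eq_0_iff power_eq_0_iff zero_power)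
    define a where "a n = z n / w n" for n
    have a0: "a n \<noteq> 0" if "0 < n" for n using wn zn that by (simp add: a_def)
    have apow: "a (i * d) ^ d = a i" if "0 < i" "0 < d" for i d
      using compat [OF that] wn [of i] wn [of "i * d"] that by (simp add: a_def power_divide field_simps)
    define r where "r = cmod (a 1)"
    have r: "r > 0" using a0 [of 1] by (simp add: r_def)
    have an: "cmod (a n) = root n r" if "0 < n" for n
      using apow [of 1 n] that by (simp add: r_def norm_power [symmetric] real_root_power_cancel flip: power_mult)
        (metis norm_ge_zero norm_power real_root_power_cancel)
    define u where "u = (\<lambda>n\<in>{0<..}. a n / of_real (cmod (a n)))"
    have u: "u \<in> topspace S1_Q"
      unfolding S1_Q_iff
    proof (intro conjI allI impI)
      show "u \<in> extensional {0<..}" by (simp add: u_def)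
      show "cmod (u n) = 1" if "0 < n" for n using a0 [OF that] that by (simp add: u_def norm_divide)
      show "u j ^ (j div i) = u i" if ij: "0 < i" "0 < j" "i dvd j" for i j
      proof -
        obtain d where d: "j = i * d" using ij(3) by (rule dvdE)
        then have d0: "0 < d" and jd: "j div i = d" using ij by auto
        have "cmod (a j) ^ d = cmod (a i)" using apow [OF ij(1) d0] by (simp add: d norm_power [symmetric])
        then have "(of_real (cmod (a j)) :: complex) ^ d = of_real (cmod (a i))" by (metis of_real_power)
        then show ?thesis using ij apow [OF ij(1) d0] by (simp add: u_def jd power_divide d [symmetric])
      qed
    qed
    define s where "s = r / (1 + r)"
    have s: "s \<in> {0..1}" using r by (simp add: s_def)
    have s1: "1 - s = 1 / (1 + r)" using r by (simp add: s_def field_simps)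
    have "z n * of_real (root n (1 - s)) = of_real (root n s) * u n * w n" if n: "0 < n" for n
    proof -
      have rs: "root n s = root n r * root n (1 - s)"
        unfolding s1 by (simp add: s_def real_root_mult [symmetric])
      have "of_real (root n r) * u n = a n"
        using n a0 [OF n] an [OF n] by (simp add: u_def flip: an)
      then have "of_real (root n s) * u n = a n * of_real (root n (1 - s))"
        unfolding rs by (simp add: mult_ac)
      then show ?thesis using wn [OF n] by (simp add: a_def)
    qed
    then show ?thesis by (intro that [OF u s] crit [OF u s])
  qed
qed

lemma continuous_susp_S1_Q:
  assumes f: "continuous_map Z S1_Q f" and s: "continuous_map Z (top_of_set {0..1}) s"
  shows "continuous_map Z CP1_Q (\<lambda>z. susp_S1_Q (f z) (s z))"
proof (rule continuous_map_into_CP1_Q)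
  have fz: "f z \<in> topspace S1_Q" if "z \<in> topspace Z" for z by (rule continuous_map_in_topspace [OF f that])
  have sz: "s z \<in> {0..1}" if "z \<in> topspace Z" for z using continuous_map_in_topspace [OF s that] by simp
  show "susp_S1_Q (f z) (s z) \<in> topspace CP1_Q" if "z \<in> topspace Z" for z
    by (rule susp_S1_Q_in [OF fz [OF that] sz [OF that]])
  fix n :: nat assume n: "0 < n"
  have sr: "continuous_map Z euclideanreal s" using s by (simp add: continuous_map_in_subtopology)
  have "continuous_map Z euclidean (\<lambda>z. f z n)"
    using continuous_map_compose [OF f continuous_S1_Q_coordinate [OF n]] by (simp add: o_def)
  moreover have "continuous_map Z euclidean (\<lambda>z. complex_of_real (root n (s z)))"
    by (rule continuous_map_apply [where S = UNIV and h = "\<lambda>s. complex_of_real (root n s)", OF _ sr])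
      (auto intro!: continuous_intros)
  ultimately have "continuous_map Z euclidean (\<lambda>z. of_real (root n (s z)) * f z n)"
    by (intro continuous_map_complex_mult)
  moreover have "continuous_map Z euclidean (\<lambda>z. complex_of_real (root n (1 - s z)))"
    by (rule continuous_map_apply [where S = UNIV and h = "\<lambda>s. complex_of_real (root n (1 - s))", OF _ sr])
      (auto intro!: continuous_intros)
  ultimately have "continuous_map Z CP1 (\<lambda>z. proj_line (of_real (root n (s z)) * f z n, of_real (root n (1 - s z))))"
    by (rule continuous_map_into_CP1)
      (use susp_vector_nonzero [OF S1_Q_nonzero [OF fz n] sz n] in \<open>auto simp: zero_prod_def\<close>)
  then show "continuous_map Z CP1 (\<lambda>z. susp_S1_Q (f z) (s z) n)"
    using n by (simp add: susp_S1_Q_def)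
qed

subsection \<open>Hemispheres\<close>

text \<open>The part of the adelic projective line where the suspension coordinate \<open>s\<close> lies in \<open>J\<close>.\<close>

definition slice :: "real set \<Rightarrow> (nat \<Rightarrow> cp1_point) set" where
  "slice J = {susp_S1_Q u s | u s. u \<in> topspace S1_Q \<and> s \<in> J}"

lemma sliceI: "u \<in> topspace S1_Q \<Longrightarrow> s \<in> J \<Longrightarrow> susp_S1_Q u s \<in> slice J"
  unfolding slice_def by blast

lemma slice_subset: "J \<subseteq> {0..1} \<Longrightarrow> slice J \<subseteq> topspace CP1_Q"
  using susp_S1_Q_in by (auto simp: slice_def)

lemma slice_unit_interval: "slice {0..1} = topspace CP1_Q"
proof
  show "topspace CP1_Q \<subseteq> slice {0..1}"
  proof
    fix x assume "x \<in> topspace CP1_Q"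
    then obtain u s where "u \<in> topspace S1_Q" "s \<in> {0..1}" "x = susp_S1_Q u s" by (rule susp_S1_Q_onto)
    then show "x \<in> slice {0..1}" unfolding slice_def by blast
  qed
qed (simp add: slice_subset)

lemma continuous_susp_slice:
  assumes "J \<subseteq> {0..1}"
  shows "continuous_map (prod_topology S1_Q (top_of_set J)) (subtopology CP1_Q (slice J)) (\<lambda>y. susp_S1_Q (fst y) (snd y))"
proof (rule continuous_map_into_subtopology)
  have "continuous_map (prod_topology S1_Q (top_of_set J)) (top_of_set {0..1}) snd"
    using continuous_map_snd [of S1_Q "top_of_set J"] assms by (auto simp: continuous_map_in_subtopology)
  then show "continuous_map (prod_topology S1_Q (top_of_set J)) CP1_Q (\<lambda>y. susp_S1_Q (fst y) (snd y))"
    by (rule continuous_susp_S1_Q [OF continuous_map_fst])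
qed (auto intro: sliceI)

lemma compact_space_slice_domain:
  assumes "compact J"
  shows "compact_space (prod_topology S1_Q (top_of_set J))"
  unfolding compact_space_prod_topology
  using compact_space_S1_Q assms compact_space_subtopology [of euclidean J] by simp

text \<open>A continuous map of a compact space onto a Hausdorff space is a quotient map, so functions and
  sections over a slice may be constructed in the coordinates \<open>(u, s)\<close>.\<close>

lemma quotient_map_susp_slice:
  assumes J: "compact J" "J \<subseteq> {0..1}"
  shows "quotient_map (prod_topology S1_Q (top_of_set J)) (subtopology CP1_Q (slice J)) (\<lambda>y. susp_S1_Q (fst y) (snd y))"
proof (rule continuous_imp_quotient_map [OF continuous_susp_slice [OF J(2)] compact_space_slice_domain [OF J(1)]])
  show "Hausdorff_space (subtopology CP1_Q (slice J))"
    by (rule Hausdorff_space_subtopology [OF Hausdorff_space_CP1_Q])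
  show "(\<lambda>y. susp_S1_Q (fst y) (snd y)) ` topspace (prod_topology S1_Q (top_of_set J)) = topspace (subtopology CP1_Q (slice J))"
  proof -
    have "(\<lambda>y. susp_S1_Q (fst y) (snd y)) ` (topspace S1_Q \<times> J) = slice J"
      by (force simp: slice_def image_iff)
    then show ?thesis using slice_subset [OF J(2)] by (simp add: inf.absorb2)
  qed
qed

lemma compactin_slice:
  assumes J: "compact J" "J \<subseteq> {0..1}"
  shows "compactin CP1_Q (slice J)"
proof -
  let ?Y = "prod_topology S1_Q (top_of_set J)"
  have "compactin ?Y (topspace ?Y)" using compact_space_slice_domain [OF J(1)] by (simp add: compact_space_def)
  from image_compactin [OF this quotient_imp_continuous_map [OF quotient_map_susp_slice [OF J]]]
  have "compactin (subtopology CP1_Q (slice J)) (topspace (subtopology CP1_Q (slice J)))"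
    using quotient_imp_surjective_map [OF quotient_map_susp_slice [OF J]] by simp
  then show ?thesis
    using slice_subset [OF J(2)] by (simp add: compactin_subtopology inf.absorb2)
qed

lemma closedin_slice: "compact J \<Longrightarrow> J \<subseteq> {0..1} \<Longrightarrow> closedin CP1_Q (slice J)"
  using compactin_imp_closedin [OF Hausdorff_space_CP1_Q compactin_slice] .

lemma compact_space_CP1_Q: "compact_space CP1_Q"
  using compactin_slice [of "{0..1}"] by (simp add: compact_space_def slice_unit_interval)

lemma descend_to_CP1_Q:
  assumes F: "continuous_map (prod_topology S1_Q (top_of_set {0..1})) Z F"
    and ends: "\<And>u u' e. u \<in> topspace S1_Q \<Longrightarrow> u' \<in> topspace S1_Q \<Longrightarrow> e = 0 \<or> e = 1 \<Longrightarrow> F (u, e) = F (u', e)"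
  obtains f where "continuous_map CP1_Q Z f"
    "\<And>u s. u \<in> topspace S1_Q \<Longrightarrow> s \<in> {0..1} \<Longrightarrow> f (susp_S1_Q u s) = F (u, s)"
proof -
  have q: "quotient_map (prod_topology S1_Q (top_of_set {0..1})) CP1_Q (\<lambda>y. susp_S1_Q (fst y) (snd y))"
    using quotient_map_susp_slice [of "{0..1}"] by (simp add: slice_unit_interval)
  obtain f where f: "continuous_map CP1_Q Z f"
    "\<And>y. y \<in> topspace (prod_topology S1_Q (top_of_set {0..1})) \<Longrightarrow> f (susp_S1_Q (fst y) (snd y)) = F y"
  proof (rule quotient_map_lift_exists [OF q F])
    fix y y' :: "(nat \<Rightarrow> complex) \<times> real"
    assume y: "y \<in> topspace (prod_topology S1_Q (top_of_set {0..1}))" "y' \<in> topspace (prod_topology S1_Q (top_of_set {0..1}))"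
      and eq: "susp_S1_Q (fst y) (snd y) = susp_S1_Q (fst y') (snd y')"
    obtain u s u' s' where yy: "y = (u, s)" "y' = (u', s')" by (metis surj_pair)
    have us: "u \<in> topspace S1_Q" "s \<in> {0..1}" "u' \<in> topspace S1_Q" "s' \<in> {0..1}"
      using y by (auto simp: yy)
    have "susp_S1_Q u s = susp_S1_Q u' s'" using eq by (simp add: yy)
    then have "s = s' \<and> (s = 0 \<or> s = 1 \<or> u = u')" using susp_S1_Q_eq_iff [OF us] by blast
    then show "F y = F y'" using ends [OF us(1,3), of s] by (auto simp: yy)
  qed auto
  show ?thesis
  proof (rule that [OF f(1)])
    fix u and s :: real assume "u \<in> topspace S1_Q" "s \<in> {0..1}"
    then show "f (susp_S1_Q u s) = F (u, s)" using f(2) [of "(u, s)"] by simp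
  qed
qed

text \<open>The paths run from the pole \<open>s = e\<close> to the points of the slice, along the lines \<open>u = const\<close>.\<close>

lemma continuous_cone_path:
  assumes "e \<in> {0..1}" "J \<subseteq> {0..1}"
  shows "continuous_map (prod_topology (prod_topology S1_Q (top_of_set J)) (top_of_set {0..1})) CP1_Q
    (\<lambda>p. susp_S1_Q (fst (fst p)) (e + snd p * (snd (fst p) - e)))"
proof (rule continuous_susp_S1_Q)
  let ?Y = "prod_topology S1_Q (top_of_set J)"
  let ?P = "prod_topology ?Y (top_of_set {0..1::real})"
  show "continuous_map ?P S1_Q (\<lambda>p. fst (fst p))"
    by (rule continuous_map_compose [OF continuous_map_fst continuous_map_fst, unfolded o_def])
  have s: "continuous_map ?P (top_of_set J) (\<lambda>p. snd (fst p))"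
    by (rule continuous_map_compose [OF continuous_map_fst continuous_map_snd, unfolded o_def])
  have r: "continuous_map ?P (top_of_set {0..1}) snd" by (rule continuous_map_snd)
  have "continuous_map ?P euclideanreal (\<lambda>p. e + snd p * (snd (fst p) - e))"
    using s r by (intro continuous_intros) (auto simp: continuous_map_in_subtopology)
  moreover have "e + t * (s - e) \<in> {0..1}" if "t \<in> {0..1}" "s \<in> {0..1}" for t s
  proof -
    have "e + t * (s - e) = (1 - t) *\<^sub>R e + t *\<^sub>R s" by (simp add: algebra_simps)
    then show ?thesis
      using convexD [OF convex_real_interval(5) assms(1) that(2), of "1 - t" t] that(1) by simp
  qed
  ultimately show "continuous_map ?P (top_of_set {0..1}) (\<lambda>p. e + snd p * (snd (fst p) - e))"
    using assms(2) by (intro continuous_map_into_subtopology) auto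
qed

text \<open>Every bundle is trivial over a cone: a vector at the pole is transported along the rays. The
  opposite pole must be excluded, since many rays meet there; at the pole \<open>e\<close> itself all paths are
  constant, and the transported vectors agree.\<close>

lemma frame_on_slice:
  assumes lb: "line_bundle CP1_Q E" and J: "compact J" "J \<subseteq> {0..1}" and e: "e = 0 \<or> e = 1"
    and J': "1 - e \<notin> J"
  obtains \<sigma> where "frame CP1_Q E (slice J) \<sigma>"
proof -
  let ?Y = "prod_topology S1_Q (top_of_set J)"
  let ?H = "\<lambda>p. susp_S1_Q (fst (fst p)) (e + snd p * (snd (fst p) - e))"
  let ?x0 = "susp_S1_Q (solenoid_line 0) e"
  have e01: "e \<in> {0..1}" using e by auto
  have pole: "susp_S1_Q u e = susp_S1_Q u' e" if "u \<in> topspace S1_Q" "u' \<in> topspace S1_Q" for u u'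
    using susp_S1_Q_eq_iff [OF that(1) e01 that(2) e01] e by blast
  obtain v0 where v0: "v0 \<in> fibre E ?x0" "nonzero_vector E v0"
    by (rule nonzero_exists [OF lb susp_S1_Q_in [OF solenoid_line_in e01]])
  have H0: "?H (y, 0) = ?x0" if "y \<in> topspace ?Y" for y
    using pole [OF _ solenoid_line_in] that by auto
  obtain \<sigma> where \<sigma>: "continuous_map ?Y (total_space E) \<sigma>"
    "\<And>y. y \<in> topspace ?Y \<Longrightarrow> \<sigma> y \<in> fibre E (?H (y, 1)) \<and> nonzero_vector E (\<sigma> y)"
    "\<And>y y'. \<forall>s\<in>{0..1}. ?H (y, s) = ?H (y', s) \<Longrightarrow> \<sigma> y = \<sigma> y'"
    by (rule transport_along_homotopy [OF lb compact_space_CP1_Q Hausdorff_space_CP1_Q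
        compact_space_slice_domain [OF J(1)] continuous_cone_path [OF e01 J(2)] H0 v0]) (assumption, rule that, assumption+)
  obtain \<tau> where \<tau>: "continuous_map (subtopology CP1_Q (slice J)) (total_space E) \<tau>"
    "\<And>y. y \<in> topspace ?Y \<Longrightarrow> \<tau> (susp_S1_Q (fst y) (snd y)) = \<sigma> y"
  proof (rule quotient_map_lift_exists [OF quotient_map_susp_slice [OF J] \<sigma>(1)])
    fix y y' assume y: "y \<in> topspace ?Y" "y' \<in> topspace ?Y"
      and eq: "susp_S1_Q (fst y) (snd y) = susp_S1_Q (fst y') (snd y')"
    have us: "fst y \<in> topspace S1_Q" "snd y \<in> {0..1}" "fst y' \<in> topspace S1_Q" "snd y' \<in> {0..1}"
      using y J(2) by auto
    have "snd y = snd y' \<and> (snd y = 0 \<or> snd y = 1 \<or> fst y = fst y')"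
      using susp_S1_Q_eq_iff [OF us] eq by blast
    moreover have "snd y \<noteq> 1 - e" using y J' by auto
    ultimately have "y = y' \<or> (snd y = e \<and> snd y' = e)" using e by (auto simp: prod_eq_iff)
    then have "\<forall>s\<in>{0..1}. ?H (y, s) = ?H (y', s)" using pole [of "fst y" "fst y'"] y by auto
    then show "\<sigma> y = \<sigma> y'" by (rule \<sigma>(3))
  qed auto
  have "frame CP1_Q E (slice J) \<tau>"
    unfolding frame_def
  proof (intro conjI ballI)
    fix x assume "x \<in> slice J"
    then obtain u s where us: "u \<in> topspace S1_Q" "s \<in> J" "x = susp_S1_Q u s" by (auto simp: slice_def)
    then have y: "(u, s) \<in> topspace ?Y" by simp
    show "\<tau> x \<in> fibre E x" "nonzero_vector E (\<tau> x)"
      using \<tau>(2) [OF y] \<sigma>(2) [OF y] us(3) by auto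
  qed (rule \<tau>(1))
  then show ?thesis by (rule that)
qed

text \<open>On a cone a function without zeros is homotopic to a constant along the rays, hence it has a
  logarithm on the equator.\<close>

lemma log_on_slice:
  fixes a :: "(nat \<Rightarrow> cp1_point) \<Rightarrow> complex"
  assumes J: "J \<subseteq> {0..1}" and e: "e = 0 \<or> e = 1" and seg: "closed_segment e (1/2) \<subseteq> J"
    and a: "continuous_map (subtopology CP1_Q (slice J)) euclidean a" and nz: "\<And>x. x \<in> slice J \<Longrightarrow> a x \<noteq> 0"
  obtains L where "continuous_map S1_Q euclidean L" "\<And>u. u \<in> topspace S1_Q \<Longrightarrow> a (susp_S1_Q u (1/2)) = exp (L u)"
proof -
  define h where "h = (\<lambda>r :: real. e + r * (1/2 - e))"
  have hJ: "h r \<in> J" if "r \<in> {0..1}" for r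
  proof -
    have "h r = (1 - r) *\<^sub>R e + r *\<^sub>R (1/2)" by (simp add: h_def algebra_simps)
    then have "h r \<in> closed_segment e (1/2)" unfolding in_segment using that by auto
    then show ?thesis using seg by blast
  qed
  let ?H = "\<lambda>p. a (susp_S1_Q (fst p) (h (snd p)))"
  let ?P = "prod_topology S1_Q (top_of_set {0..1::real})"
  have "continuous_map ?P euclideanreal (\<lambda>p. h (snd p))"
    using continuous_map_snd [of S1_Q "top_of_set {0..1::real}"] unfolding h_def
    by (intro continuous_intros) (simp_all add: continuous_map_in_subtopology)
  then have "continuous_map ?P (top_of_set {0..1}) (\<lambda>p. h (snd p))"
    using hJ J by (intro continuous_map_into_subtopology) auto
  then have "continuous_map ?P CP1_Q (\<lambda>p. susp_S1_Q (fst p) (h (snd p)))"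
    by (intro continuous_susp_S1_Q continuous_map_fst)
  then have "continuous_map ?P (subtopology CP1_Q (slice J)) (\<lambda>p. susp_S1_Q (fst p) (h (snd p)))"
    using hJ by (intro continuous_map_into_subtopology) (auto intro: sliceI)
  from continuous_map_compose [OF this a] have H: "continuous_map ?P euclidean ?H" by (simp add: o_def)
  obtain L where L: "continuous_map S1_Q euclidean L"
    "\<And>u. u \<in> topspace S1_Q \<Longrightarrow> ?H (u, 1) = ?H (u, 0) * exp (L u)"
  proof (rule log_along_homotopy [OF compact_space_S1_Q H])
    show "?H (u, s) \<noteq> 0" if "u \<in> topspace S1_Q" "s \<in> {0..1}" for u s
      using nz [OF sliceI [OF that(1) hJ [OF that(2)]]] by simp
  qed auto
  have e01: "e \<in> {0..1}" using e by auto
  let ?x0 = "susp_S1_Q (solenoid_line 0) e"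
  have h01: "h 0 = e" "h 1 = 1/2" by (simp_all add: h_def)
  have "a ?x0 \<noteq> 0" using nz [OF sliceI [OF solenoid_line_in hJ [of 0]]] by (simp add: h01)
  then have "a (susp_S1_Q u (1/2)) = exp (Ln (a ?x0) + L u)" if u: "u \<in> topspace S1_Q" for u
  proof -
    have "susp_S1_Q u e = ?x0" using susp_S1_Q_eq_iff [OF u e01 solenoid_line_in e01] e by blast
    then show ?thesis using L(2) [OF u] \<open>a ?x0 \<noteq> 0\<close> by (simp add: h01 exp_add)
  qed
  moreover have "continuous_map S1_Q euclidean (\<lambda>u. Ln (a ?x0) + L u)"
    by (intro continuous_intros L(1)) simp
  ultimately show ?thesis by (rule that [rotated])
qed

section \<open>Clutching functions\<close>

abbreviation south :: "(nat \<Rightarrow> cp1_point) set" where "south \<equiv> slice {0..1/2}"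
abbreviation north :: "(nat \<Rightarrow> cp1_point) set" where "north \<equiv> slice {1/2..1}"

text \<open>The transition function, on the equator \<open>s = 1/2\<close>, between nowhere vanishing sections over the two
  closed hemispheres.\<close>

definition clutching :: "('e, nat \<Rightarrow> cp1_point) bundle_data \<Rightarrow> ((nat \<Rightarrow> complex) \<Rightarrow> complex) \<Rightarrow> bool" where
  "clutching E t \<longleftrightarrow>
     (\<exists>\<sigma> \<tau>. frame CP1_Q E south \<sigma> \<and> frame CP1_Q E north \<tau> \<and>
        (\<forall>u\<in>topspace S1_Q. ratio E (\<tau> (susp_S1_Q u (1/2))) (\<sigma> (susp_S1_Q u (1/2))) = t u))"

lemma south_north:
  shows "closedin CP1_Q south" "closedin CP1_Q north" "south \<union> north = topspace CP1_Q"
    "x \<in> south \<inter> north \<Longrightarrow> \<exists>u\<in>topspace S1_Q. x = susp_S1_Q u (1/2)"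
proof -
  show "closedin CP1_Q south" "closedin CP1_Q north" by (rule closedin_slice; simp)+
  have "slice {0..1/2} \<union> slice {1/2..1} = slice ({0..1/2} \<union> {1/2..1})" unfolding slice_def by blast
  also have "{0..1/2} \<union> {1/2..1} = {0..1::real}" by auto
  finally show "south \<union> north = topspace CP1_Q" by (simp add: slice_unit_interval)
  assume "x \<in> south \<inter> north"
  then obtain u s u' s' where us: "u \<in> topspace S1_Q" "s \<in> {0..1/2}" "x = susp_S1_Q u s"
    "u' \<in> topspace S1_Q" "s' \<in> {1/2..1}" "x = susp_S1_Q u' s'"
    unfolding slice_def by blast
  have "s \<in> {0..1}" "s' \<in> {0..1}" using us by auto
  then have "s = s'" using susp_S1_Q_eq_iff [OF us(1) _ us(4)] us(3,6) by metis
  then have "s = 1/2" using us(2,5) by simp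
  then show "\<exists>u\<in>topspace S1_Q. x = susp_S1_Q u (1/2)" using us by blast
qed

lemma equator: "u \<in> topspace S1_Q \<Longrightarrow> susp_S1_Q u (1/2) \<in> south" "u \<in> topspace S1_Q \<Longrightarrow> susp_S1_Q u (1/2) \<in> north"
  by (auto intro: sliceI)

lemma continuous_on_equator:
  assumes "continuous_map (subtopology CP1_Q (slice J)) Y f" "1/2 \<in> J"
  shows "continuous_map S1_Q Y (\<lambda>u. f (susp_S1_Q u (1/2)))"
proof -
  have "continuous_map S1_Q CP1_Q (\<lambda>u. susp_S1_Q u (1/2))"
    by (rule continuous_susp_S1_Q) auto
  then have "continuous_map S1_Q (subtopology CP1_Q (slice J)) (\<lambda>u. susp_S1_Q u (1/2))"
    using assms(2) by (intro continuous_map_into_subtopology) (auto intro: sliceI)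
  from continuous_map_compose [OF this assms(1)] show ?thesis by (simp add: o_def)
qed

lemma clutching_continuous:
  assumes lb: "line_bundle CP1_Q E" and c: "clutching E t"
  shows "continuous_map S1_Q euclidean t" and "\<And>u. u \<in> topspace S1_Q \<Longrightarrow> t u \<noteq> 0"
proof -
  obtain \<sigma> \<tau> where \<sigma>: "frame CP1_Q E south \<sigma>" and \<tau>: "frame CP1_Q E north \<tau>"
    and t: "\<And>u. u \<in> topspace S1_Q \<Longrightarrow> ratio E (\<tau> (susp_S1_Q u (1/2))) (\<sigma> (susp_S1_Q u (1/2))) = t u"
    using c unfolding clutching_def by blast
  have "continuous_map S1_Q euclidean (\<lambda>u. ratio E (\<tau> (susp_S1_Q u (1/2))) (\<sigma> (susp_S1_Q u (1/2))))"
  proof (rule continuous_ratio [OF lb continuous_on_equator [OF frameD(1) [OF \<tau>]] continuous_on_equator [OF frameD(1) [OF \<sigma>]]])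
    fix u assume u: "u \<in> topspace S1_Q"
    show "proj E (\<sigma> (susp_S1_Q u (1/2))) = proj E (\<tau> (susp_S1_Q u (1/2)))"
      using fibreD(2) [OF frameD(2) [OF \<sigma> equator(1) [OF u]]] fibreD(2) [OF frameD(2) [OF \<tau> equator(2) [OF u]]] by simp
    show "nonzero_vector E (\<sigma> (susp_S1_Q u (1/2)))" by (rule frameD(3) [OF \<sigma> equator(1) [OF u]])
  qed auto
  then show "continuous_map S1_Q euclidean t" by (rule continuous_map_eq) (rule t)
  fix u assume u: "u \<in> topspace S1_Q"
  show "t u \<noteq> 0"
    using ratio_eq_0 [OF lb frameD(2) [OF \<tau> equator(2) [OF u]] frameD(2,3) [OF \<sigma> equator(1) [OF u]]]
      frameD(3) [OF \<tau> equator(2) [OF u]] t [OF u] by simp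
qed

lemma exists_clutching:
  assumes lb: "line_bundle CP1_Q E"
  obtains t where "clutching E t"
proof -
  obtain \<sigma> where \<sigma>: "frame CP1_Q E south \<sigma>" by (rule frame_on_slice [OF lb, of "{0..1/2}" 0]) auto
  obtain \<tau> where \<tau>: "frame CP1_Q E north \<tau>" by (rule frame_on_slice [OF lb, of "{1/2..1}" 1]) auto
  show ?thesis
    by (rule that [of "\<lambda>u. ratio E (\<tau> (susp_S1_Q u (1/2))) (\<sigma> (susp_S1_Q u (1/2)))"])
      (use \<sigma> \<tau> in \<open>auto simp: clutching_def\<close>)
qed

lemma frame_fscale:
  assumes lb: "line_bundle X E" and \<sigma>: "frame X E S \<sigma>" and S: "S \<subseteq> topspace X"
    and a: "continuous_map X euclidean a" and nz: "\<And>x. x \<in> topspace X \<Longrightarrow> a x \<noteq> 0"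
  shows "frame X E S (\<lambda>x. fscale E (a x) (\<sigma> x))"
  unfolding frame_def
proof (intro conjI ballI)
  show "continuous_map (subtopology X S) (total_space E) (\<lambda>x. fscale E (a x) (\<sigma> x))"
    by (rule continuous_fscale [OF lb frameD(1) [OF \<sigma>] continuous_map_from_subtopology [OF a]])
  fix x assume x: "x \<in> S"
  show "fscale E (a x) (\<sigma> x) \<in> fibre E x" by (rule fscale_in_fibre [OF lb frameD(2) [OF \<sigma> x]])
  show "nonzero_vector E (fscale E (a x) (\<sigma> x))"
    using nonzero_fscale [OF lb frameD(2) [OF \<sigma> x]] frameD(3) [OF \<sigma> x] nz x S by blast
qed

lemma ratio_fscale_right:
  assumes lb: "line_bundle X E" and v: "v \<in> fibre E x" and w: "w \<in> fibre E x" "nonzero_vector E w" and c: "c \<noteq> 0"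
  shows "ratio E v (fscale E c w) = ratio E v w / c"
proof -
  have cw: "fscale E c w \<in> fibre E x" "nonzero_vector E (fscale E c w)"
    using fscale_in_fibre [OF lb w(1)] nonzero_fscale [OF lb w(1)] w(2) c by auto
  have "ratio E v (fscale E c w) * c = ratio E v w"
    using ratio_ratio [OF lb v cw(1) w(1) cw(2) w(2)] ratio_fscale_self [OF lb w] by simp
  then show ?thesis using c by (simp add: field_simps)
qed

text \<open>A change of the transition function by a factor \<open>exp (L u)\<close> is absorbed by rescaling one of the
  frames, because \<open>L\<close> extends from the equator to the whole projective line.\<close>

lemma bundle_iso_of_clutching:
  assumes E: "line_bundle CP1_Q E" and F: "line_bundle CP1_Q F"
    and t: "clutching E t" and t': "clutching F t'"
    and L: "continuous_map S1_Q euclidean L" and eq: "\<And>u. u \<in> topspace S1_Q \<Longrightarrow> t' u = t u * exp (L u)"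
  shows "bundle_iso E F"
proof -
  obtain \<sigma> \<tau> where \<sigma>: "frame CP1_Q E south \<sigma>" and \<tau>: "frame CP1_Q E north \<tau>"
    and tu: "\<And>u. u \<in> topspace S1_Q \<Longrightarrow> ratio E (\<tau> (susp_S1_Q u (1/2))) (\<sigma> (susp_S1_Q u (1/2))) = t u"
    using t unfolding clutching_def by blast
  obtain \<sigma>' \<tau>' where \<sigma>': "frame CP1_Q F south \<sigma>'" and \<tau>': "frame CP1_Q F north \<tau>'"
    and t'u: "\<And>u. u \<in> topspace S1_Q \<Longrightarrow> ratio F (\<tau>' (susp_S1_Q u (1/2))) (\<sigma>' (susp_S1_Q u (1/2))) = t' u"
    using t' unfolding clutching_def by blast
  \<comment> \<open>The factor \<open>4 * s * (1 - s)\<close> vanishes at both poles and is \<open>1\<close> on the equator.\<close>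
  have "continuous_map (prod_topology S1_Q (top_of_set {0..1})) euclidean
      (\<lambda>p. complex_of_real (4 * snd p * (1 - snd p)) * L (fst p))"
  proof (rule continuous_map_complex_mult)
    have "continuous_map (prod_topology S1_Q (top_of_set {0..1})) euclideanreal snd"
      using continuous_map_snd [of S1_Q "top_of_set {0..1::real}"] by (simp add: continuous_map_in_subtopology)
    then show "continuous_map (prod_topology S1_Q (top_of_set {0..1})) euclidean
        (\<lambda>p. complex_of_real (4 * snd p * (1 - snd p)))"
      by (rule continuous_map_apply [where S = UNIV and h = "\<lambda>s. complex_of_real (4 * s * (1 - s))", rotated])
        (auto intro!: continuous_intros)
    show "continuous_map (prod_topology S1_Q (top_of_set {0..1::real})) euclidean (\<lambda>p. L (fst p))"
      using continuous_map_compose [OF continuous_map_fst L] by (simp add: o_def)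
  qed
  then obtain M where M: "continuous_map CP1_Q euclidean M"
    "\<And>u s. u \<in> topspace S1_Q \<Longrightarrow> s \<in> {0..1} \<Longrightarrow> M (susp_S1_Q u s) = complex_of_real (4 * s * (1 - s)) * L u"
    by (rule descend_to_CP1_Q) auto
  have eM: "continuous_map CP1_Q euclidean (\<lambda>x. exp (M x))"
    by (rule continuous_map_apply [where S = UNIV, OF _ M(1)]) (auto intro!: continuous_intros)
  have "south \<subseteq> topspace CP1_Q" by (rule slice_subset) auto
  then have \<sigma>'': "frame CP1_Q F south (\<lambda>x. fscale F (exp (M x)) (\<sigma>' x))"
    by (intro frame_fscale [OF F \<sigma>' _ eM]) auto
  show ?thesis
  proof (rule bundle_iso_of_frames [OF E F south_north(1-3) \<sigma> \<tau> \<sigma>'' \<tau>'])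
    fix x assume "x \<in> south \<inter> north"
    then obtain u where u: "u \<in> topspace S1_Q" and x: "x = susp_S1_Q u (1/2)" using south_north(4) by blast
    have "M x = L u" using M(2) [OF u, of "1/2"] by (simp add: x)
    then have "ratio F (\<tau>' x) (fscale F (exp (M x)) (\<sigma>' x)) = t' u / exp (L u)"
      using ratio_fscale_right [OF F frameD(2) [OF \<tau>' equator(2) [OF u]] frameD(2,3) [OF \<sigma>' equator(1) [OF u]], of "exp (L u)"]
        t'u [OF u] by (simp add: x)
    then show "ratio E (\<tau> x) (\<sigma> x) = ratio F (\<tau>' x) (fscale F (exp (M x)) (\<sigma>' x))"
      using tu [OF u] eq [OF u] by (simp add: x)
  qed
qed

lemma frame_change_log:
  assumes lb: "line_bundle CP1_Q E" and J: "J \<subseteq> {0..1}" and e: "e = 0 \<or> e = 1" and seg: "closed_segment e (1/2) \<subseteq> J"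
    and \<sigma>: "frame CP1_Q E (slice J) \<sigma>" and \<sigma>': "frame CP1_Q E (slice J) \<sigma>'"
  obtains L where "continuous_map S1_Q euclidean L"
    "\<And>u. u \<in> topspace S1_Q \<Longrightarrow> ratio E (\<sigma> (susp_S1_Q u (1/2))) (\<sigma>' (susp_S1_Q u (1/2))) = exp (L u)"
proof (rule log_on_slice [OF J e seg])
  show "continuous_map (subtopology CP1_Q (slice J)) euclidean (\<lambda>x. ratio E (\<sigma> x) (\<sigma>' x))"
    by (rule continuous_ratio [OF lb frameD(1) [OF \<sigma>] frameD(1) [OF \<sigma>']])
      (use fibreD(2) [OF frameD(2) [OF \<sigma>]] fibreD(2) [OF frameD(2) [OF \<sigma>']] frameD(3) [OF \<sigma>'] in auto)
  show "ratio E (\<sigma> x) (\<sigma>' x) \<noteq> 0" if "x \<in> slice J" for x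
    using ratio_eq_0 [OF lb frameD(2) [OF \<sigma> that] frameD(2,3) [OF \<sigma>' that]] frameD(3) [OF \<sigma> that] by simp
qed (rule that)

text \<open>An isomorphism carries frames to frames, and any two frames over a hemisphere differ by a
  function without zeros, which has a logarithm on the equator.\<close>

lemma clutching_of_bundle_iso:
  assumes E: "line_bundle CP1_Q E" and F: "line_bundle CP1_Q F" and iso: "bundle_iso E F"
    and t: "clutching E t" and t': "clutching F t'"
  obtains L where "continuous_map S1_Q euclidean L" "\<And>u. u \<in> topspace S1_Q \<Longrightarrow> t' u = t u * exp (L u)"
proof -
  obtain \<sigma> \<tau> where \<sigma>: "frame CP1_Q E south \<sigma>" and \<tau>: "frame CP1_Q E north \<tau>"
    and tu: "\<And>u. u \<in> topspace S1_Q \<Longrightarrow> ratio E (\<tau> (susp_S1_Q u (1/2))) (\<sigma> (susp_S1_Q u (1/2))) = t u"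
    using t unfolding clutching_def by blast
  obtain \<sigma>' \<tau>' where \<sigma>': "frame CP1_Q F south \<sigma>'" and \<tau>': "frame CP1_Q F north \<tau>'"
    and t'u: "\<And>u. u \<in> topspace S1_Q \<Longrightarrow> ratio F (\<tau>' (susp_S1_Q u (1/2))) (\<sigma>' (susp_S1_Q u (1/2))) = t' u"
    using t' unfolding clutching_def by blast
  obtain h where h: "homeomorphic_map (total_space E) (total_space F) h"
    "\<And>x v. v \<in> fibre E x \<Longrightarrow> h v \<in> fibre F x"
    "\<And>x v w. v \<in> fibre E x \<Longrightarrow> w \<in> fibre E x \<Longrightarrow> h (fadd E v w) = fadd F (h v) (h w)"
    "\<And>x v c. v \<in> fibre E x \<Longrightarrow> h (fscale E c v) = fscale F c (h v)"
    "\<And>x v. v \<in> fibre E x \<Longrightarrow> nonzero_vector F (h v) \<longleftrightarrow> nonzero_vector E v"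
    by (rule bundle_isoE [OF E iso]) blast
  have hfr: "frame CP1_Q F S (\<lambda>x. h (\<rho> x))" if \<rho>: "frame CP1_Q E S \<rho>" for S \<rho>
  proof -
    have "continuous_map (subtopology CP1_Q S) (total_space F) (\<lambda>x. h (\<rho> x))"
      using continuous_map_compose [OF frameD(1) [OF \<rho>] homeomorphic_imp_continuous_map [OF h(1)]] by (simp add: o_def)
    then show ?thesis unfolding frame_def using h(2,5) frameD(2,3) [OF \<rho>] by blast
  qed
  obtain A where A: "continuous_map S1_Q euclidean A"
    "\<And>u. u \<in> topspace S1_Q \<Longrightarrow> ratio F (h (\<sigma> (susp_S1_Q u (1/2)))) (\<sigma>' (susp_S1_Q u (1/2))) = exp (A u)"
    by (rule frame_change_log [OF F _ _ _ hfr [OF \<sigma>] \<sigma>', of 0]) (auto simp: closed_segment_eq_real_ivl)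
  obtain B where B: "continuous_map S1_Q euclidean B"
    "\<And>u. u \<in> topspace S1_Q \<Longrightarrow> ratio F (\<tau>' (susp_S1_Q u (1/2))) (h (\<tau> (susp_S1_Q u (1/2)))) = exp (B u)"
    by (rule frame_change_log [OF F _ _ _ \<tau>' hfr [OF \<tau>], of 1]) (auto simp: closed_segment_eq_real_ivl)
  show ?thesis
  proof (rule that)
    show "continuous_map S1_Q euclidean (\<lambda>u. A u + B u)" by (intro continuous_intros A(1) B(1))
    fix u assume u: "u \<in> topspace S1_Q"
    let ?x = "susp_S1_Q u (1/2)"
    note \<sigma>x = frameD(2,3) [OF \<sigma> equator(1) [OF u]] and \<tau>x = frameD(2,3) [OF \<tau> equator(2) [OF u]]
    note \<sigma>'x = frameD(2,3) [OF \<sigma>' equator(1) [OF u]] and \<tau>'x = frameD(2,3) [OF \<tau>' equator(2) [OF u]]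
    have hn: "nonzero_vector F (h (\<sigma> ?x))" "nonzero_vector F (h (\<tau> ?x))"
      using h(5) [OF \<sigma>x(1)] h(5) [OF \<tau>x(1)] \<sigma>x \<tau>x by auto
    have "ratio F (h (\<tau> ?x)) (h (\<sigma> ?x)) = t u"
      using ratio_bundle_iso [OF E F \<tau>x(1) \<sigma>x h(2) [OF \<sigma>x(1)] h(4) [OF \<sigma>x(1)] hn(1)] tu [OF u] by simp
    moreover have "ratio F (\<tau>' ?x) (h (\<tau> ?x)) * (ratio F (h (\<tau> ?x)) (h (\<sigma> ?x)) * ratio F (h (\<sigma> ?x)) (\<sigma>' ?x))
        = ratio F (\<tau>' ?x) (\<sigma>' ?x)"
      unfolding ratio_ratio [OF F h(2) [OF \<tau>x(1)] h(2) [OF \<sigma>x(1)] \<sigma>'x(1) hn(1) \<sigma>'x(2)]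
      by (rule ratio_ratio [OF F \<tau>'x(1) h(2) [OF \<tau>x(1)] \<sigma>'x(1) hn(2) \<sigma>'x(2)])
    ultimately show "t' u = t u * exp (A u + B u)"
      using A(2) [OF u] B(2) [OF u] t'u [OF u] by (simp add: exp_add mult_ac)
  qed
qed

lemma clutching_tensor:
  assumes E: "line_bundle CP1_Q E" and F: "line_bundle CP1_Q F" and t: "clutching E t" and t': "clutching F t'"
  shows "clutching (tensor_bundle E F) (\<lambda>u. t u * t' u)"
proof -
  obtain \<sigma> \<tau> where \<sigma>: "frame CP1_Q E south \<sigma>" and \<tau>: "frame CP1_Q E north \<tau>"
    and tu: "\<And>u. u \<in> topspace S1_Q \<Longrightarrow> ratio E (\<tau> (susp_S1_Q u (1/2))) (\<sigma> (susp_S1_Q u (1/2))) = t u"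
    using t unfolding clutching_def by blast
  obtain \<sigma>' \<tau>' where \<sigma>': "frame CP1_Q F south \<sigma>'" and \<tau>': "frame CP1_Q F north \<tau>'"
    and t'u: "\<And>u. u \<in> topspace S1_Q \<Longrightarrow> ratio F (\<tau>' (susp_S1_Q u (1/2))) (\<sigma>' (susp_S1_Q u (1/2))) = t' u"
    using t' unfolding clutching_def by blast
  show ?thesis
    unfolding clutching_def
  proof (intro exI conjI ballI)
    show "frame CP1_Q (tensor_bundle E F) south (\<lambda>x. tensor_vec E F (\<sigma> x, \<sigma>' x))" by (rule frame_tensor [OF E F \<sigma> \<sigma>'])
    show "frame CP1_Q (tensor_bundle E F) north (\<lambda>x. tensor_vec E F (\<tau> x, \<tau>' x))" by (rule frame_tensor [OF E F \<tau> \<tau>'])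
    fix u assume u: "u \<in> topspace S1_Q"
    show "ratio (tensor_bundle E F) (tensor_vec E F (\<tau> (susp_S1_Q u (1/2)), \<tau>' (susp_S1_Q u (1/2))))
        (tensor_vec E F (\<sigma> (susp_S1_Q u (1/2)), \<sigma>' (susp_S1_Q u (1/2)))) = t u * t' u"
      unfolding ratio_tensor [OF E F frameD(2) [OF \<tau> equator(2) [OF u]] frameD(2,3) [OF \<sigma> equator(1) [OF u]]
          frameD(2) [OF \<tau>' equator(2) [OF u]] frameD(2,3) [OF \<sigma>' equator(1) [OF u]]]
      by (simp add: tu [OF u] t'u [OF u])
  qed
qed

lemma clutching_trivial: "clutching (trivial_bundle CP1_Q) (\<lambda>u. 1)"
proof -
  have fr: "frame CP1_Q (trivial_bundle CP1_Q) (slice J) (\<lambda>x. (x, 1))" if "J \<subseteq> {0..1}" for J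
    unfolding frame_def
  proof (intro conjI ballI)
    show "continuous_map (subtopology CP1_Q (slice J)) (total_space (trivial_bundle CP1_Q)) (\<lambda>x. (x, 1))"
      unfolding bundle_data_simps_trivial
      by (intro continuous_map_pairedI continuous_map_from_subtopology) auto
  qed (use slice_subset [OF that] in \<open>auto simp: fibre_trivial nonzero_vector_def bundle_data_simps_trivial\<close>)
  have "ratio (trivial_bundle CP1_Q) (x, 1) (x, 1) = 1" for x
    unfolding ratio_def by (rule the_equality) (auto simp: bundle_data_simps_trivial)
  then show ?thesis
    unfolding clutching_def using fr [of "{0..1/2}"] fr [of "{1/2..1}"] by auto
qed

subsection \<open>Suspended maps\<close>

lemma suspension_map_susp:
  assumes u: "u \<in> topspace S1_Q" and s: "s \<in> {0..1}" and g: "\<And>u. u \<in> topspace S1_Q \<Longrightarrow> g u \<noteq> 0"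
  shows "suspension_map g (susp_S1_Q u s) = susp_S1 (g u) s"
  unfolding suspension_map_def
proof (rule the_equality)
  show "\<exists>u'\<in>topspace S1_Q. \<exists>s'\<in>{0..1}. susp_S1_Q u s = susp_S1_Q u' s' \<and> susp_S1 (g u) s = susp_S1 (g u') s'"
    using u s by blast
  fix l assume "\<exists>u'\<in>topspace S1_Q. \<exists>s'\<in>{0..1}. susp_S1_Q u s = susp_S1_Q u' s' \<and> l = susp_S1 (g u') s'"
  then obtain u' s' where u': "u' \<in> topspace S1_Q" "s' \<in> {0..1}" "susp_S1_Q u s = susp_S1_Q u' s'" "l = susp_S1 (g u') s'"
    by blast
  have "s = s' \<and> (s = 0 \<or> s = 1 \<or> u = u')" using susp_S1_Q_eq_iff [OF u s u'(1,2)] u'(3) by blast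
  moreover have "proj_line (g u, 0) = proj_line (g u', 0)"
    using g [OF u] g [OF u'(1)] by (subst proj_line_eq_cross) (auto simp: zero_prod_def)
  ultimately show "l = susp_S1 (g u) s" by (auto simp: u'(4) susp_S1_def)
qed

lemma susp_S1_vector_nonzero:
  "a \<noteq> 0 \<Longrightarrow> (of_real s * a, of_real (1 - s)) \<noteq> (0 :: complex \<times> complex)"
  by (auto simp: zero_prod_def)

lemma continuous_suspension_map:
  assumes g: "continuous_map S1_Q S1 g"
  shows "continuous_map CP1_Q CP1 (suspension_map g)"
proof -
  have gc: "continuous_map S1_Q euclidean g" and gn: "\<And>u. u \<in> topspace S1_Q \<Longrightarrow> g u \<noteq> 0"
    using g by (auto simp: S1_def continuous_map_in_subtopology Pi_iff)
  have q: "quotient_map (prod_topology S1_Q (top_of_set {0..1})) CP1_Q (\<lambda>y. susp_S1_Q (fst y) (snd y))"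
    using quotient_map_susp_slice [of "{0..1}"] by (simp add: slice_unit_interval)
  let ?P = "prod_topology S1_Q (top_of_set {0..1::real})"
  have s: "continuous_map ?P euclideanreal snd"
    using continuous_map_snd [of S1_Q "top_of_set {0..1::real}"] by (simp add: continuous_map_in_subtopology)
  have gf: "continuous_map ?P euclidean (\<lambda>p. g (fst p))"
    using continuous_map_compose [OF continuous_map_fst gc] by (simp add: o_def)
  have "continuous_map ?P euclidean (\<lambda>p. complex_of_real (snd p))"
    by (rule continuous_map_apply [where S = UNIV and h = complex_of_real and f = snd, OF _ s])
      (auto intro!: continuous_intros)
  moreover have "continuous_map ?P euclidean (\<lambda>p. complex_of_real (1 - snd p))"
    by (rule continuous_map_apply [where S = UNIV and h = "\<lambda>s. complex_of_real (1 - s)" and f = snd, OF _ s])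
      (auto intro!: continuous_intros)
  ultimately have "continuous_map ?P CP1 (\<lambda>p. proj_line (of_real (snd p) * g (fst p), of_real (1 - snd p)))"
    by (intro continuous_map_into_CP1 continuous_map_complex_mult gf)
      (use gn in auto)
  then have "continuous_map ?P CP1 (suspension_map g \<circ> (\<lambda>y. susp_S1_Q (fst y) (snd y)))"
    by (rule continuous_map_eq) (use suspension_map_susp [where g = g, OF _ _ gn] in \<open>auto simp: susp_S1_def\<close>)
  then show ?thesis by (rule continuous_compose_quotient_map [OF q])
qed

text \<open>The forms \<open>z\<^sub>1\<close> and \<open>z\<^sub>0\<close> give frames of the Hopf bundle over the two hemispheres. Their ratio is the
  affine coordinate, which at the image of the equatorial point \<open>u\<close> is \<open>g u\<close>.\<close>

lemma clutching_suspension_map: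
  assumes g: "continuous_map S1_Q S1 g"
  shows "clutching (pullback_bundle CP1_Q (suspension_map g) hopf_bundle) g"
proof -
  let ?f = "suspension_map g" and ?P = "pullback_bundle CP1_Q (suspension_map g) hopf_bundle"
  have f: "continuous_map CP1_Q CP1 ?f" by (rule continuous_suspension_map [OF g])
  have gn: "g u \<noteq> 0" if "u \<in> topspace S1_Q" for u
    using continuous_map_in_topspace [OF g that] by (auto simp: S1_def)
  have fs: "?f (susp_S1_Q u s) = proj_line (of_real s * g u, of_real (1 - s))"
    if "u \<in> topspace S1_Q" "s \<in> {0..1}" for u s
    using suspension_map_susp [where g = g, OF that gn] by (simp add: susp_S1_def)
  have fr: "frame CP1_Q ?P (slice J) (\<lambda>x. (x, form_section a b (?f x)))"
    if J: "J \<subseteq> {0..1}" and dom: "\<And>u s. u \<in> topspace S1_Q \<Longrightarrow> s \<in> J \<Longrightarrow> linear_form a b (of_real s * g u, of_real (1 - s)) \<noteq> 0"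
    for J a b
    unfolding frame_def
  proof (intro conjI ballI)
    have "continuous_map (subtopology CP1_Q (slice J)) (total_space hopf_bundle) (\<lambda>x. form_section a b (?f x))"
      by (intro continuous_form_section continuous_map_from_subtopology f) auto
    moreover have "continuous_map (subtopology CP1_Q (slice J)) CP1_Q (\<lambda>x. x)"
      by (rule continuous_map_from_subtopology) simp
    ultimately show "continuous_map (subtopology CP1_Q (slice J)) (total_space ?P) (\<lambda>x. (x, form_section a b (?f x)))"
      by (intro continuous_map_into_pullback) (auto simp: hopf_simps(2) form_section_def)
    fix x assume x: "x \<in> slice J"
    then obtain u s where us: "u \<in> topspace S1_Q" "s \<in> J" "x = susp_S1_Q u s" by (auto simp: slice_def)
    have xX: "x \<in> topspace CP1_Q" using slice_subset [OF J] x by blast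
    have s01: "s \<in> {0..1}" using us(2) J by blast
    have "?f x \<in> form_domain a b"
      unfolding us(3) fs [OF us(1) s01] proj_line_in_form_domain [OF susp_S1_vector_nonzero [OF gn [OF us(1)]]]
      by (rule dom [OF us(1,2)])
    then show "(x, form_section a b (?f x)) \<in> fibre ?P x" "nonzero_vector ?P (x, form_section a b (?f x))"
      using xX form_section_in_fibre [OF continuous_map_in_topspace [OF f xX]] form_section_nonzero
      by (simp_all add: fibre_pullback nonzero_pullback)
  qed
  show ?thesis
    unfolding clutching_def
  proof (intro exI conjI ballI)
    show "frame CP1_Q ?P south (\<lambda>x. (x, form_section 0 1 (?f x)))"
      by (rule fr) (auto simp: linear_form_def)
    show "frame CP1_Q ?P north (\<lambda>x. (x, form_section 1 0 (?f x)))"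
      by (rule fr) (auto simp: linear_form_def gn)
    fix u assume u: "u \<in> topspace S1_Q"
    have half: "(1/2 :: real) \<in> {0..1}" by simp
    show "ratio ?P (susp_S1_Q u (1/2), form_section 1 0 (?f (susp_S1_Q u (1/2))))
        (susp_S1_Q u (1/2), form_section 0 1 (?f (susp_S1_Q u (1/2)))) = g u"
      unfolding ratio_pullback fs [OF u half]
      by (subst ratio_form_section [OF susp_S1_vector_nonzero [OF gn [OF u]]]) (simp_all add: linear_form_def)
  qed
qed

lemma homotopic_maps_log:
  assumes "homotopic_with (\<lambda>_. True) S1_Q S1 f g"
  obtains L where "continuous_map S1_Q euclidean L" "\<And>u. u \<in> topspace S1_Q \<Longrightarrow> f u = g u * exp (L u)"
proof -
  obtain h where h: "continuous_map (prod_topology (top_of_set {0..1::real}) S1_Q) S1 h" "\<And>u. h (0, u) = g u" "\<And>u. h (1, u) = f u"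
    using homotopic_with_symD [OF assms] unfolding homotopic_with_def by blast
  have "continuous_map (prod_topology S1_Q (top_of_set {0..1})) (prod_topology (top_of_set {0..1::real}) S1_Q) (\<lambda>p. (snd p, fst p))"
    by (intro continuous_map_pairedI continuous_map_fst continuous_map_snd)
  from continuous_map_compose [OF this h(1)]
  have H: "continuous_map (prod_topology S1_Q (top_of_set {0..1})) S1 (\<lambda>p. h (snd p, fst p))" by (simp add: o_def)
  then have Hc: "continuous_map (prod_topology S1_Q (top_of_set {0..1})) euclidean (\<lambda>p. h (snd p, fst p))"
    by (simp add: S1_def continuous_map_in_subtopology)
  obtain L where L: "continuous_map S1_Q euclidean L"
    "\<And>u. u \<in> topspace S1_Q \<Longrightarrow> h (snd (u, 1::real), fst (u, 1::real)) = h (snd (u, 0::real), fst (u, 0::real)) * exp (L u)"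
  proof (rule log_along_homotopy [OF compact_space_S1_Q Hc])
    fix u and s :: real assume "u \<in> topspace S1_Q" "s \<in> {0..1}"
    then have "(u, s) \<in> topspace (prod_topology S1_Q (top_of_set {0..1}))" by simp
    from continuous_map_in_topspace [OF H this] show "h (snd (u, s), fst (u, s)) \<noteq> 0" by (auto simp: S1_def)
  qed (rule that; blast)
  show ?thesis by (rule that [OF L(1)]) (use L(2) h(2,3) in simp)
qed

section \<open>Classification by the Chern number\<close>

text \<open>The character in the class of the transition function modulo exponentials. In contrast to the
  associated rational this refers only to the bundle itself, and it is visibly additive.\<close>

definition has_degree :: "('e, nat \<Rightarrow> cp1_point) bundle_data \<Rightarrow> rat \<Rightarrow> bool" where
  "has_degree E q \<longleftrightarrow>
     (\<exists>t L. clutching E t \<and> continuous_map S1_Q euclidean L \<and>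
        (\<forall>u\<in>topspace S1_Q. t u = solenoid_character q u * exp (L u)))"

lemma solenoid_character_nonzero: "u \<in> topspace S1_Q \<Longrightarrow> solenoid_character q u \<noteq> 0"
  using norm_solenoid_character [of u q] by auto

lemma exists_degree:
  assumes "line_bundle CP1_Q E"
  obtains q where "has_degree E q"
proof -
  obtain t where t: "clutching E t" by (rule exists_clutching [OF assms])
  note t' = clutching_continuous [OF assms t]
  obtain q L where L: "continuous_map S1_Q euclidean L"
    "\<And>u. u \<in> topspace S1_Q \<Longrightarrow> t u = solenoid_character q u * exp (L u)"
    using solenoid_map_log [OF t'(1)] t'(2) by metis
  show ?thesis by (rule that [of q]) (use L t in \<open>auto simp: has_degree_def\<close>)
qed

text \<open>Two characters that differ by an exponential have a quotient with a logarithm, so they are equal.\<close>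

lemma degree_bundle_iso:
  assumes E: "line_bundle CP1_Q E" and F: "line_bundle CP1_Q F" and iso: "bundle_iso E F"
    and q: "has_degree E q" and r: "has_degree F r"
  shows "q = r"
proof -
  obtain t L where t: "clutching E t" and L: "continuous_map S1_Q euclidean L"
    "\<And>u. u \<in> topspace S1_Q \<Longrightarrow> t u = solenoid_character q u * exp (L u)"
    using q unfolding has_degree_def by blast
  obtain t' L' where t': "clutching F t'" and L': "continuous_map S1_Q euclidean L'"
    "\<And>u. u \<in> topspace S1_Q \<Longrightarrow> t' u = solenoid_character r u * exp (L' u)"
    using r unfolding has_degree_def by blast
  obtain M where M: "continuous_map S1_Q euclidean M" "\<And>u. u \<in> topspace S1_Q \<Longrightarrow> t' u = t u * exp (M u)"
    by (rule clutching_of_bundle_iso [OF E F iso t t']) (rule that; blast)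
  have "continuous_map S1_Q euclidean (\<lambda>u. L u + M u - L' u)"
    by (intro continuous_intros L(1) M(1) L'(1))
  moreover have "solenoid_character (r - q) u = exp (L u + M u - L' u)" if u: "u \<in> topspace S1_Q" for u
  proof -
    have "solenoid_character q u * solenoid_character (r - q) u = solenoid_character r u"
      using solenoid_character_add [OF u, of q "r - q"] by simp
    moreover have "solenoid_character r u = solenoid_character q u * exp (L u + M u - L' u)"
      using L(2) [OF u] M(2) [OF u] L'(2) [OF u] by (simp add: exp_add exp_diff field_simps)
    ultimately show ?thesis using solenoid_character_nonzero [OF u, of q] by simp
  qed
  ultimately have "r - q = 0" by (rule solenoid_character_has_log)
  then show ?thesis by simp
qed

lemma bundle_iso_of_degree:
  assumes E: "line_bundle CP1_Q E" and F: "line_bundle CP1_Q F" and q: "has_degree E q" "has_degree F q"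
  shows "bundle_iso E F"
proof -
  obtain t L where t: "clutching E t" and L: "continuous_map S1_Q euclidean L"
    "\<And>u. u \<in> topspace S1_Q \<Longrightarrow> t u = solenoid_character q u * exp (L u)"
    using q(1) unfolding has_degree_def by blast
  obtain t' L' where t': "clutching F t'" and L': "continuous_map S1_Q euclidean L'"
    "\<And>u. u \<in> topspace S1_Q \<Longrightarrow> t' u = solenoid_character q u * exp (L' u)"
    using q(2) unfolding has_degree_def by blast
  show ?thesis
  proof (rule bundle_iso_of_clutching [OF E F t t'])
    show "continuous_map S1_Q euclidean (\<lambda>u. L' u - L u)" by (intro continuous_intros L(1) L'(1))
    show "t' u = t u * exp (L' u - L u)" if "u \<in> topspace S1_Q" for u
      using L(2) [OF that] L'(2) [OF that] by (simp add: exp_diff)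
  qed
qed

lemma degree_tensor:
  assumes E: "line_bundle CP1_Q E" and F: "line_bundle CP1_Q F" and q: "has_degree E q" and r: "has_degree F r"
  shows "has_degree (tensor_bundle E F) (q + r)"
proof -
  obtain t L where t: "clutching E t" and L: "continuous_map S1_Q euclidean L"
    "\<And>u. u \<in> topspace S1_Q \<Longrightarrow> t u = solenoid_character q u * exp (L u)"
    using q unfolding has_degree_def by blast
  obtain t' L' where t': "clutching F t'" and L': "continuous_map S1_Q euclidean L'"
    "\<And>u. u \<in> topspace S1_Q \<Longrightarrow> t' u = solenoid_character r u * exp (L' u)"
    using r unfolding has_degree_def by blast
  show ?thesis
    unfolding has_degree_def
  proof (intro exI conjI ballI)
    show "clutching (tensor_bundle E F) (\<lambda>u. t u * t' u)" by (rule clutching_tensor [OF E F t t'])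
    show "continuous_map S1_Q euclidean (\<lambda>u. L u + L' u)" by (intro continuous_intros L(1) L'(1))
    show "t u * t' u = solenoid_character (q + r) u * exp (L u + L' u)" if "u \<in> topspace S1_Q" for u
      using L(2) [OF that] L'(2) [OF that] solenoid_character_add [OF that] by (simp add: exp_add)
  qed
qed

lemma degree_trivial: "has_degree (trivial_bundle CP1_Q) 0"
  unfolding has_degree_def
proof (intro exI conjI ballI)
  show "clutching (trivial_bundle CP1_Q) (\<lambda>u. 1)" by (rule clutching_trivial)
  show "continuous_map S1_Q euclidean (\<lambda>u. 0 :: complex)" by simp
  show "1 = solenoid_character 0 u * exp 0" for u by (simp add: solenoid_character_0)
qed

lemma degree_suspension_map:
  assumes g: "continuous_map S1_Q S1 g" and h: "homotopic_with (\<lambda>_. True) S1_Q S1 g (solenoid_character q)"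
  shows "has_degree (pullback_bundle CP1_Q (suspension_map g) hopf_bundle) q"
proof -
  obtain L where "continuous_map S1_Q euclidean L" "\<And>u. u \<in> topspace S1_Q \<Longrightarrow> g u = solenoid_character q u * exp (L u)"
    by (rule homotopic_maps_log [OF h]) (rule that; blast)
  then show ?thesis unfolding has_degree_def using clutching_suspension_map [OF g] by blast
qed

lemma line_bundle_suspension_map:
  "continuous_map S1_Q S1 g \<Longrightarrow> line_bundle CP1_Q (pullback_bundle CP1_Q (suspension_map g) hopf_bundle)"
  by (rule line_bundle_pullback [OF line_bundle_hopf continuous_suspension_map])

lemma continuous_solenoid_character_S1: "continuous_map S1_Q S1 (solenoid_character q)"
  unfolding S1_def
  by (intro continuous_map_into_subtopology continuous_solenoid_character) (use norm_solenoid_character in auto)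

text \<open>The pullback of the Hopf bundle by the suspension of \<open>g\<close> has the transition function \<open>g\<close>, and
  homotopic maps to the circle differ by an exponential. Conversely, a bundle of degree \<open>q\<close> is
  isomorphic to the pullback by the suspension of the character with index \<open>q\<close>.\<close>

lemma associated_rational_iff_degree:
  assumes E: "line_bundle CP1_Q E"
  shows "associated_rational E q \<longleftrightarrow> has_degree E q"
proof
  assume "associated_rational E q"
  then obtain g where g: "continuous_map S1_Q S1 g"
    and iso: "bundle_iso E (pullback_bundle CP1_Q (suspension_map g) hopf_bundle)"
    and h: "homotopic_with (\<lambda>_. True) S1_Q S1 g (solenoid_character q)"
    unfolding associated_rational_def by blast
  obtain r where r: "has_degree E r" by (rule exists_degree [OF E])
  have "r = q"
    by (rule degree_bundle_iso [OF E line_bundle_suspension_map [OF g] iso r degree_suspension_map [OF g h]])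
  then show "has_degree E q" using r by simp
next
  assume q: "has_degree E q"
  let ?\<chi> = "solenoid_character q"
  note c = continuous_solenoid_character_S1 [of q]
  have h: "homotopic_with (\<lambda>_. True) S1_Q S1 ?\<chi> ?\<chi>" using c by simp
  have "bundle_iso E (pullback_bundle CP1_Q (suspension_map ?\<chi>) hopf_bundle)"
    by (rule bundle_iso_of_degree [OF E line_bundle_suspension_map [OF c] q degree_suspension_map [OF c h]])
  then show "associated_rational E q" unfolding associated_rational_def using c h by blast
qed

lemma first_chern_number_eq:
  assumes E: "line_bundle CP1_Q E" and q: "has_degree E q"
  shows "first_chern_number E = q"
  unfolding first_chern_number_def
proof (rule the_equality)
  show "associated_rational E q" using associated_rational_iff_degree [OF E] q by blast
  fix r assume "associated_rational E r"
  then have "has_degree E r" using associated_rational_iff_degree [OF E] by blast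
  then show "r = q" using degree_bundle_iso [OF E E bundle_iso_refl _ q] by blast
qed

lemma degree_first_chern_number:
  assumes E: "line_bundle CP1_Q E"
  shows "has_degree E (first_chern_number E)"
proof -
  obtain q where "has_degree E q" by (rule exists_degree [OF E])
  then show ?thesis using first_chern_number_eq [OF E] by simp
qed

lemma bundle_iso_iff_first_chern_number:
  assumes E: "line_bundle CP1_Q E" and F: "line_bundle CP1_Q F"
  shows "bundle_iso E F \<longleftrightarrow> first_chern_number E = first_chern_number F"
  using degree_bundle_iso [OF E F _ degree_first_chern_number [OF E] degree_first_chern_number [OF F]]
    bundle_iso_of_degree [OF E F degree_first_chern_number [OF E]] degree_first_chern_number [OF F] by metis

lemma first_chern_number_tensor:
  assumes E: "line_bundle CP1_Q E" and F: "line_bundle CP1_Q F"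
  shows "first_chern_number (tensor_bundle E F) = first_chern_number E + first_chern_number F"
  by (rule first_chern_number_eq [OF line_bundle_tensor [OF E F]
    degree_tensor [OF E F degree_first_chern_number [OF E] degree_first_chern_number [OF F]]])

lemma exists_line_bundle_with_chern_number:
  obtains E :: "((nat \<Rightarrow> cp1_point) \<times> complex, nat \<Rightarrow> cp1_point) bundle_data"
  where "line_bundle CP1_Q E" "first_chern_number E = q"
proof -
  let ?P = "pullback_bundle CP1_Q (suspension_map (solenoid_character q)) hopf_bundle"
  note c = continuous_solenoid_character_S1 [of q]
  have P: "line_bundle CP1_Q ?P" by (rule line_bundle_suspension_map [OF c])
  have "homotopic_with (\<lambda>_. True) S1_Q S1 (solenoid_character q) (solenoid_character q)" using c by simp
  from first_chern_number_eq [OF P degree_suspension_map [OF c this]] have q: "first_chern_number ?P = q" .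
  obtain E :: "((nat \<Rightarrow> cp1_point) \<times> complex, nat \<Rightarrow> cp1_point) bundle_data"
    where E: "line_bundle CP1_Q E" "bundle_iso ?P E" by (rule exists_isomorphic_copy [OF P])
  show ?thesis
    using that [OF E(1)] bundle_iso_iff_first_chern_number [OF P E(1)] E(2) q by simp
qed

definition chern_class :: "rat \<Rightarrow> ((nat \<Rightarrow> cp1_point) \<times> complex, nat \<Rightarrow> cp1_point) bundle_data set" where
  "chern_class q = {F. line_bundle CP1_Q F \<and> first_chern_number F = q}"

lemma bundle_class_eq_chern_class:
  assumes "line_bundle CP1_Q E"
  shows "bundle_class CP1_Q E = chern_class (first_chern_number E)"
  using bundle_iso_iff_first_chern_number [OF _ assms] by (auto simp: bundle_class_def chern_class_def)

lemma chern_class_nonempty: obtains E where "E \<in> chern_class q"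
  using exists_line_bundle_with_chern_number [of q] unfolding chern_class_def by blast

lemma inj_chern_class: "chern_class q = chern_class r \<Longrightarrow> q = r"
  using chern_class_nonempty [of q] unfolding chern_class_def by blast

text \<open>The Chern number identifies the set of isomorphism classes with the rational numbers, and all
  tensor products of representatives of two classes have the same Chern number.\<close>

lemma line_bundle_group_simps:
  "carrier (line_bundle_group CP1_Q) = range chern_class"
  "chern_class q \<otimes>\<^bsub>line_bundle_group CP1_Q\<^esub> chern_class r = chern_class (q + r)"
  "\<one>\<^bsub>line_bundle_group CP1_Q\<^esub> = chern_class 0"
proof -
  have "chern_class q \<in> carrier (line_bundle_group CP1_Q)" for q
  proof -
    obtain E where E: "E \<in> chern_class q" by (rule chern_class_nonempty)
    then have "line_bundle CP1_Q E" "chern_class q = bundle_class CP1_Q E"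
      using bundle_class_eq_chern_class [of E] by (auto simp: chern_class_def)
    then show ?thesis unfolding line_bundle_group_def by auto
  qed
  then show "carrier (line_bundle_group CP1_Q) = range chern_class"
    by (auto simp: line_bundle_group_def bundle_class_eq_chern_class)
  have tensor: "bundle_class CP1_Q (tensor_bundle E F) = chern_class (q + r)"
    if EF: "E \<in> chern_class q" "F \<in> chern_class r" for E F
  proof -
    have E: "line_bundle CP1_Q E" "first_chern_number E = q" and F: "line_bundle CP1_Q F" "first_chern_number F = r"
      using EF by (auto simp: chern_class_def)
    show ?thesis
      using bundle_class_eq_chern_class [OF line_bundle_tensor [OF E(1) F(1)]] first_chern_number_tensor [OF E(1) F(1)]
      by (simp add: E(2) F(2))
  qed
  obtain E0 where E0: "E0 \<in> chern_class q" by (rule chern_class_nonempty)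
  obtain F0 where F0: "F0 \<in> chern_class r" by (rule chern_class_nonempty)
  have "chern_class q \<otimes>\<^bsub>line_bundle_group CP1_Q\<^esub> chern_class r
      = (\<Union>E\<in>chern_class q. \<Union>F\<in>chern_class r. bundle_class CP1_Q (tensor_bundle E F))"
    by (simp add: line_bundle_group_def)
  also have "\<dots> = (\<Union>E\<in>chern_class q. \<Union>F\<in>chern_class r. chern_class (q + r))"
    by (intro SUP_cong refl tensor)
  also have "\<dots> = chern_class (q + r)" using E0 F0 by blast
  finally show "chern_class q \<otimes>\<^bsub>line_bundle_group CP1_Q\<^esub> chern_class r = chern_class (q + r)" .
  show "\<one>\<^bsub>line_bundle_group CP1_Q\<^esub> = chern_class 0"
    using bundle_class_eq_chern_class [OF line_bundle_trivial] first_chern_number_eq [OF line_bundle_trivial degree_trivial]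
    by (simp add: line_bundle_group_def)
qed

theorem theorem4:
  shows "comm_group (line_bundle_group CP1_Q) \<and>
    (\<exists>\<psi> \<in> iso (line_bundle_group CP1_Q) rational_group.
       \<forall>E :: ('e, nat \<Rightarrow> cp1_point) bundle_data. line_bundle CP1_Q E \<longrightarrow>
         bundle_class CP1_Q E \<in> carrier (line_bundle_group CP1_Q) \<and>
         \<psi> (bundle_class CP1_Q E) = first_chern_number E) \<and>
    (\<forall>E :: ('e, nat \<Rightarrow> cp1_point) bundle_data. line_bundle CP1_Q E \<longrightarrow>
       (\<exists>!q. associated_rational E q) \<and> associated_rational E (first_chern_number E)) \<and>
    (\<forall>(E :: ('e, nat \<Rightarrow> cp1_point) bundle_data) (F :: ('f, nat \<Rightarrow> cp1_point) bundle_data).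
       line_bundle CP1_Q E \<longrightarrow> line_bundle CP1_Q F \<longrightarrow>
         line_bundle CP1_Q (tensor_bundle E F) \<and>
         first_chern_number (tensor_bundle E F) = first_chern_number E + first_chern_number F)"
proof (intro conjI)
  let ?G = "line_bundle_group CP1_Q"
  note G = line_bundle_group_simps
  show "comm_group ?G"
  proof (rule comm_groupI)
    fix x assume "x \<in> carrier ?G"
    then obtain q where q: "x = chern_class q" unfolding G by blast
    have "chern_class (- q) \<otimes>\<^bsub>?G\<^esub> x = \<one>\<^bsub>?G\<^esub>" by (simp add: q G)
    then show "\<exists>y\<in>carrier ?G. y \<otimes>\<^bsub>?G\<^esub> x = \<one>\<^bsub>?G\<^esub>" unfolding G(1) by blast
  qed (auto simp: G add_ac)
  define \<psi> where "\<psi> = the_inv chern_class"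
  have inj: "inj chern_class" using inj_chern_class by (rule injI)
  have \<psi>: "\<psi> (chern_class q) = q" for q unfolding \<psi>_def by (rule the_inv_f_f [OF inj])
  have "\<psi> \<in> iso ?G rational_group"
  proof (rule isoI)
    show "\<psi> \<in> hom ?G rational_group"
      by (rule homI) (auto simp: G \<psi> rational_group_def)
    show "bij_betw \<psi> (carrier ?G) (carrier rational_group)"
      by (rule bij_betw_byWitness [where f' = chern_class]) (auto simp: G \<psi> rational_group_def)
  qed
  then show "\<exists>\<psi> \<in> iso ?G rational_group. \<forall>E :: ('e, nat \<Rightarrow> cp1_point) bundle_data. line_bundle CP1_Q E \<longrightarrow>
         bundle_class CP1_Q E \<in> carrier ?G \<and> \<psi> (bundle_class CP1_Q E) = first_chern_number E"
    by (intro bexI [of _ \<psi>]) (auto simp: G bundle_class_eq_chern_class \<psi>)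
  show "\<forall>E :: ('e, nat \<Rightarrow> cp1_point) bundle_data. line_bundle CP1_Q E \<longrightarrow>
       (\<exists>!q. associated_rational E q) \<and> associated_rational E (first_chern_number E)"
  proof (intro allI impI)
    fix E :: "('e, nat \<Rightarrow> cp1_point) bundle_data" assume E: "line_bundle CP1_Q E"
    have "associated_rational E (first_chern_number E)"
      using associated_rational_iff_degree [OF E] degree_first_chern_number [OF E] by blast
    moreover have "q = first_chern_number E" if "associated_rational E q" for q
      using that associated_rational_iff_degree [OF E] first_chern_number_eq [OF E] by blast
    ultimately show "(\<exists>!q. associated_rational E q) \<and> associated_rational E (first_chern_number E)" by blast
  qed
  show "\<forall>(E :: ('e, nat \<Rightarrow> cp1_point) bundle_data) (F :: ('f, nat \<Rightarrow> cp1_point) bundle_data).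
       line_bundle CP1_Q E \<longrightarrow> line_bundle CP1_Q F \<longrightarrow>
         line_bundle CP1_Q (tensor_bundle E F) \<and>
         first_chern_number (tensor_bundle E F) = first_chern_number E + first_chern_number F"
    using line_bundle_tensor first_chern_number_tensor by blast
qed

end
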